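(* Let $\mathbb A$ be an abelian category with enough projective objects. Then the 2-category $\mathbb A^{[1]}_c$ is a 2-abelian $\mathsf{Gpd}$-category (in the sense of M. Dupont). Moreover: (a) the category of discrete objects of $\mathbb A^{[1]}_c$ (objects: discrete objects; morphisms: 2-isomorphism classes of morphisms) is equivalent to $\mathbb A$, via $a\mapsto \mathrm{Coker}(a)$; (b) the category of codiscrete objects of $\mathbb A^{[1]}_c$ (objects: codiscrete objects; morphisms: 2-isomorphism classes of morphisms) is equivalent to $\mathbb A$, via $a\mapsto \mathrm{Ker}(a)$.
   Context: Let $\mathbb A$ be an abelian category. The 2-category $\mathbb A^{[1]}$ has as objects the morphisms $a:A_1\to A_0$ of $\mathbb A$. For objects $a:A_1\to A_0$ and $b:B_1\to B_0$, a morphism $a\to b$ is a pair $(f_0,f_1)$ of morphisms $f_i:A_i\to B_i$ of $\mathbb A$ with $b f_1=f_0 a$; composition is componentwise. A 2-arrow $(f_0,f_1)\Rightarrow(g_0,g_1)$ between morphisms $a\to b$ is a morphism $\alpha:A_0\to B_1$ of $\mathbb A$ with $f_1-g_1=\alpha a$ and $f_0-g_0=b\alpha$; vertical composition is addition of such $\alpha$'s, and whiskering is given by $(h_0,h_1)\circ\alpha=h_1\alpha$ and $\alpha\circ(e_0,e_1)=\alpha e_0$. All 2-arrows are invertible, so each $\mathbf{Hom}(a,b)$ is a groupoid; the zero object is $0\to 0$. $\mathbb A^{[1]}_c$ is the full 2-subcategory of $\mathbb A^{[1]}$ on the objects $a:A_1\to A_0$ with $A_0$ projective in $\mathbb A$.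 In a 2-category $\mathcal C$ with invertible 2-arrows (a $\mathsf{Gpd}$-category) and zero object: a morphism $f:a\to b$ is faithful (resp. fully faithful) if for every object $x$ the functor $f\circ-:\mathbf{Hom}(x,a)\to\mathbf{Hom}(x,b)$ is faithful (resp. full and faithful); it is cofaithful (resp. fully cofaithful) if for every $x$ the functor $-\circ f:\mathbf{Hom}(b,x)\to\mathbf{Hom}(a,x)$ is faithful (resp. full and faithful). An object $a$ is discrete if $a\to 0$ is faithful and codiscrete if $0\to a$ is cofaithful. A 2-kernel of $f:a\to b$ is a triple $(k,u:k\to a,\kappa:fu\Rightarrow 0)$ such that for every $x$ the functor $v\mapsto (uv,\kappa v)$ from $\mathbf{Hom}(x,k)$ to the groupoid of pairs $(w\in\mathbf{Hom}(x,a),\ \phi:fw\Rightarrow 0)$ is an equivalence; a 2-cokernel is defined dually. A pip of $f:a\to b$ is a universal pair $(p,\pi)$ with $\pi:0\Rightarrow 0$ a 2-arrow between zero morphisms $p\to a$ and $f\pi=\mathrm{id}$; a root of a 2-arrow $\alpha:0\Rightarrow0$ between morphisms $a\to b$ is a universal morphism $r:R\to a$ with $\alpha r=\mathrm{id}$; copips and coroots are dual. Following Dupont, a $\mathsf{Gpd}$-category is 2-abelian if it is 2-additive (hom-groupoids are symmetric 2-groups, composition is bilinear, finite biproducts exist), it has all 2-kernels, 2-cokernels, pips, copips, roots and coroots, and it is 2-Puppe-exact: every faithful morphism is the 2-kernel of its 2-cokernel, every cofaithful morphism is the 2-cokernel of its 2-kernel, every fully faithful morphism is the root of its copip, and every fully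 cofaithful morphism is the coroot of its pip. *)

theory Defs
  imports Main
begin

text \<open>Cmp A g f is the composite g o f (defined when Cod f = Dom g).
  Add, Neg, Zro give the additive (preadditive) structure on hom-sets.\<close>

record ('o,'m) acat =
  Dom :: "'m \<Rightarrow> 'o"
  Cod :: "'m \<Rightarrow> 'o"
  Cmp :: "'m \<Rightarrow> 'm \<Rightarrow> 'm"
  Idt :: "'o \<Rightarrow> 'm"
  Zro :: "'o \<Rightarrow> 'o \<Rightarrow> 'm"
  Add :: "'m \<Rightarrow> 'm \<Rightarrow> 'm"
  Neg :: "'m \<Rightarrow> 'm"

definition hom :: "('o,'m) acat \<Rightarrow> 'o \<Rightarrow> 'o \<Rightarrow> 'm set" where
  "hom A x y = {f. Dom A f = x \<and> Cod A f = y}"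

definition msub :: "('o,'m) acat \<Rightarrow> 'm \<Rightarrow> 'm \<Rightarrow> 'm" where
  "msub A f g = Add A f (Neg A g)"

definition is_category :: "('o,'m) acat \<Rightarrow> bool" where
  "is_category A \<longleftrightarrow>
     (\<forall>f g. Cod A f = Dom A g \<longrightarrow>
        Dom A (Cmp A g f) = Dom A f \<and> Cod A (Cmp A g f) = Cod A g) \<and>
     (\<forall>x. Idt A x \<in> hom A x x) \<and>
     (\<forall>f. Cmp A f (Idt A (Dom A f)) = f \<and> Cmp A (Idt A (Cod A f)) f = f) \<and>
     (\<forall>f g h. Cod A f = Dom A g \<and> Cod A g = Dom A h \<longrightarrow>
        Cmp A h (Cmp A g f) = Cmp A (Cmp A h g) f)"

definition preadditive :: "('o,'m) acat \<Rightarrow> bool" where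
  "preadditive A \<longleftrightarrow>
     (\<forall>x y. Zro A x y \<in> hom A x y \<and>
        (\<forall>f\<in>hom A x y. \<forall>g\<in>hom A x y. \<forall>h\<in>hom A x y.
           Add A f g \<in> hom A x y \<and> Neg A f \<in> hom A x y \<and>
           Add A (Add A f g) h = Add A f (Add A g h) \<and>
           Add A f g = Add A g f \<and>
           Add A f (Zro A x y) = f \<and>
           Add A f (Neg A f) = Zro A x y)) \<and>
     (\<forall>w x y z f g h k. f \<in> hom A x y \<and> g \<in> hom A x y \<and> h \<in> hom A y z \<and> k \<in> hom A w x \<longrightarrow>
        Cmp A h (Add A f g) = Add A (Cmp A h f) (Cmp A h g) \<and>
        Cmp A (Add A f g) k = Add A (Cmp A f k) (Cmp A g k))"

definition has_zero_object :: "('o,'m) acat \<Rightarrow> bool" where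
  "has_zero_object A \<longleftrightarrow>
     (\<exists>z. \<forall>x. (\<exists>!f. f \<in> hom A z x) \<and> (\<exists>!f. f \<in> hom A x z))"

definition has_biproducts :: "('o,'m) acat \<Rightarrow> bool" where
  "has_biproducts A \<longleftrightarrow>
     (\<forall>x y. \<exists>s i1 i2 p1 p2.
        i1 \<in> hom A x s \<and> i2 \<in> hom A y s \<and> p1 \<in> hom A s x \<and> p2 \<in> hom A s y \<and>
        Cmp A p1 i1 = Idt A x \<and> Cmp A p2 i2 = Idt A y \<and>
        Cmp A p1 i2 = Zro A y x \<and> Cmp A p2 i1 = Zro A x y \<and>
        Add A (Cmp A i1 p1) (Cmp A i2 p2) = Idt A s)"

definition is_kernel :: "('o,'m) acat \<Rightarrow> 'm \<Rightarrow> 'm \<Rightarrow> bool" where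
  "is_kernel A f k \<longleftrightarrow>
     Cod A k = Dom A f \<and> Cmp A f k = Zro A (Dom A k) (Cod A f) \<and>
     (\<forall>g. Cod A g = Dom A f \<and> Cmp A f g = Zro A (Dom A g) (Cod A f) \<longrightarrow>
        (\<exists>!h. h \<in> hom A (Dom A g) (Dom A k) \<and> Cmp A k h = g))"

definition is_cokernel :: "('o,'m) acat \<Rightarrow> 'm \<Rightarrow> 'm \<Rightarrow> bool" where
  "is_cokernel A f c \<longleftrightarrow>
     Dom A c = Cod A f \<and> Cmp A c f = Zro A (Dom A f) (Cod A c) \<and>
     (\<forall>g. Dom A g = Cod A f \<and> Cmp A g f = Zro A (Dom A f) (Cod A g) \<longrightarrow>
        (\<exists>!h. h \<in> hom A (Cod A c) (Cod A g) \<and> Cmp A h c = g))"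

definition mono :: "('o,'m) acat \<Rightarrow> 'm \<Rightarrow> bool" where
  "mono A m \<longleftrightarrow> (\<forall>g h. Cod A g = Dom A m \<and> Cod A h = Dom A m \<and> Dom A g = Dom A h \<and>
                       Cmp A m g = Cmp A m h \<longrightarrow> g = h)"

definition epi :: "('o,'m) acat \<Rightarrow> 'm \<Rightarrow> bool" where
  "epi A e \<longleftrightarrow> (\<forall>g h. Dom A g = Cod A e \<and> Dom A h = Cod A e \<and> Cod A g = Cod A h \<and>
                      Cmp A g e = Cmp A h e \<longrightarrow> g = h)"

definition abelian :: "('o,'m) acat \<Rightarrow> bool" where
  "abelian A \<longleftrightarrow> is_category A \<and> preadditive A \<and> has_zero_object A \<and> has_biproducts A \<and>
     (\<forall>f. \<exists>k. is_kernel A f k) \<and> (\<forall>f. \<exists>c. is_cokernel A f c) \<and>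
     (\<forall>m. mono A m \<longrightarrow> (\<exists>f. is_kernel A f m)) \<and>
     (\<forall>e. epi A e \<longrightarrow> (\<exists>f. is_cokernel A f e))"

definition projective :: "('o,'m) acat \<Rightarrow> 'o \<Rightarrow> bool" where
  "projective A P \<longleftrightarrow>
     (\<forall>e g. epi A e \<and> g \<in> hom A P (Cod A e) \<longrightarrow> (\<exists>h\<in>hom A P (Dom A e). Cmp A e h = g))"

definition enough_projectives :: "('o,'m) acat \<Rightarrow> bool" where
  "enough_projectives A \<longleftrightarrow> (\<forall>X. \<exists>P e. projective A P \<and> epi A e \<and> e \<in> hom A P X)"

definition isomorphic :: "('o,'m) acat \<Rightarrow> 'o \<Rightarrow> 'o \<Rightarrow> bool" where
  "isomorphic A X Y \<longleftrightarrow> (\<exists>h g. h \<in> hom A X Y \<and> g \<in> hom A Y X \<and>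
       Cmp A g h = Idt A X \<and> Cmp A h g = Idt A Y)"

text \<open>Objects: arrows a : Dom a -> Cod a of A with Cod a projective (A_1 = Dom a, A_0 = Cod a).
  1-cells a -> b: pairs (f0, f1) with b f1 = f0 a.  2-cells (f0,f1) => (g0,g1):
  alpha : Cod a -> Dom b with f1 - g1 = alpha a and f0 - g0 = b alpha.
  Vertical composition of 2-cells is Add, identity 2-cells are zero arrows,
  whiskering: h o alpha = h1 alpha, alpha o e = alpha e0.\<close>

definition c_obj :: "('o,'m) acat \<Rightarrow> 'm \<Rightarrow> bool" where
  "c_obj A a \<longleftrightarrow> projective A (Cod A a)"

definition c_mor :: "('o,'m) acat \<Rightarrow> 'm \<Rightarrow> 'm \<Rightarrow> 'm \<times> 'm \<Rightarrow> bool" where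
  "c_mor A a b f \<longleftrightarrow> fst f \<in> hom A (Cod A a) (Cod A b) \<and> snd f \<in> hom A (Dom A a) (Dom A b) \<and>
     Cmp A b (snd f) = Cmp A (fst f) a"

definition c_cell :: "('o,'m) acat \<Rightarrow> 'm \<Rightarrow> 'm \<Rightarrow> 'm \<times> 'm \<Rightarrow> 'm \<times> 'm \<Rightarrow> 'm \<Rightarrow> bool" where
  "c_cell A a b f g \<alpha> \<longleftrightarrow> c_mor A a b f \<and> c_mor A a b g \<and> \<alpha> \<in> hom A (Cod A a) (Dom A b) \<and>
     msub A (snd f) (snd g) = Cmp A \<alpha> a \<and> msub A (fst f) (fst g) = Cmp A b \<alpha>"

definition c_comp :: "('o,'m) acat \<Rightarrow> 'm \<times> 'm \<Rightarrow> 'm \<times> 'm \<Rightarrow> 'm \<times> 'm" where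
  "c_comp A g f = (Cmp A (fst g) (fst f), Cmp A (snd g) (snd f))"

definition c_id :: "('o,'m) acat \<Rightarrow> 'm \<Rightarrow> 'm \<times> 'm" where
  "c_id A a = (Idt A (Cod A a), Idt A (Dom A a))"

definition c_zero :: "('o,'m) acat \<Rightarrow> 'm \<Rightarrow> 'm \<Rightarrow> 'm \<times> 'm" where
  "c_zero A a b = (Zro A (Cod A a) (Cod A b), Zro A (Dom A a) (Dom A b))"

definition c_add :: "('o,'m) acat \<Rightarrow> 'm \<times> 'm \<Rightarrow> 'm \<times> 'm \<Rightarrow> 'm \<times> 'm" where
  "c_add A f g = (Add A (fst f) (fst g), Add A (snd f) (snd g))"

definition c_neg :: "('o,'m) acat \<Rightarrow> 'm \<times> 'm \<Rightarrow> 'm \<times> 'm" where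
  "c_neg A f = (Neg A (fst f), Neg A (snd f))"

definition c_idcell :: "('o,'m) acat \<Rightarrow> 'm \<Rightarrow> 'm \<Rightarrow> 'm" where
  "c_idcell A a b = Zro A (Cod A a) (Dom A b)"

definition wl :: "('o,'m) acat \<Rightarrow> 'm \<times> 'm \<Rightarrow> 'm \<Rightarrow> 'm" where
  "wl A h \<alpha> = Cmp A (snd h) \<alpha>"

definition wr :: "('o,'m) acat \<Rightarrow> 'm \<Rightarrow> 'm \<times> 'm \<Rightarrow> 'm" where
  "wr A \<alpha> e = Cmp A \<alpha> (fst e)"

definition c_zero_obj :: "('o,'m) acat \<Rightarrow> 'm \<Rightarrow> bool" where
  "c_zero_obj A z \<longleftrightarrow> c_obj A z \<and>
     (\<forall>x. c_obj A x \<longrightarrow>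
        (\<exists>f. c_mor A x z f) \<and> (\<forall>f g. c_mor A x z f \<and> c_mor A x z g \<longrightarrow> (\<exists>!\<alpha>. c_cell A x z f g \<alpha>)) \<and>
        (\<exists>f. c_mor A z x f) \<and> (\<forall>f g. c_mor A z x f \<and> c_mor A z x g \<longrightarrow> (\<exists>!\<alpha>. c_cell A z x f g \<alpha>)))"

definition c_faithful :: "('o,'m) acat \<Rightarrow> 'm \<Rightarrow> 'm \<Rightarrow> 'm \<times> 'm \<Rightarrow> bool" where
  "c_faithful A a b f \<longleftrightarrow> c_obj A a \<and> c_obj A b \<and> c_mor A a b f \<and>
     (\<forall>x g h \<alpha> \<beta>. c_obj A x \<and> c_cell A x a g h \<alpha> \<and> c_cell A x a g h \<beta> \<and> wl A f \<alpha> = wl A f \<beta>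
        \<longrightarrow> \<alpha> = \<beta>)"

definition c_fully_faithful :: "('o,'m) acat \<Rightarrow> 'm \<Rightarrow> 'm \<Rightarrow> 'm \<times> 'm \<Rightarrow> bool" where
  "c_fully_faithful A a b f \<longleftrightarrow> c_faithful A a b f \<and>
     (\<forall>x g h \<gamma>. c_obj A x \<and> c_mor A x a g \<and> c_mor A x a h \<and>
        c_cell A x b (c_comp A f g) (c_comp A f h) \<gamma> \<longrightarrow> (\<exists>\<alpha>. c_cell A x a g h \<alpha> \<and> wl A f \<alpha> = \<gamma>))"

definition c_cofaithful :: "('o,'m) acat \<Rightarrow> 'm \<Rightarrow> 'm \<Rightarrow> 'm \<times> 'm \<Rightarrow> bool" where
  "c_cofaithful A a b f \<longleftrightarrow> c_obj A a \<and> c_obj A b \<and> c_mor A a b f \<and>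
     (\<forall>x g h \<alpha> \<beta>. c_obj A x \<and> c_cell A b x g h \<alpha> \<and> c_cell A b x g h \<beta> \<and> wr A \<alpha> f = wr A \<beta> f
        \<longrightarrow> \<alpha> = \<beta>)"

definition c_fully_cofaithful :: "('o,'m) acat \<Rightarrow> 'm \<Rightarrow> 'm \<Rightarrow> 'm \<times> 'm \<Rightarrow> bool" where
  "c_fully_cofaithful A a b f \<longleftrightarrow> c_cofaithful A a b f \<and>
     (\<forall>x g h \<gamma>. c_obj A x \<and> c_mor A b x g \<and> c_mor A b x h \<and>
        c_cell A a x (c_comp A g f) (c_comp A h f) \<gamma> \<longrightarrow> (\<exists>\<alpha>. c_cell A b x g h \<alpha> \<and> wr A \<alpha> f = \<gamma>))"

definition c_discrete :: "('o,'m) acat \<Rightarrow> 'm \<Rightarrow> bool" where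
  "c_discrete A a \<longleftrightarrow> c_obj A a \<and> (\<forall>z t. c_zero_obj A z \<and> c_mor A a z t \<longrightarrow> c_faithful A a z t)"

definition c_codiscrete :: "('o,'m) acat \<Rightarrow> 'm \<Rightarrow> bool" where
  "c_codiscrete A a \<longleftrightarrow> c_obj A a \<and> (\<forall>z t. c_zero_obj A z \<and> c_mor A z a t \<longrightarrow> c_cofaithful A z a t)"

text \<open>2-kernel (k, u, kappa) of f : a -> b.  The functor v |-> (u v, kappa v) into the groupoid of
  pairs (w, phi : f w => 0) is required to be an equivalence (essentially surjective, full, faithful).
  A morphism of pairs (w,phi) -> (w',phi') is beta : w => w' with phi = (f beta) followed by phi'.\<close>
definition c_is_2kernel ::
  "('o,'m) acat \<Rightarrow> 'm \<Rightarrow> 'm \<Rightarrow> 'm \<times> 'm \<Rightarrow> 'm \<Rightarrow> 'm \<times> 'm \<Rightarrow> 'm \<Rightarrow> bool" where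
  "c_is_2kernel A a b f k u \<kappa> \<longleftrightarrow>
     c_obj A k \<and> c_mor A k a u \<and> c_cell A k b (c_comp A f u) (c_zero A k b) \<kappa> \<and>
     (\<forall>x. c_obj A x \<longrightarrow>
        (\<forall>w \<phi>. c_mor A x a w \<and> c_cell A x b (c_comp A f w) (c_zero A x b) \<phi> \<longrightarrow>
           (\<exists>v \<beta>. c_mor A x k v \<and> c_cell A x a (c_comp A u v) w \<beta> \<and>
                  wr A \<kappa> v = Add A (wl A f \<beta>) \<phi>)) \<and>
        (\<forall>v v' \<beta>. c_mor A x k v \<and> c_mor A x k v' \<and> c_cell A x a (c_comp A u v) (c_comp A u v') \<beta> \<and>
                  wr A \<kappa> v = Add A (wl A f \<beta>) (wr A \<kappa> v') \<longrightarrow>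
           (\<exists>\<gamma>. c_cell A x k v v' \<gamma> \<and> wl A u \<gamma> = \<beta>)) \<and>
        (\<forall>v v' \<gamma> \<gamma>'. c_cell A x k v v' \<gamma> \<and> c_cell A x k v v' \<gamma>' \<and> wl A u \<gamma> = wl A u \<gamma>' \<longrightarrow> \<gamma> = \<gamma>'))"

definition c_is_2cokernel ::
  "('o,'m) acat \<Rightarrow> 'm \<Rightarrow> 'm \<Rightarrow> 'm \<times> 'm \<Rightarrow> 'm \<Rightarrow> 'm \<times> 'm \<Rightarrow> 'm \<Rightarrow> bool" where
  "c_is_2cokernel A a b f c q \<zeta> \<longleftrightarrow>
     c_obj A c \<and> c_mor A b c q \<and> c_cell A a c (c_comp A q f) (c_zero A a c) \<zeta> \<and>
     (\<forall>x. c_obj A x \<longrightarrow>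
        (\<forall>w \<phi>. c_mor A b x w \<and> c_cell A a x (c_comp A w f) (c_zero A a x) \<phi> \<longrightarrow>
           (\<exists>v \<beta>. c_mor A c x v \<and> c_cell A b x (c_comp A v q) w \<beta> \<and>
                  wl A v \<zeta> = Add A (wr A \<beta> f) \<phi>)) \<and>
        (\<forall>v v' \<beta>. c_mor A c x v \<and> c_mor A c x v' \<and> c_cell A b x (c_comp A v q) (c_comp A v' q) \<beta> \<and>
                  wl A v \<zeta> = Add A (wr A \<beta> f) (wl A v' \<zeta>) \<longrightarrow>
           (\<exists>\<gamma>. c_cell A c x v v' \<gamma> \<and> wr A \<gamma> q = \<beta>)) \<and>
        (\<forall>v v' \<gamma> \<gamma>'. c_cell A c x v v' \<gamma> \<and> c_cell A c x v v' \<gamma>' \<and> wr A \<gamma> q = wr A \<gamma>' q \<longrightarrow> \<gamma> = \<gamma>'))"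

text \<open>pip (p, pi) of f : a -> b: pi : 0 => 0 between zero 1-cells p -> a with f pi = id;
  universal: Hom(x,p) -> {rho : 0 => 0 : x -> a | f rho = id} (a discrete groupoid), v |-> pi v,
  is an equivalence.\<close>
definition c_is_pip :: "('o,'m) acat \<Rightarrow> 'm \<Rightarrow> 'm \<Rightarrow> 'm \<times> 'm \<Rightarrow> 'm \<Rightarrow> 'm \<Rightarrow> bool" where
  "c_is_pip A a b f p \<pi> \<longleftrightarrow>
     c_obj A p \<and> c_cell A p a (c_zero A p a) (c_zero A p a) \<pi> \<and> wl A f \<pi> = c_idcell A p b \<and>
     (\<forall>x. c_obj A x \<longrightarrow>
        (\<forall>\<rho>. c_cell A x a (c_zero A x a) (c_zero A x a) \<rho> \<and> wl A f \<rho> = c_idcell A x b \<longrightarrow>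
           (\<exists>v. c_mor A x p v \<and> wr A \<pi> v = \<rho>)) \<and>
        (\<forall>v v'. c_mor A x p v \<and> c_mor A x p v' \<and> wr A \<pi> v = wr A \<pi> v' \<longrightarrow> (\<exists>\<gamma>. c_cell A x p v v' \<gamma>)) \<and>
        (\<forall>v v' \<gamma> \<gamma>'. c_cell A x p v v' \<gamma> \<and> c_cell A x p v v' \<gamma>' \<longrightarrow> \<gamma> = \<gamma>'))"

definition c_is_copip :: "('o,'m) acat \<Rightarrow> 'm \<Rightarrow> 'm \<Rightarrow> 'm \<times> 'm \<Rightarrow> 'm \<Rightarrow> 'm \<Rightarrow> bool" where
  "c_is_copip A a b f p \<pi> \<longleftrightarrow>
     c_obj A p \<and> c_cell A b p (c_zero A b p) (c_zero A b p) \<pi> \<and> wr A \<pi> f = c_idcell A a p \<and>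
     (\<forall>x. c_obj A x \<longrightarrow>
        (\<forall>\<rho>. c_cell A b x (c_zero A b x) (c_zero A b x) \<rho> \<and> wr A \<rho> f = c_idcell A a x \<longrightarrow>
           (\<exists>v. c_mor A p x v \<and> wl A v \<pi> = \<rho>)) \<and>
        (\<forall>v v'. c_mor A p x v \<and> c_mor A p x v' \<and> wl A v \<pi> = wl A v' \<pi> \<longrightarrow> (\<exists>\<gamma>. c_cell A p x v v' \<gamma>)) \<and>
        (\<forall>v v' \<gamma> \<gamma>'. c_cell A p x v v' \<gamma> \<and> c_cell A p x v v' \<gamma>' \<longrightarrow> \<gamma> = \<gamma>'))"

text \<open>root r : R -> a of alpha : 0 => 0 (zero 1-cells a -> b): alpha r = id, and
  Hom(x,R) -> full subgroupoid of Hom(x,a) on {w | alpha w = id}, v |-> r v, is an equivalence.\<close>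
definition c_is_root :: "('o,'m) acat \<Rightarrow> 'm \<Rightarrow> 'm \<Rightarrow> 'm \<Rightarrow> 'm \<Rightarrow> 'm \<times> 'm \<Rightarrow> bool" where
  "c_is_root A a b \<alpha> R r \<longleftrightarrow>
     c_obj A R \<and> c_mor A R a r \<and> wr A \<alpha> r = c_idcell A R b \<and>
     (\<forall>x. c_obj A x \<longrightarrow>
        (\<forall>w. c_mor A x a w \<and> wr A \<alpha> w = c_idcell A x b \<longrightarrow>
           (\<exists>v \<beta>. c_mor A x R v \<and> c_cell A x a (c_comp A r v) w \<beta>)) \<and>
        (\<forall>v v' \<beta>. c_mor A x R v \<and> c_mor A x R v' \<and> c_cell A x a (c_comp A r v) (c_comp A r v') \<beta> \<longrightarrow>
           (\<exists>\<gamma>. c_cell A x R v v' \<gamma> \<and> wl A r \<gamma> = \<beta>)) \<and>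
        (\<forall>v v' \<gamma> \<gamma>'. c_cell A x R v v' \<gamma> \<and> c_cell A x R v v' \<gamma>' \<and> wl A r \<gamma> = wl A r \<gamma>' \<longrightarrow> \<gamma> = \<gamma>'))"

definition c_is_coroot :: "('o,'m) acat \<Rightarrow> 'm \<Rightarrow> 'm \<Rightarrow> 'm \<Rightarrow> 'm \<Rightarrow> 'm \<times> 'm \<Rightarrow> bool" where
  "c_is_coroot A a b \<alpha> Q q \<longleftrightarrow>
     c_obj A Q \<and> c_mor A b Q q \<and> wl A q \<alpha> = c_idcell A a Q \<and>
     (\<forall>x. c_obj A x \<longrightarrow>
        (\<forall>w. c_mor A b x w \<and> wl A w \<alpha> = c_idcell A a x \<longrightarrow>
           (\<exists>v \<beta>. c_mor A Q x v \<and> c_cell A b x (c_comp A v q) w \<beta>)) \<and>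
        (\<forall>v v' \<beta>. c_mor A Q x v \<and> c_mor A Q x v' \<and> c_cell A b x (c_comp A v q) (c_comp A v' q) \<beta> \<longrightarrow>
           (\<exists>\<gamma>. c_cell A Q x v v' \<gamma> \<and> wr A \<gamma> q = \<beta>)) \<and>
        (\<forall>v v' \<gamma> \<gamma>'. c_cell A Q x v v' \<gamma> \<and> c_cell A Q x v v' \<gamma>' \<and> wr A \<gamma> q = wr A \<gamma>' q \<longrightarrow> \<gamma> = \<gamma>'))"

text \<open>2-additivity with respect to the componentwise additive structure: each Hom(a,b) is a
  (strict) symmetric 2-group under c_add (on 2-cells: Add), composition and whiskering are
  bilinear, and there are a zero object and binary biproducts (in the bicategorical sense).\<close>
definition c_two_additive :: "('o,'m) acat \<Rightarrow> bool" where
  "c_two_additive A \<longleftrightarrow>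
     (\<forall>a b. c_obj A a \<and> c_obj A b \<longrightarrow>
        c_mor A a b (c_zero A a b) \<and>
        (\<forall>f g h. c_mor A a b f \<and> c_mor A a b g \<and> c_mor A a b h \<longrightarrow>
           c_mor A a b (c_add A f g) \<and> c_mor A a b (c_neg A f) \<and>
           c_add A (c_add A f g) h = c_add A f (c_add A g h) \<and>
           c_add A f g = c_add A g f \<and>
           c_add A f (c_zero A a b) = f \<and>
           c_add A f (c_neg A f) = c_zero A a b) \<and>
        (\<forall>f g f' g' \<alpha> \<beta>. c_cell A a b f g \<alpha> \<and> c_cell A a b f' g' \<beta> \<longrightarrow>
           c_cell A a b (c_add A f f') (c_add A g g') (Add A \<alpha> \<beta>)) \<and>
        (\<forall>f. c_mor A a b f \<longrightarrow> c_cell A a b f f (c_idcell A a b)) \<and>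
        (\<forall>f g h \<alpha> \<beta>. c_cell A a b f g \<alpha> \<and> c_cell A a b g h \<beta> \<longrightarrow>
           c_cell A a b f h (Add A \<alpha> \<beta>)) \<and>
        (\<forall>f g \<alpha>. c_cell A a b f g \<alpha> \<longrightarrow> c_cell A a b g f (Neg A \<alpha>))) \<and>
     (\<forall>a b c f g h. c_obj A a \<and> c_obj A b \<and> c_obj A c \<and>
        c_mor A a b f \<and> c_mor A a b g \<and> c_mor A b c h \<longrightarrow>
          c_comp A h (c_add A f g) = c_add A (c_comp A h f) (c_comp A h g)) \<and>
     (\<forall>a b c f g h. c_obj A a \<and> c_obj A b \<and> c_obj A c \<and>
        c_mor A b c f \<and> c_mor A b c g \<and> c_mor A a b h \<longrightarrow>
          c_comp A (c_add A f g) h = c_add A (c_comp A f h) (c_comp A g h)) \<and>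
     (\<forall>a b c f g h h' \<alpha> \<beta>. c_obj A a \<and> c_obj A b \<and> c_obj A c \<and>
        c_cell A a b f g \<alpha> \<and> c_cell A a b f g \<beta> \<and> c_mor A b c h \<and> c_mor A b c h' \<longrightarrow>
          wl A h (Add A \<alpha> \<beta>) = Add A (wl A h \<alpha>) (wl A h \<beta>) \<and>
          wl A (c_add A h h') \<alpha> = Add A (wl A h \<alpha>) (wl A h' \<alpha>)) \<and>
     (\<forall>a b c f g h h' \<alpha> \<beta>. c_obj A a \<and> c_obj A b \<and> c_obj A c \<and>
        c_cell A b c f g \<alpha> \<and> c_cell A b c f g \<beta> \<and> c_mor A a b h \<and> c_mor A a b h' \<longrightarrow>
          wr A (Add A \<alpha> \<beta>) h = Add A (wr A \<alpha> h) (wr A \<beta> h) \<and>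
          wr A \<alpha> (c_add A h h') = Add A (wr A \<alpha> h) (wr A \<alpha> h')) \<and>
     (\<exists>z. c_zero_obj A z) \<and>
     (\<forall>a b. c_obj A a \<and> c_obj A b \<longrightarrow>
        (\<exists>s i1 i2 p1 p2 \<alpha>1 \<alpha>2 \<alpha>3 \<alpha>4 \<alpha>5. c_obj A s \<and>
           c_mor A a s i1 \<and> c_mor A b s i2 \<and> c_mor A s a p1 \<and> c_mor A s b p2 \<and>
           c_cell A a a (c_comp A p1 i1) (c_id A a) \<alpha>1 \<and>
           c_cell A b b (c_comp A p2 i2) (c_id A b) \<alpha>2 \<and>
           c_cell A b a (c_comp A p1 i2) (c_zero A b a) \<alpha>3 \<and>
           c_cell A a b (c_comp A p2 i1) (c_zero A a b) \<alpha>4 \<and>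
           c_cell A s s (c_add A (c_comp A i1 p1) (c_comp A i2 p2)) (c_id A s) \<alpha>5))"

definition c_two_abelian :: "('o,'m) acat \<Rightarrow> bool" where
  "c_two_abelian A \<longleftrightarrow> c_two_additive A \<and>
     (\<forall>a b f. c_obj A a \<and> c_obj A b \<and> c_mor A a b f \<longrightarrow>
        (\<exists>k u \<kappa>. c_is_2kernel A a b f k u \<kappa>) \<and>
        (\<exists>c q \<zeta>. c_is_2cokernel A a b f c q \<zeta>) \<and>
        (\<exists>p \<pi>. c_is_pip A a b f p \<pi>) \<and>
        (\<exists>p \<pi>. c_is_copip A a b f p \<pi>)) \<and>
     (\<forall>a b \<alpha>. c_obj A a \<and> c_obj A b \<and> c_cell A a b (c_zero A a b) (c_zero A a b) \<alpha> \<longrightarrow>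
        (\<exists>R r. c_is_root A a b \<alpha> R r) \<and> (\<exists>Q q. c_is_coroot A a b \<alpha> Q q)) \<and>
     \<comment> \<open>2-Puppe-exactness\<close>
     (\<forall>a b f c q \<zeta>. c_faithful A a b f \<and> c_is_2cokernel A a b f c q \<zeta> \<longrightarrow>
        c_is_2kernel A b c q a f \<zeta>) \<and>
     (\<forall>a b f k u \<kappa>. c_cofaithful A a b f \<and> c_is_2kernel A a b f k u \<kappa> \<longrightarrow>
        c_is_2cokernel A k a u b f \<kappa>) \<and>
     (\<forall>a b f p \<pi>. c_fully_faithful A a b f \<and> c_is_copip A a b f p \<pi> \<longrightarrow>
        c_is_root A b p \<pi> a f) \<and>
     (\<forall>a b f p \<pi>. c_fully_cofaithful A a b f \<and> c_is_pip A a b f p \<pi> \<longrightarrow>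
        c_is_coroot A p a \<pi> b f)"

text \<open>The category of discrete objects has as morphisms 2-isomorphism classes of 1-cells.
  A functor out of it is given on representatives (Fm a b f for f : a -> b), constant on 2-iso classes.
  "Equivalent to A via a |-> Coker(a)": Fo a is the codomain of a chosen cokernel cok a of a,
  Fm f is the induced arrow (Fm f o cok a = cok b o f0), Fm is a functor, and it is
  faithful, full and essentially surjective.\<close>
definition discrete_equiv_via_coker :: "('o,'m) acat \<Rightarrow> bool" where
  "discrete_equiv_via_coker A \<longleftrightarrow>
     (\<exists>(cok :: 'm \<Rightarrow> 'm) (Fo :: 'm \<Rightarrow> 'o) (Fm :: 'm \<Rightarrow> 'm \<Rightarrow> 'm \<times> 'm \<Rightarrow> 'm).
        (\<forall>a. c_discrete A a \<longrightarrow> is_cokernel A a (cok a) \<and> Cod A (cok a) = Fo a) \<and>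
        (\<forall>a b f. c_discrete A a \<and> c_discrete A b \<and> c_mor A a b f \<longrightarrow>
           Fm a b f \<in> hom A (Fo a) (Fo b) \<and> Cmp A (Fm a b f) (cok a) = Cmp A (cok b) (fst f)) \<and>
        (\<forall>a b f g \<alpha>. c_discrete A a \<and> c_discrete A b \<and> c_cell A a b f g \<alpha> \<longrightarrow> Fm a b f = Fm a b g) \<and>
        (\<forall>a. c_discrete A a \<longrightarrow> Fm a a (c_id A a) = Idt A (Fo a)) \<and>
        (\<forall>a b c f g. c_discrete A a \<and> c_discrete A b \<and> c_discrete A c \<and>
           c_mor A a b f \<and> c_mor A b c g \<longrightarrow> Fm a c (c_comp A g f) = Cmp A (Fm b c g) (Fm a b f)) \<and>
        (\<forall>a b f g. c_discrete A a \<and> c_discrete A b \<and> c_mor A a b f \<and> c_mor A a b g \<and>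
           Fm a b f = Fm a b g \<longrightarrow> (\<exists>\<alpha>. c_cell A a b f g \<alpha>)) \<and>
        (\<forall>a b h. c_discrete A a \<and> c_discrete A b \<and> h \<in> hom A (Fo a) (Fo b) \<longrightarrow>
           (\<exists>f. c_mor A a b f \<and> Fm a b f = h)) \<and>
        (\<forall>X. \<exists>a. c_discrete A a \<and> isomorphic A (Fo a) X))"

definition codiscrete_equiv_via_ker :: "('o,'m) acat \<Rightarrow> bool" where
  "codiscrete_equiv_via_ker A \<longleftrightarrow>
     (\<exists>(ker :: 'm \<Rightarrow> 'm) (Go :: 'm \<Rightarrow> 'o) (Gm :: 'm \<Rightarrow> 'm \<Rightarrow> 'm \<times> 'm \<Rightarrow> 'm).
        (\<forall>a. c_codiscrete A a \<longrightarrow> is_kernel A a (ker a) \<and> Dom A (ker a) = Go a) \<and>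
        (\<forall>a b f. c_codiscrete A a \<and> c_codiscrete A b \<and> c_mor A a b f \<longrightarrow>
           Gm a b f \<in> hom A (Go a) (Go b) \<and> Cmp A (ker b) (Gm a b f) = Cmp A (snd f) (ker a)) \<and>
        (\<forall>a b f g \<alpha>. c_codiscrete A a \<and> c_codiscrete A b \<and> c_cell A a b f g \<alpha> \<longrightarrow> Gm a b f = Gm a b g) \<and>
        (\<forall>a. c_codiscrete A a \<longrightarrow> Gm a a (c_id A a) = Idt A (Go a)) \<and>
        (\<forall>a b c f g. c_codiscrete A a \<and> c_codiscrete A b \<and> c_codiscrete A c \<and>
           c_mor A a b f \<and> c_mor A b c g \<longrightarrow> Gm a c (c_comp A g f) = Cmp A (Gm b c g) (Gm a b f)) \<and>
        (\<forall>a b f g. c_codiscrete A a \<and> c_codiscrete A b \<and> c_mor A a b f \<and> c_mor A a b g \<and>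
           Gm a b f = Gm a b g \<longrightarrow> (\<exists>\<alpha>. c_cell A a b f g \<alpha>)) \<and>
        (\<forall>a b h. c_codiscrete A a \<and> c_codiscrete A b \<and> h \<in> hom A (Go a) (Go b) \<longrightarrow>
           (\<exists>f. c_mor A a b f \<and> Gm a b f = h)) \<and>
        (\<forall>X. \<exists>a. c_codiscrete A a \<and> isomorphic A (Go a) X))"

end

theory Submission
  imports Defs
begin

text \<open>A null sequence k \<rightarrow> a \<rightarrow> b, with u : k \<rightarrow> a, f : a \<rightarrow> b and a 2-cell \<kappa> from f u to 0, has a total
  complex k1 \<rightarrow> k0 \<oplus> a1 \<rightarrow> a0 \<oplus> b1 \<rightarrow> b0. Testing against the objects 0 \<rightarrow> P and X \<rightarrow> 0 shows that
  (k, u, \<kappa>) is a 2-kernel of f iff this complex is exact at the first three places, that (b, f, \<kappa>) is a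
  2-cokernel of u iff it is exact at the last three, that u is faithful iff it is exact at k1, and that
  f is cofaithful iff it is exact at b0; since b0 is projective, the last map is then split epi.
  So a faithful 1-cell is the 2-kernel of its 2-cokernel, and dually. A fully faithful 1-cell is a pullback
  square and a fully cofaithful one a pushout square, which yields the statements on roots and coroots.
  Limits are built in the category of all arrows and then made cofibrant by pulling back along an epi
  from a projective onto the degree 0 part; colimits keep the degree 0 part and need no correction.
  An object is discrete iff it is a mono, i.e. the start of a projective presentation of its cokernel, and
  codiscrete iff it is an epi, hence split.\<close>

section \<open>Preadditive categories\<close>

text \<open>Maps out of projectives serve as generalised elements: they lift along epis without a
  change of domain, so diagrams are chased as for modules. The obstacle is that only the degree 0
  part of an object is projective. A component with projective domain is obtained by direct lifting.
  A degree 1 component is constructed on a projective cover of its domain and must then be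
  descended, which needs joint injectivity on the target side (exactness at \<open>k1\<close>) or a
  proof that the value does not depend on choices. For 2-cokernels, maps out of \<open>b0\<close>
  are needed as well; they come from the section of \<open>a0 + b1 -> b0\<close>, whose
  complementary projector yields explicit formulas. The two families of test objects complement each
  other: \<open>0 -> P\<close> sees generalised elements of both degrees, while
  \<open>X -> 0\<close> sees maps from both degrees to an arbitrary \<open>X\<close>, because
  \<open>0\<close> is projective. Hence pushouts and cokernels of the abelian category are available
  as tests, and exactness can be read off from a 2-cokernel.\<close>

locale preadditive_category =
  fixes A :: "('o, 'm) acat"
  assumes category: "is_category A" and preadditive: "preadditive A"
begin

abbreviation cmp (infixr "\<cdot>" 70) where "g \<cdot> f \<equiv> Cmp A g f"
abbreviation add (infixl "\<oplus>" 65) where "f \<oplus> g \<equiv> Add A f g"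
abbreviation neg ("\<ominus> _" [81] 80) where "\<ominus> f \<equiv> Neg A f"
abbreviation D where "D \<equiv> Dom A"
abbreviation C where "C \<equiv> Cod A"
abbreviation zr ("\<zero>") where "\<zero> \<equiv> Zro A"
abbreviation I where "I \<equiv> Idt A"

lemma mem_hom [simp]: "f \<in> hom A x y \<longleftrightarrow> D f = x \<and> C f = y"
  by (simp add: hom_def)

lemma cmp_type [simp]: "C f = D g \<Longrightarrow> D (g \<cdot> f) = D f" "C f = D g \<Longrightarrow> C (g \<cdot> f) = C g"
  using category unfolding is_category_def by auto

lemma id_type [simp]: "D (I x) = x" "C (I x) = x"
  using category unfolding is_category_def by auto

lemma cmp_id [simp]: "D f = x \<Longrightarrow> f \<cdot> I x = f" "C f = x \<Longrightarrow> I x \<cdot> f = f"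
  using category unfolding is_category_def by auto

lemma cmp_assoc [simp]: "C f = D g \<Longrightarrow> C g = D h \<Longrightarrow> (h \<cdot> g) \<cdot> f = h \<cdot> g \<cdot> f"
  using category unfolding is_category_def by auto

lemma zero_type [simp]: "D (\<zero> x y) = x" "C (\<zero> x y) = y"
  using preadditive unfolding preadditive_def by auto

lemma add_type [simp]:
  "D f = D g \<Longrightarrow> C f = C g \<Longrightarrow> D (f \<oplus> g) = D g"
  "D f = D g \<Longrightarrow> C f = C g \<Longrightarrow> C (f \<oplus> g) = C g"
  using preadditive unfolding preadditive_def by auto

lemma neg_type [simp]: "D (\<ominus> f) = D f" "C (\<ominus> f) = C f"
  using preadditive unfolding preadditive_def by auto

section \<open>Arithmetic of the hom-groups\<close>

lemma hom_group:
  assumes "f \<in> hom A x y" "g \<in> hom A x y" "h \<in> hom A x y"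
  shows "(f \<oplus> g) \<oplus> h = f \<oplus> (g \<oplus> h)" "f \<oplus> g = g \<oplus> f" "f \<oplus> \<zero> x y = f" "f \<oplus> \<ominus> f = \<zero> x y"
  using preadditive assms unfolding preadditive_def by blast+

lemma add_assoc [simp]:
  "D f = D g \<Longrightarrow> C f = C g \<Longrightarrow> D g = D h \<Longrightarrow> C g = C h \<Longrightarrow> (f \<oplus> g) \<oplus> h = f \<oplus> (g \<oplus> h)"
  by (rule hom_group(1)[of _ "D f" "C f"]) simp_all

lemma add_commute: "D f = D g \<Longrightarrow> C f = C g \<Longrightarrow> f \<oplus> g = g \<oplus> f"
  by (rule hom_group(2)[of _ "D f" "C f" _ f]) simp_all

lemma add_left_commute:
  "D f = D g \<Longrightarrow> C f = C g \<Longrightarrow> D g = D h \<Longrightarrow> C g = C h \<Longrightarrow> f \<oplus> (g \<oplus> h) = g \<oplus> (f \<oplus> h)"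
  by (metis add_assoc add_commute)

lemmas add_ac = add_commute add_left_commute

lemma add_zero [simp]:
  "D f = x \<Longrightarrow> C f = y \<Longrightarrow> f \<oplus> \<zero> x y = f"
  "D f = x \<Longrightarrow> C f = y \<Longrightarrow> \<zero> x y \<oplus> f = f"
  using hom_group(3)[of f x y f f] add_commute[of f "\<zero> x y"] by simp_all

lemma add_neg [simp]: "f \<oplus> \<ominus> f = \<zero> (D f) (C f)" "\<ominus> f \<oplus> f = \<zero> (D f) (C f)"
  using hom_group(4)[of f "D f" "C f" f f] add_commute[of f "\<ominus> f"] by simp_all

lemma add_neg_cancel [simp]:
  "D f = D g \<Longrightarrow> C f = C g \<Longrightarrow> f \<oplus> (\<ominus> f \<oplus> g) = g"
  "D f = D g \<Longrightarrow> C f = C g \<Longrightarrow> \<ominus> f \<oplus> (f \<oplus> g) = g"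
  by (simp_all flip: add_assoc)

text \<open>The permutative rules \<open>add_ac\<close> sort summands by term order, so
  \<open>f\<close> and \<open>\<ominus> f\<close> may end up separated; these rules cancel the pair
  across one or two intermediate summands.\<close>

lemma add_neg_cancel_deep [simp]:
  assumes "D f = D g" "C f = C g"
  shows "f \<oplus> (g \<oplus> \<ominus> f) = g" "\<ominus> f \<oplus> (g \<oplus> f) = g"
    "D h = D g \<Longrightarrow> C h = C g \<Longrightarrow> f \<oplus> (g \<oplus> (\<ominus> f \<oplus> h)) = g \<oplus> h"
    "D h = D g \<Longrightarrow> C h = C g \<Longrightarrow> \<ominus> f \<oplus> (g \<oplus> (f \<oplus> h)) = g \<oplus> h"
    "D h = D g \<Longrightarrow> C h = C g \<Longrightarrow> f \<oplus> (g \<oplus> (h \<oplus> \<ominus> f)) = g \<oplus> h"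
    "D h = D g \<Longrightarrow> C h = C g \<Longrightarrow> \<ominus> f \<oplus> (g \<oplus> (h \<oplus> f)) = g \<oplus> h"
  using assms add_left_commute[of f g] add_left_commute[of "\<ominus> f" g]
    add_left_commute[of f h] add_left_commute[of "\<ominus> f" h] by simp_all

lemma add_left_cancel [simp]:
  "D f = D g \<Longrightarrow> C f = C g \<Longrightarrow> D h = D g \<Longrightarrow> C h = C g \<Longrightarrow> f \<oplus> g = f \<oplus> h \<longleftrightarrow> g = h"
  by (metis add_neg_cancel(2))

lemma add_right_cancel [simp]:
  "D f = D g \<Longrightarrow> C f = C g \<Longrightarrow> D h = D g \<Longrightarrow> C h = C g \<Longrightarrow> g \<oplus> f = h \<oplus> f \<longleftrightarrow> g = h"
  by (metis add_left_cancel add_commute)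

lemma cmp_add_left [simp]:
  "D f = D g \<Longrightarrow> C f = C g \<Longrightarrow> C g = D h \<Longrightarrow> h \<cdot> (f \<oplus> g) = h \<cdot> f \<oplus> h \<cdot> g"
proof -
  assume a: "D f = D g" "C f = C g" "C g = D h"
  then have "f \<in> hom A (D f) (D h) \<and> g \<in> hom A (D f) (D h) \<and> h \<in> hom A (D h) (C h) \<and> I (D f) \<in> hom A (D f) (D f)"
    by simp
  then show ?thesis using preadditive unfolding preadditive_def by blast
qed

lemma cmp_add_right [simp]:
  "D f = D g \<Longrightarrow> C f = C g \<Longrightarrow> D g = C h \<Longrightarrow> (f \<oplus> g) \<cdot> h = f \<cdot> h \<oplus> g \<cdot> h"
proof -
  assume a: "D f = D g" "C f = C g" "D g = C h"
  then have "f \<in> hom A (D f) (C f) \<and> g \<in> hom A (D f) (C f) \<and> I (C f) \<in> hom A (C f) (C f) \<and> h \<in> hom A (D h) (D f)"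
    by simp
  then show ?thesis using preadditive unfolding preadditive_def by blast
qed

lemma add_self_eq: "f \<oplus> f = f \<Longrightarrow> f = \<zero> (D f) (C f)"
  by (metis add_neg(2) add_neg_cancel(2))

lemma cmp_zero [simp]:
  "y = D h \<Longrightarrow> h \<cdot> \<zero> x y = \<zero> x (C h)"
  "x = C h \<Longrightarrow> \<zero> x y \<cdot> h = \<zero> (D h) y"
proof -
  assume "y = D h"
  then have "h \<cdot> \<zero> x y \<oplus> h \<cdot> \<zero> x y = h \<cdot> \<zero> x y" by (simp flip: cmp_add_left)
  from add_self_eq[OF this] show "h \<cdot> \<zero> x y = \<zero> x (C h)" using \<open>y = D h\<close> by simp
next
  assume "x = C h"
  then have "\<zero> x y \<cdot> h \<oplus> \<zero> x y \<cdot> h = \<zero> x y \<cdot> h" by (simp flip: cmp_add_right)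
  from add_self_eq[OF this] show "\<zero> x y \<cdot> h = \<zero> (D h) y" using \<open>x = C h\<close> by simp
qed

lemma neg_unique: "D f = D g \<Longrightarrow> C f = C g \<Longrightarrow> f \<oplus> g = \<zero> (D f) (C f) \<Longrightarrow> g = \<ominus> f"
  by (metis add_left_cancel add_neg(1) neg_type)

lemma neg_neg [simp]: "\<ominus> (\<ominus> f) = f"
  by (rule neg_unique[symmetric]) simp_all

lemma neg_zero [simp]: "\<ominus> (\<zero> x y) = \<zero> x y"
  by (rule neg_unique[symmetric]) simp_all

lemma neg_add [simp]:
  assumes "D f = D g" "C f = C g" shows "\<ominus> (f \<oplus> g) = \<ominus> f \<oplus> \<ominus> g"
  by (rule neg_unique[symmetric]) (use assms in \<open>simp_all add: add_ac\<close>)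

lemma cmp_neg [simp]:
  "C f = D h \<Longrightarrow> h \<cdot> (\<ominus> f) = \<ominus> (h \<cdot> f)"
  "C h = D f \<Longrightarrow> (\<ominus> f) \<cdot> h = \<ominus> (f \<cdot> h)"
  by (rule neg_unique, simp_all flip: cmp_add_left cmp_add_right)+

lemma neg_eq_iff [simp]: "\<ominus> f = \<ominus> g \<longleftrightarrow> f = g"
  by (metis neg_neg)

text \<open>Moving the subtrahend across turns the defining equations of a 2-cell into sums, which
  is the form used in \<open>cell_iff\<close>.\<close>

lemma msub_eq_iff [simp]:
  assumes "D f = D g" "C f = C g" "D h = D g" "C h = C g"
  shows "msub A f g = h \<longleftrightarrow> f = h \<oplus> g"
proof
  assume "msub A f g = h"
  then show "f = h \<oplus> g" using assms unfolding msub_def by auto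
qed (use assms in \<open>simp add: msub_def\<close>)

lemma diff_zero_iff:
  assumes "D f = D g" "C f = C g"
  shows "f \<oplus> \<ominus> g = \<zero> (D g) (C g) \<longleftrightarrow> f = g"
  using assms msub_eq_iff[of f g "\<zero> (D g) (C g)"] by (simp add: msub_def)

text \<open>Turns an equation between composites into a rewrite rule for right-nested chains.\<close>
lemma cmp_eq: "g \<cdot> f = k \<Longrightarrow> C f = D g \<Longrightarrow> C z = D f \<Longrightarrow> g \<cdot> f \<cdot> z = k \<cdot> z"
  by auto

section \<open>Monos, epis, kernels and cokernels\<close>

lemma epiD: "epi A e \<Longrightarrow> g \<cdot> e = h \<cdot> e \<Longrightarrow> D g = C e \<Longrightarrow> D h = C e \<Longrightarrow> C g = C h \<Longrightarrow> g = h"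
  unfolding epi_def by blast

lemma monoD: "mono A m \<Longrightarrow> m \<cdot> g = m \<cdot> h \<Longrightarrow> C g = D m \<Longrightarrow> C h = D m \<Longrightarrow> D g = D h \<Longrightarrow> g = h"
  unfolding mono_def by blast

lemma monoI:
  assumes "\<And>y. C y = D m \<Longrightarrow> m \<cdot> y = \<zero> (D y) (C m) \<Longrightarrow> y = \<zero> (D y) (D m)"
  shows "mono A m"
  unfolding mono_def
proof (intro allI impI, elim conjE)
  fix g h assume a: "C g = D m" "C h = D m" "D g = D h" "m \<cdot> g = m \<cdot> h"
  have "g \<oplus> \<ominus> h = \<zero> (D h) (C h)" using assms[of "g \<oplus> \<ominus> h"] a by simp
  then show "g = h" using a diff_zero_iff[of g h] by simp
qed

lemma epiI:
  assumes "\<And>y. D y = C e \<Longrightarrow> y \<cdot> e = \<zero> (D e) (C y) \<Longrightarrow> y = \<zero> (C e) (C y)"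
  shows "epi A e"
  unfolding epi_def
proof (intro allI impI, elim conjE)
  fix g h assume a: "D g = C e" "D h = C e" "C g = C h" "g \<cdot> e = h \<cdot> e"
  have "g \<oplus> \<ominus> h = \<zero> (D h) (C h)" using assms[of "g \<oplus> \<ominus> h"] a by simp
  then show "g = h" using a diff_zero_iff[of g h] by simp
qed

lemma mono_cmp:
  assumes "mono A m" "mono A n" "C n = D m"
  shows "mono A (m \<cdot> n)"
  unfolding mono_def
proof (intro allI impI, elim conjE)
  fix g h assume a: "C g = D (m \<cdot> n)" "C h = D (m \<cdot> n)" "D g = D h" "(m \<cdot> n) \<cdot> g = (m \<cdot> n) \<cdot> h"
  then have "n \<cdot> g = n \<cdot> h" using assms(3) by (intro monoD[OF assms(1), of "n \<cdot> g" "n \<cdot> h"]) simp_all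
  then show "g = h" using a assms(3) monoD[OF assms(2), of g h] by simp
qed

lemma epi_cmp:
  assumes "epi A e" "epi A d" "C d = D e"
  shows "epi A (e \<cdot> d)"
  unfolding epi_def
proof (intro allI impI, elim conjE)
  fix g h assume a: "D g = C (e \<cdot> d)" "D h = C (e \<cdot> d)" "C g = C h" "g \<cdot> e \<cdot> d = h \<cdot> e \<cdot> d"
  then have "g \<cdot> e = h \<cdot> e" using assms(3) by (intro epiD[OF assms(2), of "g \<cdot> e" "h \<cdot> e"]) simp_all
  then show "g = h" using a assms(3) epiD[OF assms(1), of g h] by simp
qed

text \<open>Unique factorisation is split into existence and monicity of \<open>k\<close>, which are
  easier to chain. For monicity, a map killed by \<open>k\<close> and the zero map both factor the
  same zero map.\<close>

lemma kernelD:
  assumes "is_kernel A f k"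
  shows "C k = D f" "f \<cdot> k = \<zero> (D k) (C f)" "mono A k"
    and "C g = D f \<Longrightarrow> f \<cdot> g = \<zero> (D g) (C f) \<Longrightarrow> \<exists>h. D h = D g \<and> C h = D k \<and> k \<cdot> h = g"
proof -
  show t: "C k = D f" "f \<cdot> k = \<zero> (D k) (C f)" using assms unfolding is_kernel_def by auto
  show "C g = D f \<Longrightarrow> f \<cdot> g = \<zero> (D g) (C f) \<Longrightarrow> \<exists>h. D h = D g \<and> C h = D k \<and> k \<cdot> h = g"
    using assms unfolding is_kernel_def mem_hom by blast
  show "mono A k"
  proof (rule monoI)
    fix y assume y: "C y = D k" "k \<cdot> y = \<zero> (D y) (C k)"
    have "\<exists>!h. h \<in> hom A (D (\<zero> (D y) (C k))) (D k) \<and> k \<cdot> h = \<zero> (D y) (C k)"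
      using assms[unfolded is_kernel_def, THEN conjunct2, THEN conjunct2, rule_format, of "\<zero> (D y) (C k)"]
        t by simp
    then show "y = \<zero> (D y) (D k)"
      using y cmp_zero(1)[OF refl, of k "D y"] by (metis mem_hom zero_type)
  qed
qed

lemma cokernelD:
  assumes "is_cokernel A f c"
  shows "D c = C f" "c \<cdot> f = \<zero> (D f) (C c)" "epi A c"
    and "D g = C f \<Longrightarrow> g \<cdot> f = \<zero> (D f) (C g) \<Longrightarrow> \<exists>h. D h = C c \<and> C h = C g \<and> h \<cdot> c = g"
proof -
  show t: "D c = C f" "c \<cdot> f = \<zero> (D f) (C c)" using assms unfolding is_cokernel_def by auto
  show "D g = C f \<Longrightarrow> g \<cdot> f = \<zero> (D f) (C g) \<Longrightarrow> \<exists>h. D h = C c \<and> C h = C g \<and> h \<cdot> c = g"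
    using assms unfolding is_cokernel_def mem_hom by blast
  show "epi A c"
  proof (rule epiI)
    fix y assume y: "D y = C c" "y \<cdot> c = \<zero> (D c) (C y)"
    have "\<exists>!h. h \<in> hom A (C c) (C (\<zero> (D c) (C y))) \<and> h \<cdot> c = \<zero> (D c) (C y)"
      using assms[unfolded is_cokernel_def, THEN conjunct2, THEN conjunct2, rule_format, of "\<zero> (D c) (C y)"]
        t by simp
    then show "y = \<zero> (C c) (C y)"
      using y cmp_zero(2)[OF refl, of c "C y"] by (metis mem_hom zero_type)
  qed
qed

end

section \<open>Abelian categories with enough projectives\<close>

locale abelian_projective = preadditive_category +
  assumes abelian: "abelian A" and enough: "enough_projectives A"
begin

lemma ex_kernel: "\<exists>k. is_kernel A f k"
  using abelian unfolding abelian_def by blast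

lemma ex_cokernel: "\<exists>c. is_cokernel A f c"
  using abelian unfolding abelian_def by blast

lemma projective_cover:
  obtains P e where "projective A P" "epi A e" "D e = P" "C e = X"
  using enough unfolding enough_projectives_def mem_hom by blast

lemma projective_lift:
  assumes "projective A P" "epi A e" "D g = P" "C g = C e"
  obtains h where "D h = P" "C h = D e" "e \<cdot> h = g"
  using assms unfolding projective_def Bex_def mem_hom by blast

text \<open>A fixed zero object, so that the test objects can be written as the concrete arrows
  \<open>\<zero> Z P\<close> and \<open>\<zero> X Z\<close>.\<close>

definition Z where
  "Z = (SOME z. \<forall>x. (\<exists>!f. f \<in> hom A z x) \<and> (\<exists>!f. f \<in> hom A x z))"

lemma Z: "(\<exists>!f. f \<in> hom A Z x) \<and> (\<exists>!f. f \<in> hom A x Z)"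
proof -
  have "\<exists>z. \<forall>x. (\<exists>!f. f \<in> hom A z x) \<and> (\<exists>!f. f \<in> hom A x z)"
    using abelian unfolding abelian_def has_zero_object_def by blast
  from someI_ex[OF this] show ?thesis unfolding Z_def by blast
qed

lemma to_Z: "C f = Z \<Longrightarrow> C g = Z \<Longrightarrow> D f = D g \<Longrightarrow> f = g"
  using Z[of "D f"] by (metis mem_hom)

lemma from_Z: "D f = Z \<Longrightarrow> D g = Z \<Longrightarrow> C f = C g \<Longrightarrow> f = g"
  using Z[of "C f"] by (metis mem_hom)

text \<open>Hence every arrow into \<open>Z\<close> is an object of the 2-category, whatever its
  domain.\<close>

lemma projective_Z: "projective A Z"
  unfolding projective_def
proof (intro allI impI, elim conjE)
  fix e g assume "g \<in> hom A Z (C e)"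
  then show "\<exists>h\<in>hom A Z (D e). e \<cdot> h = g"
    by (intro bexI[of _ "\<zero> Z (D e)"] from_Z) simp_all
qed

lemma epi_to_Z: "epi A (\<zero> X Z)"
  by (rule epiI) (rule from_Z, simp_all)

text \<open>The epi is the cokernel of some \<open>f\<close>, and \<open>f\<close> factors through
  the kernel \<open>n\<close>; so a map killing \<open>n\<close> also kills
  \<open>f\<close>.\<close>

lemma epi_cokernel_of_kernel:
  assumes "epi A e" "is_kernel A e n" "D g = D e" "g \<cdot> n = \<zero> (D n) (C g)"
  obtains h where "D h = C e" "C h = C g" "h \<cdot> e = g"
proof -
  obtain f where f: "is_cokernel A f e" using abelian assms(1) unfolding abelian_def by blast
  note cf = cokernelD[OF f]
  note kn = kernelD[OF assms(2)]
  obtain f' where f': "D f' = D f" "C f' = D n" "n \<cdot> f' = f" using kn(4)[of f] cf(1,2) by metis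
  have "g \<cdot> n \<cdot> f' = \<zero> (D f) (C g)"
    using cmp_eq[OF assms(4), of f'] f' kn assms(3) by simp
  then have "g \<cdot> f = \<zero> (D f) (C g)" using f' by simp
  from cf(4)[OF _ this] show thesis using that cf(1) assms(3) by metis
qed

text \<open>Dually, the mono is the kernel of some \<open>f\<close>, and \<open>f\<close> factors
  through the cokernel \<open>c\<close>.\<close>

lemma mono_kernel_of_cokernel:
  assumes "mono A m" "is_cokernel A m c" "C g = C m" "c \<cdot> g = \<zero> (D g) (C c)"
  obtains h where "D h = D g" "C h = D m" "m \<cdot> h = g"
proof -
  obtain f where f: "is_kernel A f m" using abelian assms(1) unfolding abelian_def by blast
  note kf = kernelD[OF f]
  note cc = cokernelD[OF assms(2)]
  obtain f' where f': "D f' = C c" "C f' = C f" "f' \<cdot> c = f" using cc(4)[of f] kf(1,2) by metis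
  have "(f' \<cdot> c) \<cdot> g = \<zero> (D g) (C f)" using assms(3,4) f'(1,2) cc by simp
  then have "f \<cdot> g = \<zero> (D g) (C f)" using f' by simp
  from kf(4)[OF _ this] show thesis using that kf(1) assms(3) by metis
qed

section \<open>Maps out of projectives as generalised elements\<close>

lemma zero_if_zero_on_projectives:
  assumes "\<And>P z. projective A P \<Longrightarrow> D z = P \<Longrightarrow> C z = D y \<Longrightarrow> y \<cdot> z = \<zero> P (C y)"
  shows "y = \<zero> (D y) (C y)"
proof -
  obtain P e where e: "projective A P" "epi A e" "D e = P" "C e = D y" by (rule projective_cover)
  show ?thesis by (rule epiD[OF e(2)]) (use assms[OF e(1,3,4)] e in simp_all)
qed

lemma eq_if_eq_on_projectives:
  assumes "D y = D y'" "C y = C y'"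
    and "\<And>P z. projective A P \<Longrightarrow> D z = P \<Longrightarrow> C z = D y' \<Longrightarrow> y \<cdot> z = y' \<cdot> z"
  shows "y = y'"
proof -
  obtain P e where e: "projective A P" "epi A e" "D e = P" "C e = D y" by (rule projective_cover)
  show ?thesis by (rule epiD[OF e(2)]) (use assms(3)[OF e(1,3)] e assms in simp_all)
qed

text \<open>By hypothesis \<open>g\<close> vanishes on the generalised elements of the kernel of
  \<open>e\<close>, hence on the kernel itself, and \<open>e\<close> is the cokernel of its
  kernel.\<close>

lemma descend:
  assumes "epi A e" "D g = D e"
    and "\<And>P y. projective A P \<Longrightarrow> D y = P \<Longrightarrow> C y = D e \<Longrightarrow> e \<cdot> y = \<zero> P (C e) \<Longrightarrow> g \<cdot> y = \<zero> P (C g)"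
  obtains h where "D h = C e" "C h = C g" "h \<cdot> e = g"
proof -
  obtain n where n: "is_kernel A e n" using ex_kernel by blast
  note kn = kernelD[OF n]
  have "g \<cdot> n = \<zero> (D (g \<cdot> n)) (C (g \<cdot> n))"
  proof (rule zero_if_zero_on_projectives)
    fix P z assume z: "projective A P" "D z = P" "C z = D (g \<cdot> n)"
    have "e \<cdot> n \<cdot> z = \<zero> P (C e)" using cmp_eq[OF kn(2), of z] z kn assms(2) by simp
    then have "g \<cdot> n \<cdot> z = \<zero> P (C g)"
      using assms(3)[of P "n \<cdot> z"] z kn assms(2) by simp
    then show "(g \<cdot> n) \<cdot> z = \<zero> P (C (g \<cdot> n))" using z kn assms(2) by simp
  qed
  then have "g \<cdot> n = \<zero> (D n) (C g)" using kn assms(2) by simp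
  from epi_cokernel_of_kernel[OF assms(1) n assms(2) this] show thesis using that by blast
qed

text \<open>The image of \<open>f\<close> is taken to be the kernel \<open>m\<close> of its
  cokernel. The map \<open>y\<close> factors through \<open>m\<close> and, \<open>P\<close> being
  projective, lifts further along the epi part of \<open>f\<close>.\<close>

lemma exact_lift:
  assumes "is_cokernel A f c" "projective A P" "D y = P" "C y = C f" "c \<cdot> y = \<zero> P (C c)"
  obtains z where "D z = P" "C z = D f" "f \<cdot> z = y"
proof -
  note cc = cokernelD[OF assms(1)]
  obtain m where m: "is_kernel A c m" using ex_kernel by blast
  note km = kernelD[OF m]
  obtain f' where f': "D f' = D f" "C f' = D m" "m \<cdot> f' = f" using km(4)[of f] cc(1,2) by metis
  obtain y' where y': "D y' = P" "C y' = D m" "m \<cdot> y' = y" using km(4)[of y] cc(1) assms(3-5) by metis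
  \<comment> \<open>The image factor of f is epi: if it factored through a proper subobject n of the image m,
    then f would be killed by the cokernel of m n, which does not kill m.\<close>
  have "epi A f'"
  proof (rule epiI)
    fix g assume g: "D g = C f'" "g \<cdot> f' = \<zero> (D f') (C g)"
    obtain n where "is_kernel A g n" using ex_kernel by blast
    note kn = kernelD[OF this]
    obtain f'' where f'': "D f'' = D f" "C f'' = D n" "n \<cdot> f'' = f'"
      using kn(4)[of f'] g f'(1,2) by metis
    have tn: "C n = D m" using kn g f' by simp
    have mn: "mono A (m \<cdot> n)" using mono_cmp km(3) kn(3) tn by simp
    obtain h where h: "is_cokernel A (m \<cdot> n) h" using ex_cokernel by blast
    note ch = cokernelD[OF h]
    have th: "D h = C m" using ch tn by simp
    have "h \<cdot> f = h \<cdot> (m \<cdot> n) \<cdot> f''" using f'' f' tn by simp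
    also have "\<dots> = \<zero> (D f) (C h)" using cmp_eq[OF ch(2), of f''] f'' tn th by simp
    finally have "h \<cdot> f = \<zero> (D f) (C h)" .
    then obtain h' where h': "D h' = C c" "C h' = C h" "h' \<cdot> c = h"
      using cc(4)[of h] th km(1) cc(1) by metis
    have "(h' \<cdot> c) \<cdot> m = \<zero> (D m) (C h)" using h'(1,2) km by simp
    then have "h \<cdot> m = \<zero> (D m) (C h)" using h' by simp
    then obtain t where t: "D t = D m" "C t = D (m \<cdot> n)" "(m \<cdot> n) \<cdot> t = m"
      using mono_kernel_of_cokernel[OF mn h, of m] tn by (metis cmp_type)
    have "m \<cdot> n \<cdot> t = m \<cdot> I (D m)" using t tn by simp
    then have "n \<cdot> t = I (D m)" by (rule monoD[OF km(3)]) (use t tn in simp_all)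
    then have "g = g \<cdot> n \<cdot> t" using g f' by simp
    also have "\<dots> = \<zero> (C f') (C g)" using cmp_eq[OF kn(2), of t] t tn g f' kn(1) by simp
    finally show "g = \<zero> (C f') (C g)" .
  qed
  then obtain z where z: "D z = P" "C z = D f'" "f' \<cdot> z = y'"
    using projective_lift[OF assms(2)] y' f' by metis
  have "f \<cdot> z = m \<cdot> f' \<cdot> z" using cmp_eq[OF f'(3), of z] z f' by simp
  also have "\<dots> = y" using z y' by simp
  finally show thesis using that z f' by simp
qed

section \<open>Limits and colimits described by generalised elements\<close>

text \<open>Two successive kernels, which avoids a biproduct of the codomains. For \<open>a\<close>
  and \<open>snd f\<close> this subobject classifies the 2-cells between zero 1-cells that
  \<open>f\<close> kills.\<close>

lemma joint_kernel:
  assumes "D g = D f"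
  obtains i where "C i = D f" "mono A i" "f \<cdot> i = \<zero> (D i) (C f)" "g \<cdot> i = \<zero> (D i) (C g)"
    "\<forall>y. C y = D f \<longrightarrow> f \<cdot> y = \<zero> (D y) (C f) \<longrightarrow> g \<cdot> y = \<zero> (D y) (C g)
      \<longrightarrow> (\<exists>h. D h = D y \<and> C h = D i \<and> i \<cdot> h = y)"
proof -
  obtain k where "is_kernel A f k" using ex_kernel by blast
  note k = kernelD[OF this]
  obtain l where "is_kernel A (g \<cdot> k) l" using ex_kernel by blast
  note l = kernelD[OF this]
  have tl: "C l = D k" using l k assms by simp
  show thesis
  proof (rule that[of "k \<cdot> l"]; (intro allI impI)?)
    show "C (k \<cdot> l) = D f" using tl k by simp
    show "mono A (k \<cdot> l)" using mono_cmp k(3) l(3) tl by simp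
    show "f \<cdot> k \<cdot> l = \<zero> (D (k \<cdot> l)) (C f)" using cmp_eq[OF k(2), of l] tl k(1) by simp
    show "g \<cdot> k \<cdot> l = \<zero> (D (k \<cdot> l)) (C g)" using l(2) tl k(1) assms by simp
    fix y assume y: "C y = D f" "f \<cdot> y = \<zero> (D y) (C f)" "g \<cdot> y = \<zero> (D y) (C g)"
    obtain y' where y': "D y' = D y" "C y' = D k" "k \<cdot> y' = y" using k(4)[OF y(1,2)] by blast
    have "(g \<cdot> k) \<cdot> y' = \<zero> (D y') (C (g \<cdot> k))" using y y' k(1) assms by simp
    then obtain h where h: "D h = D y'" "C h = D l" "l \<cdot> h = y'"
      using l(4)[of y'] y'(1,2) k(1) assms by (metis cmp_type)
    then show "\<exists>h. D h = D y \<and> C h = D (k \<cdot> l) \<and> (k \<cdot> l) \<cdot> h = y"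
      using y' tl by (intro exI[of _ h]) simp
  qed
qed

text \<open>Two successive cokernels. In the last clause \<open>k y\<close> is lifted along
  \<open>k g\<close> to \<open>t\<close>; what remains, \<open>y - g t\<close>, is killed by
  \<open>k\<close> and lifts along \<open>f\<close>.\<close>

lemma joint_cokernel:
  assumes "C g = C f"
  obtains q where "D q = C f" "epi A q" "q \<cdot> f = \<zero> (D f) (C q)" "q \<cdot> g = \<zero> (D g) (C q)"
    "\<forall>y. D y = C f \<longrightarrow> y \<cdot> f = \<zero> (D f) (C y) \<longrightarrow> y \<cdot> g = \<zero> (D g) (C y)
      \<longrightarrow> (\<exists>h. D h = C q \<and> C h = C y \<and> h \<cdot> q = y)"
    "\<forall>P y. projective A P \<longrightarrow> D y = P \<longrightarrow> C y = C f \<longrightarrow> q \<cdot> y = \<zero> P (C q)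
      \<longrightarrow> (\<exists>s t. D s = P \<and> C s = D f \<and> D t = P \<and> C t = D g \<and> y = f \<cdot> s \<oplus> g \<cdot> t)"
proof -
  obtain k where k': "is_cokernel A f k" using ex_cokernel by blast
  note k = cokernelD[OF this]
  obtain l where l': "is_cokernel A (k \<cdot> g) l" using ex_cokernel by blast
  note l = cokernelD[OF this]
  have tl: "D l = C k" using l k assms by simp
  show thesis
  proof (rule that[of "l \<cdot> k"]; (intro allI impI)?)
    show "D (l \<cdot> k) = C f" using tl k by simp
    show "epi A (l \<cdot> k)" using epi_cmp k(3) l(3) tl by simp
    show "(l \<cdot> k) \<cdot> f = \<zero> (D f) (C (l \<cdot> k))" using k(1,2) tl by simp
    show "(l \<cdot> k) \<cdot> g = \<zero> (D g) (C (l \<cdot> k))" using l(2) tl k(1) assms by simp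
  next
    fix y assume y: "D y = C f" "y \<cdot> f = \<zero> (D f) (C y)" "y \<cdot> g = \<zero> (D g) (C y)"
    obtain y' where y': "D y' = C k" "C y' = C y" "y' \<cdot> k = y" using k(4)[OF y(1,2)] by blast
    have "y' \<cdot> k \<cdot> g = \<zero> (D (k \<cdot> g)) (C y')"
      using cmp_eq[OF y'(3), of g] y y' k(1) assms by simp
    then obtain h where h: "D h = C l" "C h = C y'" "h \<cdot> l = y'"
      using l(4)[of y'] y'(1,2) k(1) assms by (metis cmp_type)
    then show "\<exists>h. D h = C (l \<cdot> k) \<and> C h = C y \<and> h \<cdot> l \<cdot> k = y"
      using y' tl cmp_eq[OF h(3), of k] by (intro exI[of _ h]) simp
  next
    fix P y assume P: "projective A P" and y: "D y = P" "C y = C f" "(l \<cdot> k) \<cdot> y = \<zero> P (C (l \<cdot> k))"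
    have "l \<cdot> k \<cdot> y = \<zero> P (C l)" using y tl k(1) by simp
    then obtain t where t: "D t = P" "C t = D (k \<cdot> g)" "(k \<cdot> g) \<cdot> t = k \<cdot> y"
      using exact_lift[OF l' P, of "k \<cdot> y"] y(1,2) tl k(1) assms by (metis cmp_type)
    have tt: "C t = D g" using t k(1) assms by simp
    have kt: "k \<cdot> g \<cdot> t = k \<cdot> y" using t(3) tt k(1) assms by simp
    then have "k \<cdot> (y \<oplus> \<ominus> (g \<cdot> t)) = \<zero> P (C k)" using y t(1) tt k(1) assms by simp
    then obtain s where s: "D s = P" "C s = D f" "f \<cdot> s = y \<oplus> \<ominus> (g \<cdot> t)"
      using exact_lift[OF k' P, of "y \<oplus> \<ominus> (g \<cdot> t)"] y(1,2) t(1) tt assms by auto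
    have "y = f \<cdot> s \<oplus> g \<cdot> t" using s y t(1) tt assms by simp
    then show "\<exists>s t. D s = P \<and> C s = D f \<and> D t = P \<and> C t = D g \<and> y = f \<cdot> s \<oplus> g \<cdot> t"
      using s(1,2) t(1) tt by blast
  qed
qed

lemma biproduct:
  obtains s i1 i2 p1 p2 where
    "D i1 = x" "C i1 = s" "D i2 = y" "C i2 = s" "D p1 = s" "C p1 = x" "D p2 = s" "C p2 = y"
    "p1 \<cdot> i1 = I x" "p2 \<cdot> i2 = I y" "p1 \<cdot> i2 = \<zero> y x" "p2 \<cdot> i1 = \<zero> x y" "i1 \<cdot> p1 \<oplus> i2 \<cdot> p2 = I s"
proof -
  have "has_biproducts A" using abelian unfolding abelian_def by blast
  then show thesis using that unfolding has_biproducts_def mem_hom by metis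
qed

lemma pullback:
  assumes "C f = C g"
  obtains p q where "D p = D q" "C p = D f" "C q = D g" "f \<cdot> p = g \<cdot> q"
    "\<forall>x y. D x = D y \<longrightarrow> C x = D f \<longrightarrow> C y = D g \<longrightarrow> f \<cdot> x = g \<cdot> y
      \<longrightarrow> (\<exists>h. D h = D y \<and> C h = D q \<and> p \<cdot> h = x \<and> q \<cdot> h = y)"
    "\<forall>h h'. C h = D q \<longrightarrow> C h' = D q \<longrightarrow> D h = D h' \<longrightarrow> p \<cdot> h = p \<cdot> h' \<longrightarrow> q \<cdot> h = q \<cdot> h' \<longrightarrow> h = h'"
proof -
  obtain s i1 i2 p1 p2 where
    t: "D i1 = D f" "C i1 = s" "D i2 = D g" "C i2 = s" "D p1 = s" "C p1 = D f" "D p2 = s" "C p2 = D g"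
    and b: "p1 \<cdot> i1 = I (D f)" "p2 \<cdot> i2 = I (D g)" "p1 \<cdot> i2 = \<zero> (D g) (D f)" "p2 \<cdot> i1 = \<zero> (D f) (D g)"
      "i1 \<cdot> p1 \<oplus> i2 \<cdot> p2 = I s" by (rule biproduct)
  note b' = b(1-4)[THEN cmp_eq]
  define r where "r = f \<cdot> p1 \<oplus> \<ominus> (g \<cdot> p2)"
  have tr: "D r = s" "C r = C g" using t assms by (simp_all add: r_def)
  obtain k where "is_kernel A r k" using ex_kernel by blast
  note k = kernelD[OF this]
  have tk: "C k = s" using k(1) tr by simp
  show thesis
  proof (rule that[of "p1 \<cdot> k" "p2 \<cdot> k"]; (intro allI impI)?)
    show "D (p1 \<cdot> k) = D (p2 \<cdot> k)" "C (p1 \<cdot> k) = D f" "C (p2 \<cdot> k) = D g" using t tk by simp_all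
    show "f \<cdot> p1 \<cdot> k = g \<cdot> p2 \<cdot> k"
      using k(2) diff_zero_iff[of "f \<cdot> p1 \<cdot> k" "g \<cdot> p2 \<cdot> k"] t tk tr assms by (simp add: r_def)
  next
    fix x y assume a: "D x = D y" "C x = D f" "C y = D g" "f \<cdot> x = g \<cdot> y"
    have w: "r \<cdot> (i1 \<cdot> x \<oplus> i2 \<cdot> y) = \<zero> (D y) (C r)"
      using a t assms tr b' by (simp add: r_def)
    obtain h where h: "D h = D (i1 \<cdot> x \<oplus> i2 \<cdot> y)" "C h = D k" "k \<cdot> h = i1 \<cdot> x \<oplus> i2 \<cdot> y"
      using k(4)[of "i1 \<cdot> x \<oplus> i2 \<cdot> y"] w a t tr by auto
    have "D h = D y" "p1 \<cdot> k \<cdot> h = x" "p2 \<cdot> k \<cdot> h = y" using h a t b' by simp_all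
    then show "\<exists>h. D h = D y \<and> C h = D (p2 \<cdot> k) \<and> (p1 \<cdot> k) \<cdot> h = x \<and> (p2 \<cdot> k) \<cdot> h = y"
      using h(2) t tk by (intro exI[of _ h]) simp
  next
    fix h h' assume a: "C h = D (p2 \<cdot> k)" "C h' = D (p2 \<cdot> k)" "D h = D h'"
      "(p1 \<cdot> k) \<cdot> h = (p1 \<cdot> k) \<cdot> h'" "(p2 \<cdot> k) \<cdot> h = (p2 \<cdot> k) \<cdot> h'"
    have th: "C h = D k" "C h' = D k" using a t tk by simp_all
    have "k \<cdot> h = (i1 \<cdot> p1 \<oplus> i2 \<cdot> p2) \<cdot> k \<cdot> h" "k \<cdot> h' = (i1 \<cdot> p1 \<oplus> i2 \<cdot> p2) \<cdot> k \<cdot> h'"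
      using b(5) th tk by simp_all
    then have "k \<cdot> h = k \<cdot> h'" using a th t tk by simp
    then show "h = h'" using monoD[OF k(3)] th a(3) by simp
  qed
qed

text \<open>The cokernel of \<open>i1 f - i2 a\<close>. Besides the universal property it records
  exactness on generalised elements: a pair identified by \<open>i\<close> and \<open>j\<close>
  comes from a single \<open>g\<close>, by \<open>exact_lift\<close>, and every element of the
  pushout is a sum, by lifting along the epi.\<close>

lemma pushout:
  assumes "D f = D a"
  obtains i j where "D i = C f" "D j = C a" "C i = C j" "i \<cdot> f = j \<cdot> a"
    "\<forall>x y. C x = C y \<longrightarrow> D x = C f \<longrightarrow> D y = C a \<longrightarrow> x \<cdot> f = y \<cdot> a
      \<longrightarrow> (\<exists>h. D h = C j \<and> C h = C y \<and> h \<cdot> i = x \<and> h \<cdot> j = y)"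
    "\<forall>P y z. projective A P \<longrightarrow> D y = P \<longrightarrow> C y = C f \<longrightarrow> D z = P \<longrightarrow> C z = C a \<longrightarrow> i \<cdot> y = j \<cdot> z
      \<longrightarrow> (\<exists>g. D g = P \<and> C g = D f \<and> f \<cdot> g = y \<and> a \<cdot> g = z)"
    "\<forall>P w. projective A P \<longrightarrow> D w = P \<longrightarrow> C w = C j
      \<longrightarrow> (\<exists>y z. D y = P \<and> C y = C f \<and> D z = P \<and> C z = C a \<and> i \<cdot> y \<oplus> j \<cdot> z = w)"
proof -
  obtain s i1 i2 p1 p2 where
    t: "D i1 = C f" "C i1 = s" "D i2 = C a" "C i2 = s" "D p1 = s" "C p1 = C f" "D p2 = s" "C p2 = C a"
    and b: "p1 \<cdot> i1 = I (C f)" "p2 \<cdot> i2 = I (C a)" "p1 \<cdot> i2 = \<zero> (C a) (C f)" "p2 \<cdot> i1 = \<zero> (C f) (C a)"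
      "i1 \<cdot> p1 \<oplus> i2 \<cdot> p2 = I s" by (rule biproduct)
  note b' = b(1-4)[THEN cmp_eq]
  define r where "r = i1 \<cdot> f \<oplus> \<ominus> (i2 \<cdot> a)"
  have tr: "D r = D a" "C r = s" using t assms by (simp_all add: r_def)
  obtain q where q': "is_cokernel A r q" using ex_cokernel by blast
  note q = cokernelD[OF this]
  have tq: "D q = s" using q(1) tr by simp
  show thesis
  proof (rule that[of "q \<cdot> i1" "q \<cdot> i2"]; (intro allI impI)?)
    show "D (q \<cdot> i1) = C f" "D (q \<cdot> i2) = C a" "C (q \<cdot> i1) = C (q \<cdot> i2)" using t tq by simp_all
    show "(q \<cdot> i1) \<cdot> f = (q \<cdot> i2) \<cdot> a"
      using q(2) diff_zero_iff[of "q \<cdot> i1 \<cdot> f" "q \<cdot> i2 \<cdot> a"] t tq tr assms by (simp add: r_def)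
  next
    fix x y assume a: "C x = C y" "D x = C f" "D y = C a" "x \<cdot> f = y \<cdot> a"
    have w: "(x \<cdot> p1 \<oplus> y \<cdot> p2) \<cdot> r = \<zero> (D r) (C y)"
      using a t assms tr b' by (simp add: r_def)
    obtain h where h: "D h = C q" "C h = C (x \<cdot> p1 \<oplus> y \<cdot> p2)" "h \<cdot> q = x \<cdot> p1 \<oplus> y \<cdot> p2"
      using q(4)[of "x \<cdot> p1 \<oplus> y \<cdot> p2"] w a t tr by auto
    have "C h = C y" "h \<cdot> q \<cdot> i1 = x" "h \<cdot> q \<cdot> i2 = y" using h cmp_eq[OF h(3)] a t tq b b' by simp_all
    then show "\<exists>h. D h = C (q \<cdot> i2) \<and> C h = C y \<and> h \<cdot> q \<cdot> i1 = x \<and> h \<cdot> q \<cdot> i2 = y"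
      using h(1) t tq by (intro exI[of _ h]) simp
  next
    fix P y z assume P: "projective A P" and a: "D y = P" "C y = C f" "D z = P" "C z = C a"
      "(q \<cdot> i1) \<cdot> y = (q \<cdot> i2) \<cdot> z"
    have "q \<cdot> (i1 \<cdot> y \<oplus> \<ominus> (i2 \<cdot> z)) = \<zero> P (C q)" using a t tq by simp
    then obtain g where g: "D g = P" "C g = D r" "r \<cdot> g = i1 \<cdot> y \<oplus> \<ominus> (i2 \<cdot> z)"
      using exact_lift[OF q' P, of "i1 \<cdot> y \<oplus> \<ominus> (i2 \<cdot> z)"] a t tr by auto
    have tg: "C g = D a" using g tr by simp
    have "p1 \<cdot> r \<cdot> g = f \<cdot> g" "p2 \<cdot> r \<cdot> g = \<ominus> (a \<cdot> g)" using tg t b b' assms by (simp_all add: r_def)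
    moreover have "p1 \<cdot> r \<cdot> g = y" "p2 \<cdot> r \<cdot> g = \<ominus> z" using g(3) t b b' a by simp_all
    ultimately show "\<exists>g. D g = P \<and> C g = D f \<and> f \<cdot> g = y \<and> a \<cdot> g = z"
      using g(1) tg assms by (intro exI[of _ g]) auto
  next
    fix P w assume P: "projective A P" and w: "D w = P" "C w = C (q \<cdot> i2)"
    obtain h where h: "D h = P" "C h = D q" "q \<cdot> h = w" using projective_lift[OF P q(3)] w t tq by (metis cmp_type)
    have "q \<cdot> (i1 \<cdot> p1 \<oplus> i2 \<cdot> p2) \<cdot> h = w" using h tq b by simp
    then show "\<exists>y z. D y = P \<and> C y = C f \<and> D z = P \<and> C z = C a \<and> (q \<cdot> i1) \<cdot> y \<oplus> (q \<cdot> i2) \<cdot> z = w"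
      using h(1,2) tq t by (intro exI[of _ "p1 \<cdot> h"] exI[of _ "p2 \<cdot> h"]) simp
  qed
qed

text \<open>The cokernel of the 2 by 2 matrix with columns \<open>(u, k)\<close> and
  \<open>(a, f)\<close>, expressed through its components \<open>e\<close> and \<open>d\<close> so
  that no biproduct appears. With \<open>\<kappa>\<close> in the place of \<open>k\<close> the
  matrix is, up to sign, the middle map of the total complex, and the last clause is exactness on
  generalised elements.\<close>

lemma matrix_cokernel:
  assumes "D u = D k" "D a = D f" "C a = C u" "C f = C k"
  obtains e d where "D e = C u" "D d = C k" "C d = C e"
    "e \<cdot> u = \<ominus> (d \<cdot> k)" "e \<cdot> a = \<ominus> (d \<cdot> f)"
    "\<forall>P z y. projective A P \<longrightarrow> D z = P \<longrightarrow> C z = C u \<longrightarrow> D y = P \<longrightarrow> C y = C k \<longrightarrow> e \<cdot> z = \<ominus> (d \<cdot> y)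
      \<longrightarrow> (\<exists>p r. D p = P \<and> C p = D k \<and> D r = P \<and> C r = D f \<and> u \<cdot> p \<oplus> a \<cdot> r = z \<and> k \<cdot> p \<oplus> f \<cdot> r = y)"
proof -
  obtain s i1 i2 p1 p2 where
    t: "D i1 = C u" "C i1 = s" "D i2 = C k" "C i2 = s" "D p1 = s" "C p1 = C u" "D p2 = s" "C p2 = C k"
    and b: "p1 \<cdot> i1 = I (C u)" "p2 \<cdot> i2 = I (C k)" "p1 \<cdot> i2 = \<zero> (C k) (C u)" "p2 \<cdot> i1 = \<zero> (C u) (C k)"
      "i1 \<cdot> p1 \<oplus> i2 \<cdot> p2 = I s" by (rule biproduct)
  note b' = b(1-4)[THEN cmp_eq]
  define m n where "m = i1 \<cdot> u \<oplus> i2 \<cdot> k" and "n = i1 \<cdot> a \<oplus> i2 \<cdot> f"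
  have tm: "D m = D k" "C m = s" "D n = D f" "C n = s" using t assms by (simp_all add: m_def n_def)
  have "C n = C m" using tm by simp
  then obtain q where q: "D q = C m" and "epi A q"
    and q0: "q \<cdot> m = \<zero> (D m) (C q)" "q \<cdot> n = \<zero> (D n) (C q)"
    and "\<forall>y. D y = C m \<longrightarrow> y \<cdot> m = \<zero> (D m) (C y) \<longrightarrow> y \<cdot> n = \<zero> (D n) (C y)
      \<longrightarrow> (\<exists>h. D h = C q \<and> C h = C y \<and> h \<cdot> q = y)"
    and ex: "\<forall>P y. projective A P \<longrightarrow> D y = P \<longrightarrow> C y = C m \<longrightarrow> q \<cdot> y = \<zero> P (C q)
      \<longrightarrow> (\<exists>s t. D s = P \<and> C s = D m \<and> D t = P \<and> C t = D n \<and> y = m \<cdot> s \<oplus> n \<cdot> t)"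
    by (rule joint_cokernel)
  have tq: "D q = s" using q tm by simp
  show thesis
  proof (rule that[of "q \<cdot> i1" "q \<cdot> i2"]; (intro allI impI)?)
    show "D (q \<cdot> i1) = C u" "D (q \<cdot> i2) = C k" "C (q \<cdot> i2) = C (q \<cdot> i1)" using t tq by simp_all
    show "(q \<cdot> i1) \<cdot> u = \<ominus> ((q \<cdot> i2) \<cdot> k)"
      using q0(1) diff_zero_iff[of "q \<cdot> i1 \<cdot> u" "\<ominus> (q \<cdot> i2 \<cdot> k)"] t tq tm assms by (simp add: m_def)
    show "(q \<cdot> i1) \<cdot> a = \<ominus> ((q \<cdot> i2) \<cdot> f)"
      using q0(2) diff_zero_iff[of "q \<cdot> i1 \<cdot> a" "\<ominus> (q \<cdot> i2 \<cdot> f)"] t tq tm assms by (simp add: n_def)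
  next
    fix P z y assume P: "projective A P" and a: "D z = P" "C z = C u" "D y = P" "C y = C k"
      "(q \<cdot> i1) \<cdot> z = \<ominus> ((q \<cdot> i2) \<cdot> y)"
    have "q \<cdot> (i1 \<cdot> z \<oplus> i2 \<cdot> y) = \<zero> P (C q)" using a t tq by simp
    then obtain p r where pr: "D p = P" "C p = D m" "D r = P" "C r = D n"
        "i1 \<cdot> z \<oplus> i2 \<cdot> y = m \<cdot> p \<oplus> n \<cdot> r"
      using ex[rule_format, OF P, of "i1 \<cdot> z \<oplus> i2 \<cdot> y"] a t tm by auto
    have tp: "C p = D k" "C r = D f" using pr tm by simp_all
    have "p1 \<cdot> (m \<cdot> p \<oplus> n \<cdot> r) = u \<cdot> p \<oplus> a \<cdot> r" "p2 \<cdot> (m \<cdot> p \<oplus> n \<cdot> r) = k \<cdot> p \<oplus> f \<cdot> r"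
      using pr(1,3) tp t b b' assms by (simp_all add: m_def n_def)
    moreover have "p1 \<cdot> (m \<cdot> p \<oplus> n \<cdot> r) = z" "p2 \<cdot> (m \<cdot> p \<oplus> n \<cdot> r) = y"
      using a t b b' by (simp_all flip: pr(5))
    ultimately show "\<exists>p r. D p = P \<and> C p = D k \<and> D r = P \<and> C r = D f
        \<and> u \<cdot> p \<oplus> a \<cdot> r = z \<and> k \<cdot> p \<oplus> f \<cdot> r = y"
      using pr(1,3) tp by (intro exI[of _ p] exI[of _ r]) simp
  qed
qed

section \<open>Gluing maps from their values on projectives\<close>

lemma jointly_mono_from_projectives:
  assumes "D m = D n"
    and inj: "\<And>P g. projective A P \<Longrightarrow> D g = P \<Longrightarrow> C g = D n \<Longrightarrow> m \<cdot> g = \<zero> P (C m) \<Longrightarrow> n \<cdot> g = \<zero> P (C n)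
      \<Longrightarrow> g = \<zero> P (D n)"
    and "C h = D n" "C h' = D n" "D h = D h'" "m \<cdot> h = m \<cdot> h'" "n \<cdot> h = n \<cdot> h'"
  shows "h = h'"
proof (rule eq_if_eq_on_projectives)
  fix P z assume P: "projective A P" and z: "D z = P" "C z = D h'"
  have "m \<cdot> h \<cdot> z = m \<cdot> h' \<cdot> z" "n \<cdot> h \<cdot> z = n \<cdot> h' \<cdot> z"
    using cmp_eq[OF assms(6), of z] cmp_eq[OF assms(7), of z] assms z by simp_all
  then have "h \<cdot> z \<oplus> \<ominus> (h' \<cdot> z) = \<zero> P (D n)" using assms(1,3-5) z by (intro inj[OF P]) simp_all
  then show "h \<cdot> z = h' \<cdot> z" using diff_zero_iff[of "h \<cdot> z" "h' \<cdot> z"] assms(3-5) z by simp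
qed (use assms in simp_all)

text \<open>On a projective cover of the domain the lift exists by hypothesis; injectivity forces it
  to kill the kernel of the cover, so it descends. This produces degree 1 components of 1-cells,
  whose domains need not be projective.\<close>

lemma lift_from_projectives:
  assumes t: "D m = D n" "D x = D y" "C x = C m" "C y = C n"
    and inj: "\<And>P g. projective A P \<Longrightarrow> D g = P \<Longrightarrow> C g = D n \<Longrightarrow> m \<cdot> g = \<zero> P (C m) \<Longrightarrow> n \<cdot> g = \<zero> P (C n)
      \<Longrightarrow> g = \<zero> P (D n)"
    and ex: "\<And>P z. projective A P \<Longrightarrow> D z = P \<Longrightarrow> C z = D y
      \<Longrightarrow> \<exists>g. D g = P \<and> C g = D n \<and> m \<cdot> g = x \<cdot> z \<and> n \<cdot> g = y \<cdot> z"
  obtains h where "D h = D y" "C h = D n" "m \<cdot> h = x" "n \<cdot> h = y"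
proof -
  obtain P e where e: "projective A P" "epi A e" "D e = P" "C e = D y" by (rule projective_cover)
  obtain g where g: "D g = P" "C g = D n" "m \<cdot> g = x \<cdot> e" "n \<cdot> g = y \<cdot> e" using ex[OF e(1,3,4)] by blast
  have "D g = D e" using g e by simp
  then obtain h where h: "D h = C e" "C h = C g" "h \<cdot> e = g"
  proof (rule descend[OF e(2)])
    fix Q w assume Q: "projective A Q" and w: "D w = Q" "C w = D e" "e \<cdot> w = \<zero> Q (C e)"
    have "m \<cdot> g \<cdot> w = \<zero> Q (C m)" "n \<cdot> g \<cdot> w = \<zero> Q (C n)"
      using cmp_eq[OF g(3), of w] cmp_eq[OF g(4), of w] w g(1,2) e t by simp_all
    then show "g \<cdot> w = \<zero> Q (C g)" using inj[OF Q, of "g \<cdot> w"] w g(1,2) e t by simp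
  qed
  have mh: "(m \<cdot> h) \<cdot> e = x \<cdot> e" and nh: "(n \<cdot> h) \<cdot> e = y \<cdot> e" using h g t by simp_all
  have "m \<cdot> h = x" by (rule epiD[OF e(2) mh]) (use h(1,2) g(2) e t in simp_all)
  moreover have "n \<cdot> h = y" by (rule epiD[OF e(2) nh]) (use h(1,2) g(2) e t in simp_all)
  ultimately show thesis using that h(1,2) g(2) e(4) by simp
qed

end

section \<open>The total complex of a null sequence\<close>

text \<open>Exactness of the total complex k1 \<rightarrow> k0 \<oplus> a1 \<rightarrow> a0 \<oplus> b1 \<rightarrow> b0 in its two middle places, tested on
  maps out of projectives. The arguments are u1 : k1 \<rightarrow> a1, u : k0 \<rightarrow> a0, f : a1 \<rightarrow> b1 and g : a0 \<rightarrow> b0.\<close>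

context abelian_projective
begin

definition exact_left where
  "exact_left k u1 u \<kappa> a f \<longleftrightarrow>
     (\<forall>P p r. projective A P \<longrightarrow> D p = P \<longrightarrow> C p = C k \<longrightarrow> D r = P \<longrightarrow> C r = D f \<longrightarrow>
        u \<cdot> p = a \<cdot> r \<longrightarrow> \<kappa> \<cdot> p = f \<cdot> r \<longrightarrow> (\<exists>g. D g = P \<and> C g = D k \<and> k \<cdot> g = p \<and> u1 \<cdot> g = r))"

definition exact_right where
  "exact_right u \<kappa> a f b g \<longleftrightarrow>
     (\<forall>P z y. projective A P \<longrightarrow> D z = P \<longrightarrow> C z = D g \<longrightarrow> D y = P \<longrightarrow> C y = D b \<longrightarrow> g \<cdot> z = b \<cdot> y \<longrightarrow>
        (\<exists>p r. D p = P \<and> C p = D \<kappa> \<and> D r = P \<and> C r = D f \<and> u \<cdot> p \<oplus> a \<cdot> r = z \<and> \<kappa> \<cdot> p \<oplus> f \<cdot> r = y))"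

section \<open>Maps out of an exact complex with split last map\<close>

context
  fixes u \<kappa> a f b g s t
  assumes ty: "D u = D \<kappa>" "C u = D g" "C \<kappa> = D b" "D a = D f" "C a = D g" "C f = D b" "C b = C g"
    "D s = C g" "C s = D b" "D t = C g" "C t = D g"
    and gu: "b \<cdot> \<kappa> = g \<cdot> u" and ga: "b \<cdot> f = g \<cdot> a"
    and split: "b \<cdot> s \<oplus> g \<cdot> t = I (C g)"
    and ex: "exact_right u \<kappa> a f b g"
begin

text \<open>The pair \<open>(t, - s)\<close> is a section of the last map, which takes
  \<open>(z, y)\<close> to \<open>g z - b y\<close>. The complementary projector takes
  \<open>(0, y)\<close> to \<open>(t b y, y - s b y)\<close>; the equation places this value in the
  kernel.\<close>

lemma split_left: assumes "C y = D b" shows "g \<cdot> t \<cdot> b \<cdot> y = b \<cdot> y \<oplus> \<ominus> (b \<cdot> s \<cdot> b \<cdot> y)"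
proof -
  have "(b \<cdot> s \<oplus> g \<cdot> t) \<cdot> b \<cdot> y = b \<cdot> y" using split ty assms by simp
  then have "b \<cdot> s \<cdot> b \<cdot> y \<oplus> g \<cdot> t \<cdot> b \<cdot> y = b \<cdot> y" using ty assms by simp
  then have "\<ominus> (b \<cdot> s \<cdot> b \<cdot> y) \<oplus> (b \<cdot> s \<cdot> b \<cdot> y \<oplus> g \<cdot> t \<cdot> b \<cdot> y) = \<ominus> (b \<cdot> s \<cdot> b \<cdot> y) \<oplus> b \<cdot> y" by simp
  then show ?thesis using ty assms by (simp add: add_ac)
qed

text \<open>The same projector on \<open>(z, 0)\<close>, whose value is
  \<open>(z - t g z, s g z)\<close>, written for the identity \<open>z\<close>.\<close>

lemma split_right: "g \<oplus> \<ominus> (g \<cdot> t \<cdot> g) = b \<cdot> s \<cdot> g"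
proof -
  have "(b \<cdot> s \<oplus> g \<cdot> t) \<cdot> g = g" using split ty by simp
  then have "b \<cdot> s \<cdot> g \<oplus> g \<cdot> t \<cdot> g = g" using ty by simp
  then have "(b \<cdot> s \<cdot> g \<oplus> g \<cdot> t \<cdot> g) \<oplus> \<ominus> (g \<cdot> t \<cdot> g) = g \<oplus> \<ominus> (g \<cdot> t \<cdot> g)" by simp
  then show ?thesis using ty by simp
qed

text \<open>The pair \<open>(d, - d1)\<close> vanishes on the image of the middle map; by exactness
  every generalised element of the kernel of the last map lies in that image.\<close>

lemma eq_on_pullback:
  assumes d: "D d1 = D b" "D d = D g" "C d1 = C d" "d1 \<cdot> \<kappa> = d \<cdot> u" "d1 \<cdot> f = d \<cdot> a"
    and yz: "D z = D y" "C z = D g" "C y = D b" "g \<cdot> z = b \<cdot> y"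
  shows "d1 \<cdot> y = d \<cdot> z"
proof (rule eq_if_eq_on_projectives)
  fix P w assume P: "projective A P" and w: "D w = P" "C w = D (d \<cdot> z)"
  have tw: "C w = D y" using w d yz by simp
  have "g \<cdot> z \<cdot> w = b \<cdot> y \<cdot> w" using cmp_eq[OF yz(4), of w] yz tw by simp
  then obtain p r where pr: "D p = P" "C p = D \<kappa>" "D r = P" "C r = D f"
      "u \<cdot> p \<oplus> a \<cdot> r = z \<cdot> w" "\<kappa> \<cdot> p \<oplus> f \<cdot> r = y \<cdot> w"
    using ex[unfolded exact_right_def, rule_format, OF P, of "z \<cdot> w" "y \<cdot> w"] yz w(1) tw by auto
  have "d1 \<cdot> y \<cdot> w = d \<cdot> z \<cdot> w"
    unfolding pr(5,6)[symmetric] using pr(1-4) ty d d(4,5)[THEN cmp_eq] by simp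
  then show "(d1 \<cdot> y) \<cdot> w = (d \<cdot> z) \<cdot> w" using tw yz d by simp
qed (use d yz in simp_all)

text \<open>A pair that vanishes on the kernel of a split epi factors through it, and the factor is
  the composite with the section, here \<open>d1 s + d t\<close>. The two equations come from
  evaluating at the projections of \<open>(0, 1)\<close> and \<open>(1, 0)\<close>.\<close>

lemma map_from_target:
  assumes d: "D d1 = D b" "D d = D g" "C d1 = C d" "d1 \<cdot> \<kappa> = d \<cdot> u" "d1 \<cdot> f = d \<cdot> a"
  shows "(d1 \<cdot> s \<oplus> d \<cdot> t) \<cdot> b = d1" "(d1 \<cdot> s \<oplus> d \<cdot> t) \<cdot> g = d"
proof -
  have "d1 \<cdot> (I (D b) \<oplus> \<ominus> (s \<cdot> b)) = d \<cdot> t \<cdot> b"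
    using split_left[of "I (D b)"] ty by (intro eq_on_pullback[OF d]) simp_all
  then have "d1 \<oplus> \<ominus> (d1 \<cdot> s \<cdot> b) = d \<cdot> t \<cdot> b" using ty d by simp
  from this[symmetric] show "(d1 \<cdot> s \<oplus> d \<cdot> t) \<cdot> b = d1" using ty d by (simp add: add_ac)
  have "d1 \<cdot> s \<cdot> g = d \<cdot> (I (D g) \<oplus> \<ominus> (t \<cdot> g))"
    using split_right ty by (intro eq_on_pullback[OF d]) simp_all
  then show "(d1 \<cdot> s \<oplus> d \<cdot> t) \<cdot> g = d" using ty d by simp
qed

text \<open>Since the complex is exact and its last map is split epi, a map given on k0 and a1 that
  respects the relations extends to a0 \<oplus> b1; the extension is unique on the image of k0 \<oplus> a1,
  and is taken to vanish on the image of the splitting.\<close>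
lemma extension:
  assumes P0: "projective A (D g)"
    and w: "D \<phi> = D \<kappa>" "D w = D f" "C w = C \<phi>"
    and rel: "\<And>P p r. projective A P \<Longrightarrow> D p = P \<Longrightarrow> C p = D \<kappa> \<Longrightarrow> D r = P \<Longrightarrow> C r = D f \<Longrightarrow>
      u \<cdot> p \<oplus> a \<cdot> r = \<zero> P (D g) \<Longrightarrow> \<kappa> \<cdot> p \<oplus> f \<cdot> r = \<zero> P (D b) \<Longrightarrow> \<phi> \<cdot> p \<oplus> w \<cdot> r = \<zero> P (C \<phi>)"
  obtains v \<beta> where "D v = D b" "C v = C \<phi>" "D \<beta> = D g" "C \<beta> = C \<phi>"
    "v \<cdot> \<kappa> = \<beta> \<cdot> u \<oplus> \<phi>" "v \<cdot> f = \<beta> \<cdot> a \<oplus> w"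
proof -
  \<comment> \<open>The projection of \<open>(1, 0)\<close> lies in the kernel and, as
    \<open>D g\<close> is projective, has a preimage \<open>(p0, r0)\<close> defined on
    \<open>D g\<close> itself.\<close>
  have "g \<cdot> (I (D g) \<oplus> \<ominus> (t \<cdot> g)) = b \<cdot> s \<cdot> g" using split_right ty by simp
  then obtain p0 r0 where pr0: "D p0 = D g" "C p0 = D \<kappa>" "D r0 = D g" "C r0 = D f"
      "u \<cdot> p0 \<oplus> a \<cdot> r0 = I (D g) \<oplus> \<ominus> (t \<cdot> g)" "\<kappa> \<cdot> p0 \<oplus> f \<cdot> r0 = s \<cdot> g"
    using ex[unfolded exact_right_def, rule_format, OF P0, of "I (D g) \<oplus> \<ominus> (t \<cdot> g)" "s \<cdot> g"] ty by auto
  \<comment> \<open>The extension has components \<open>- \<beta>\<close> and \<open>v\<close>,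
    whence the sign; its value at \<open>(1, 0)\<close> is computed from the preimage.\<close>
  define \<beta> where "\<beta> = \<ominus> (\<phi> \<cdot> p0 \<oplus> w \<cdot> r0)"
  have t\<beta>: "D \<beta> = D g" "C \<beta> = C \<phi>" using pr0(1-4) w by (simp_all add: \<beta>_def)
  \<comment> \<open>\<open>D b\<close> need not be projective, so the value at \<open>(0, 1)\<close>
    is computed on a cover \<open>e\<close> and has to be descended.\<close>
  obtain Q e where e: "projective A Q" "epi A e" "D e = Q" "C e = D b" by (rule projective_cover)
  have "g \<cdot> t \<cdot> b \<cdot> e = b \<cdot> (e \<oplus> \<ominus> (s \<cdot> b \<cdot> e))" using split_left[of e] ty e by simp
  then obtain p1 r1 where pr1: "D p1 = Q" "C p1 = D \<kappa>" "D r1 = Q" "C r1 = D f"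
      "u \<cdot> p1 \<oplus> a \<cdot> r1 = t \<cdot> b \<cdot> e" "\<kappa> \<cdot> p1 \<oplus> f \<cdot> r1 = e \<oplus> \<ominus> (s \<cdot> b \<cdot> e)"
    using ex[unfolded exact_right_def, rule_format, OF e(1), of "t \<cdot> b \<cdot> e" "e \<oplus> \<ominus> (s \<cdot> b \<cdot> e)"] ty e by auto
  \<comment> \<open>Two preimages of the same element differ by a relation, on which
    \<open>\<phi>\<close> and \<open>w\<close> cancel by \<open>rel\<close>; so the value is
    independent of the choice.\<close>
  have well: "(\<phi> \<cdot> p1 \<oplus> w \<cdot> r1) \<cdot> y = \<phi> \<cdot> p \<oplus> w \<cdot> r"
    if y: "projective A P" "D y = P" "C y = Q" and pr: "D p = P" "C p = D \<kappa>" "D r = P" "C r = D f"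
      "u \<cdot> p \<oplus> a \<cdot> r = t \<cdot> b \<cdot> e \<cdot> y" "\<kappa> \<cdot> p \<oplus> f \<cdot> r = e \<cdot> y \<oplus> \<ominus> (s \<cdot> b \<cdot> e \<cdot> y)" for P y p r
  proof -
    have "(u \<cdot> p1 \<oplus> a \<cdot> r1) \<cdot> y \<oplus> \<ominus> (u \<cdot> p \<oplus> a \<cdot> r) = \<zero> P (D g)"
      unfolding pr1 pr using y e ty by simp
    then have 1: "u \<cdot> (p1 \<cdot> y \<oplus> \<ominus> p) \<oplus> a \<cdot> (r1 \<cdot> y \<oplus> \<ominus> r) = \<zero> P (D g)"
      using pr1(1-4) pr(1-4) y ty by (simp add: add_ac)
    have "(\<kappa> \<cdot> p1 \<oplus> f \<cdot> r1) \<cdot> y \<oplus> \<ominus> (\<kappa> \<cdot> p \<oplus> f \<cdot> r) = \<zero> P (D b)"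
      unfolding pr1 pr using y e ty by (simp add: add_ac)
    then have 2: "\<kappa> \<cdot> (p1 \<cdot> y \<oplus> \<ominus> p) \<oplus> f \<cdot> (r1 \<cdot> y \<oplus> \<ominus> r) = \<zero> P (D b)"
      using pr1(1-4) pr(1-4) y ty by (simp add: add_ac)
    have "\<phi> \<cdot> (p1 \<cdot> y \<oplus> \<ominus> p) \<oplus> w \<cdot> (r1 \<cdot> y \<oplus> \<ominus> r) = \<zero> P (C \<phi>)"
      using rel[OF y(1) _ _ _ _ 1 2] pr1(1-4) pr(1-4) y by simp
    then show ?thesis
      using diff_zero_iff[of "(\<phi> \<cdot> p1 \<oplus> w \<cdot> r1) \<cdot> y" "\<phi> \<cdot> p \<oplus> w \<cdot> r"] pr1(1-4) pr(1-4) y ty w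
      by (simp add: add_ac)
  qed
  have "D (\<phi> \<cdot> p1 \<oplus> w \<cdot> r1) = D e" using pr1(1-4) w e by simp
  then obtain v where v: "D v = C e" "C v = C (\<phi> \<cdot> p1 \<oplus> w \<cdot> r1)" "v \<cdot> e = \<phi> \<cdot> p1 \<oplus> w \<cdot> r1"
  proof (rule descend[OF e(2)])
    fix P y assume P: "projective A P" and y: "D y = P" "C y = D e" "e \<cdot> y = \<zero> P (C e)"
    show "(\<phi> \<cdot> p1 \<oplus> w \<cdot> r1) \<cdot> y = \<zero> P (C (\<phi> \<cdot> p1 \<oplus> w \<cdot> r1))"
      using well[OF P, of y "\<zero> P (D \<kappa>)" "\<zero> P (D f)"] y e ty w pr1(1-4) by simp
  qed
  have tv: "D v = D b" "C v = C \<phi>" using v(1,2) e pr1(1-4) w by simp_all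
  have value_v: "v \<cdot> y = \<phi> \<cdot> p \<oplus> w \<cdot> r"
    if y: "projective A P" "D y = P" "C y = D b" and pr: "D p = P" "C p = D \<kappa>" "D r = P" "C r = D f"
      "u \<cdot> p \<oplus> a \<cdot> r = t \<cdot> b \<cdot> y" "\<kappa> \<cdot> p \<oplus> f \<cdot> r = y \<oplus> \<ominus> (s \<cdot> b \<cdot> y)" for P y p r
  proof -
    obtain y' where y': "D y' = P" "C y' = D e" "e \<cdot> y' = y"
      using projective_lift[OF y(1) e(2)] y e by metis
    have "v \<cdot> y = (\<phi> \<cdot> p1 \<oplus> w \<cdot> r1) \<cdot> y'" using v(3) cmp_eq[OF v(3), of y'] y' v(1) by simp
    then show ?thesis using well[OF y(1) y'(1) _ pr(1-4)] y' e pr by simp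
  qed
  have "v \<cdot> \<kappa> = \<beta> \<cdot> u \<oplus> \<phi>"
  proof (rule eq_if_eq_on_projectives)
    fix P c assume P: "projective A P" and c: "D c = P" "C c = D (\<beta> \<cdot> u \<oplus> \<phi>)"
    have tc: "C c = D \<kappa>" using c ty w t\<beta> by simp
    \<comment> \<open>\<open>(u c, \<kappa> c)\<close> is the image of \<open>(c, 0)\<close> and is
      fixed by the projector. Subtracting the preimage of the projection of \<open>(u c, 0)\<close>
      leaves a preimage of the projection of \<open>(0, \<kappa> c)\<close>.\<close>
    have 1: "u \<cdot> (c \<oplus> \<ominus> (p0 \<cdot> u \<cdot> c)) \<oplus> a \<cdot> (\<ominus> (r0 \<cdot> u \<cdot> c)) = t \<cdot> b \<cdot> \<kappa> \<cdot> c"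
    proof -
      have "u \<cdot> (c \<oplus> \<ominus> (p0 \<cdot> u \<cdot> c)) \<oplus> a \<cdot> (\<ominus> (r0 \<cdot> u \<cdot> c)) = u \<cdot> c \<oplus> \<ominus> ((u \<cdot> p0 \<oplus> a \<cdot> r0) \<cdot> u \<cdot> c)"
        using pr0(1-4) c tc ty by simp
      also have "\<dots> = t \<cdot> g \<cdot> u \<cdot> c" unfolding pr0 using c tc ty by simp
      finally show ?thesis using cmp_eq[OF gu, of c] tc ty by simp
    qed
    have 2: "\<kappa> \<cdot> (c \<oplus> \<ominus> (p0 \<cdot> u \<cdot> c)) \<oplus> f \<cdot> (\<ominus> (r0 \<cdot> u \<cdot> c)) = \<kappa> \<cdot> c \<oplus> \<ominus> (s \<cdot> b \<cdot> \<kappa> \<cdot> c)"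
    proof -
      have "\<kappa> \<cdot> (c \<oplus> \<ominus> (p0 \<cdot> u \<cdot> c)) \<oplus> f \<cdot> (\<ominus> (r0 \<cdot> u \<cdot> c)) = \<kappa> \<cdot> c \<oplus> \<ominus> ((\<kappa> \<cdot> p0 \<oplus> f \<cdot> r0) \<cdot> u \<cdot> c)"
        using pr0(1-4) c tc ty by simp
      also have "\<dots> = \<kappa> \<cdot> c \<oplus> \<ominus> (s \<cdot> g \<cdot> u \<cdot> c)" unfolding pr0 using c tc ty by simp
      finally show ?thesis using cmp_eq[OF gu, of c] tc ty by simp
    qed
    have "v \<cdot> \<kappa> \<cdot> c = \<phi> \<cdot> (c \<oplus> \<ominus> (p0 \<cdot> u \<cdot> c)) \<oplus> w \<cdot> (\<ominus> (r0 \<cdot> u \<cdot> c))"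
      by (rule value_v[OF P _ _ _ _ _ _ 1 2]) (use pr0(1-4) c tc ty in simp_all)
    then show "(v \<cdot> \<kappa>) \<cdot> c = (\<beta> \<cdot> u \<oplus> \<phi>) \<cdot> c"
      using pr0(1-4) c(1) tc ty tv w by (simp add: \<beta>_def add_ac)
  qed (use ty w tv t\<beta> in simp_all)
  moreover have "v \<cdot> f = \<beta> \<cdot> a \<oplus> w"
  proof (rule eq_if_eq_on_projectives)
    fix P c assume P: "projective A P" and c: "D c = P" "C c = D (\<beta> \<cdot> a \<oplus> w)"
    have tc: "C c = D f" using c ty w t\<beta> by simp
    \<comment> \<open>The same with \<open>(0, c)\<close>, whose image is
      \<open>(a c, f c)\<close>.\<close>
    have 1: "u \<cdot> (\<ominus> (p0 \<cdot> a \<cdot> c)) \<oplus> a \<cdot> (c \<oplus> \<ominus> (r0 \<cdot> a \<cdot> c)) = t \<cdot> b \<cdot> f \<cdot> c"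
    proof -
      have "u \<cdot> (\<ominus> (p0 \<cdot> a \<cdot> c)) \<oplus> a \<cdot> (c \<oplus> \<ominus> (r0 \<cdot> a \<cdot> c)) = a \<cdot> c \<oplus> \<ominus> ((u \<cdot> p0 \<oplus> a \<cdot> r0) \<cdot> a \<cdot> c)"
        using pr0(1-4) c tc ty by (simp add: add_ac)
      also have "\<dots> = t \<cdot> g \<cdot> a \<cdot> c" unfolding pr0 using c tc ty by simp
      finally show ?thesis using cmp_eq[OF ga, of c] tc ty by simp
    qed
    have 2: "\<kappa> \<cdot> (\<ominus> (p0 \<cdot> a \<cdot> c)) \<oplus> f \<cdot> (c \<oplus> \<ominus> (r0 \<cdot> a \<cdot> c)) = f \<cdot> c \<oplus> \<ominus> (s \<cdot> b \<cdot> f \<cdot> c)"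
    proof -
      have "\<kappa> \<cdot> (\<ominus> (p0 \<cdot> a \<cdot> c)) \<oplus> f \<cdot> (c \<oplus> \<ominus> (r0 \<cdot> a \<cdot> c)) = f \<cdot> c \<oplus> \<ominus> ((\<kappa> \<cdot> p0 \<oplus> f \<cdot> r0) \<cdot> a \<cdot> c)"
        using pr0(1-4) c tc ty by (simp add: add_ac)
      also have "\<dots> = f \<cdot> c \<oplus> \<ominus> (s \<cdot> g \<cdot> a \<cdot> c)" unfolding pr0 using c tc ty by simp
      finally show ?thesis using cmp_eq[OF ga, of c] tc ty by simp
    qed
    have "v \<cdot> f \<cdot> c = \<phi> \<cdot> (\<ominus> (p0 \<cdot> a \<cdot> c)) \<oplus> w \<cdot> (c \<oplus> \<ominus> (r0 \<cdot> a \<cdot> c))"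
      by (rule value_v[OF P _ _ _ _ _ _ 1 2]) (use pr0(1-4) c tc ty in simp_all)
    then show "(v \<cdot> f) \<cdot> c = (\<beta> \<cdot> a \<oplus> w) \<cdot> c"
      using pr0(1-4) c(1) tc ty tv w by (simp add: \<beta>_def add_ac)
  qed (use ty w tv t\<beta> in simp_all)
  ultimately show thesis using that tv t\<beta> by blast
qed

end

section \<open>1-cells and 2-cells as equations\<close>

lemma mor_iff: "c_mor A a b f \<longleftrightarrow>
    D (fst f) = C a \<and> C (fst f) = C b \<and> D (snd f) = D a \<and> C (snd f) = D b \<and> b \<cdot> snd f = fst f \<cdot> a"
  by (simp add: c_mor_def conj_assoc)

lemma cell_iff: "c_cell A a b f g \<alpha> \<longleftrightarrow> c_mor A a b f \<and> c_mor A a b g \<and> D \<alpha> = C a \<and> C \<alpha> = D b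
    \<and> snd f = \<alpha> \<cdot> a \<oplus> snd g \<and> fst f = b \<cdot> \<alpha> \<oplus> fst g"
proof (cases "c_mor A a b f \<and> c_mor A a b g \<and> D \<alpha> = C a \<and> C \<alpha> = D b")
  case True
  then show ?thesis by (simp add: c_cell_def mor_iff)
qed (auto simp: c_cell_def)

lemmas c_simps = mor_iff cell_iff c_comp_def c_zero_def c_id_def c_idcell_def c_add_def c_neg_def wl_def wr_def

text \<open>Such a \<open>g\<close> is a 2-cell between zero 1-cells from the test object
  \<open>Z -> P\<close> to \<open>k\<close>, and its whiskering with \<open>u\<close> is an
  identity.\<close>

lemma faithfulD:
  assumes "c_faithful A k a u" "projective A P" "D g = P" "C g = D k"
    "k \<cdot> g = \<zero> P (C k)" "snd u \<cdot> g = \<zero> P (C (snd u))"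
  shows "g = \<zero> P (D k)"
proof -
  let ?x = "\<zero> Z P"
  have "c_mor A k a u" using assms(1) unfolding c_faithful_def by blast
  then have u: "D (snd u) = D k" by (simp add: mor_iff)
  have "g \<cdot> ?x = \<zero> Z (D k)" using assms by simp
  then have "c_obj A ?x \<and> c_cell A ?x k (c_zero A ?x k) (c_zero A ?x k) g
      \<and> c_cell A ?x k (c_zero A ?x k) (c_zero A ?x k) (\<zero> P (D k)) \<and> wl A u g = wl A u (\<zero> P (D k))"
    using assms(2-6) u by (simp add: c_obj_def c_simps)
  then show ?thesis using assms(1) unfolding c_faithful_def by blast
qed

text \<open>The joint cokernel \<open>q\<close> of \<open>b\<close> and \<open>fst f\<close> is a
  2-cell between zero 1-cells into the test object \<open>C q -> Z\<close>, and its whiskering with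
  \<open>f\<close> is an identity, so \<open>q = 0\<close>. Then the identity of \<open>C b\<close>,
  being a map out of a projective, is hit by \<open>b\<close> and \<open>fst f\<close>
  together.\<close>

lemma cofaithful_split:
  assumes "c_cofaithful A a b f"
  obtains s t where "D s = C b" "C s = D b" "D t = C b" "C t = C a" "b \<cdot> s \<oplus> fst f \<cdot> t = I (C b)"
proof -
  have b: "projective A (C b)" and f: "c_mor A a b f" using assms unfolding c_cofaithful_def c_obj_def by auto
  note f = f[unfolded mor_iff]
  have "C (fst f) = C b" using f by simp
  then obtain q where q: "D q = C b" "epi A q" "q \<cdot> b = \<zero> (D b) (C q)" "q \<cdot> fst f = \<zero> (D (fst f)) (C q)"
    "\<forall>y. D y = C b \<longrightarrow> y \<cdot> b = \<zero> (D b) (C y) \<longrightarrow> y \<cdot> fst f = \<zero> (D (fst f)) (C y)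
      \<longrightarrow> (\<exists>h. D h = C q \<and> C h = C y \<and> h \<cdot> q = y)"
    and ex: "\<forall>P y. projective A P \<longrightarrow> D y = P \<longrightarrow> C y = C b \<longrightarrow> q \<cdot> y = \<zero> P (C q)
      \<longrightarrow> (\<exists>s t. D s = P \<and> C s = D b \<and> D t = P \<and> C t = D (fst f) \<and> y = b \<cdot> s \<oplus> fst f \<cdot> t)"
    by (rule joint_cokernel)
  let ?x = "\<zero> (C q) Z"
  have "?x \<cdot> q = \<zero> (C b) Z" using q by simp
  then have "c_obj A ?x \<and> c_cell A b ?x (c_zero A b ?x) (c_zero A b ?x) q
      \<and> c_cell A b ?x (c_zero A b ?x) (c_zero A b ?x) (\<zero> (C b) (C q)) \<and> wr A q f = wr A (\<zero> (C b) (C q)) f"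
    using projective_Z q f by (simp add: c_obj_def c_simps)
  then have "q = \<zero> (C b) (C q)" using assms unfolding c_cofaithful_def by blast
  then have "q \<cdot> I (C b) = \<zero> (C b) (C q)" using q by simp
  then show thesis using ex[rule_format, OF b, of "I (C b)"] that f by auto
qed

section \<open>From universal properties to exactness\<close>

text \<open>Out of the test object \<open>Z -> P\<close>, a 1-cell is a generalised element in
  degree 0 and a 2-cell one in degree 1. Fullness then reads as exactness at \<open>k0 + a1\<close>,
  essential surjectivity as exactness at \<open>a0 + b1\<close>.\<close>

lemma exact_of_kernel:
  assumes f: "c_mor A a b f" and ker: "c_is_2kernel A a b f k u \<kappa>"
  shows "exact_left k (snd u) (fst u) \<kappa> a (snd f)" "exact_right (fst u) \<kappa> a (snd f) b (fst f)"
proof -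
  have u: "c_mor A k a u" and \<kappa>: "c_cell A k b (c_comp A f u) (c_zero A k b) \<kappa>"
    using ker unfolding c_is_2kernel_def by auto
  note ty = f[unfolded mor_iff] u[unfolded mor_iff] \<kappa>[unfolded cell_iff, THEN conjunct2, THEN conjunct2]
  show "exact_left k (snd u) (fst u) \<kappa> a (snd f)"
    unfolding exact_left_def
  proof (intro allI impI)
    fix P p r assume P: "projective A P" and a: "D p = P" "C p = C k" "D r = P" "C r = D (snd f)"
      "fst u \<cdot> p = a \<cdot> r" "\<kappa> \<cdot> p = snd f \<cdot> r"
    let ?x = "\<zero> Z P"
    let ?v = "(p, \<zero> Z (D k))" and ?v' = "(\<zero> P (C k), \<zero> Z (D k))"
    have x: "c_obj A ?x" using P by (simp add: c_obj_def)
    have "c_mor A ?x k ?v \<and> c_mor A ?x k ?v' \<and> c_cell A ?x a (c_comp A u ?v) (c_comp A u ?v') r \<and>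
       wr A \<kappa> ?v = Add A (wl A f r) (wr A \<kappa> ?v')"
      using a ty by (simp add: c_simps)
    then obtain \<gamma> where "c_cell A ?x k ?v ?v' \<gamma>" "wl A u \<gamma> = r"
      using ker x unfolding c_is_2kernel_def by blast
    then show "\<exists>g. D g = P \<and> C g = D k \<and> k \<cdot> g = p \<and> snd u \<cdot> g = r"
      by (intro exI[of _ \<gamma>]) (simp add: c_simps)
  qed
  show "exact_right (fst u) \<kappa> a (snd f) b (fst f)"
    unfolding exact_right_def
  proof (intro allI impI)
    fix P z y assume P: "projective A P" and a: "D z = P" "C z = D (fst f)" "D y = P" "C y = D b"
      "fst f \<cdot> z = b \<cdot> y"
    let ?x = "\<zero> Z P" and ?w = "(z, \<zero> Z (D a))"
    have x: "c_obj A ?x" using P by (simp add: c_obj_def)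
    have "c_mor A ?x a ?w \<and> c_cell A ?x b (c_comp A f ?w) (c_zero A ?x b) y"
      using a ty by (simp add: c_simps)
    then obtain v \<beta> where v: "c_mor A ?x k v" "c_cell A ?x a (c_comp A u v) ?w \<beta>"
        "wr A \<kappa> v = Add A (wl A f \<beta>) y"
      using ker x unfolding c_is_2kernel_def by blast
    \<comment> \<open>\<open>exact_right\<close> adds the two terms, while the 2-cell expresses
      \<open>u p\<close> as \<open>a \<beta> + z\<close>; hence the witness
      \<open>\<ominus> \<beta>\<close>.\<close>
    show "\<exists>p r. D p = P \<and> C p = D \<kappa> \<and> D r = P \<and> C r = D (snd f)
        \<and> fst u \<cdot> p \<oplus> a \<cdot> r = z \<and> \<kappa> \<cdot> p \<oplus> snd f \<cdot> r = y"
      using v a ty by (intro exI[of _ "fst v"] exI[of _ "\<ominus> \<beta>"]) (simp add: c_simps add_ac)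
  qed
qed

text \<open>Into a test object \<open>X -> Z\<close>, a 1-cell is a map from degree 1 to
  \<open>X\<close> and a 2-cell a map from degree 0. The tests use universal choices of
  \<open>X\<close>: the pushout of \<open>snd u\<close> and \<open>k\<close> for exactness at
  \<open>k0 + a1\<close>, the cokernel of the middle map for exactness at
  \<open>a0 + b1\<close>.\<close>

lemma exact_of_cokernel:
  assumes u: "c_mor A k a u" and coker: "c_is_2cokernel A k a u b f \<kappa>"
  shows "exact_left k (snd u) (fst u) \<kappa> a (snd f)" "exact_right (fst u) \<kappa> a (snd f) b (fst f)"
proof -
  have f: "c_mor A a b f" and \<kappa>: "c_cell A k b (c_comp A f u) (c_zero A k b) \<kappa>"
    using coker unfolding c_is_2cokernel_def by auto
  note ty = f[unfolded mor_iff] u[unfolded mor_iff] \<kappa>[unfolded cell_iff, THEN conjunct2, THEN conjunct2]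
  have "D (snd u) = D k" using ty by simp
  then obtain i j where ij: "D i = C (snd u)" "D j = C k" "C i = C j" "i \<cdot> snd u = j \<cdot> k"
    "\<forall>x y. C x = C y \<longrightarrow> D x = C (snd u) \<longrightarrow> D y = C k \<longrightarrow> x \<cdot> snd u = y \<cdot> k
      \<longrightarrow> (\<exists>h. D h = C j \<and> C h = C y \<and> h \<cdot> i = x \<and> h \<cdot> j = y)"
    and ex: "\<forall>P y z. projective A P \<longrightarrow> D y = P \<longrightarrow> C y = C (snd u) \<longrightarrow> D z = P \<longrightarrow> C z = C k \<longrightarrow> i \<cdot> y = j \<cdot> z
      \<longrightarrow> (\<exists>g. D g = P \<and> C g = D (snd u) \<and> snd u \<cdot> g = y \<and> k \<cdot> g = z)"
    "\<forall>P w. projective A P \<longrightarrow> D w = P \<longrightarrow> C w = C j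
      \<longrightarrow> (\<exists>y z. D y = P \<and> C y = C (snd u) \<and> D z = P \<and> C z = C k \<and> i \<cdot> y \<oplus> j \<cdot> z = w)"
    by (rule pushout)
  let ?x = "\<zero> (C j) Z" and ?w = "(\<zero> (C a) Z, i)"
  have x: "c_obj A ?x" using projective_Z by (simp add: c_obj_def)
  \<comment> \<open>The pushout square says that \<open>j\<close> is a 2-cell from
    \<open>i (snd u)\<close> to zero; essential surjectivity then extends \<open>i\<close> to
    \<open>b1\<close> up to a homotopy \<open>\<beta>\<close>.\<close>
  have "c_mor A a ?x ?w \<and> c_cell A k ?x (c_comp A ?w u) (c_zero A k ?x) j"
    using ij(1-4) ty by (simp add: c_simps)
  then obtain v \<beta> where v: "c_mor A b ?x v" "c_cell A a ?x (c_comp A v f) ?w \<beta>" "wl A v \<kappa> = Add A (wr A \<beta> u) j"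
    using coker x unfolding c_is_2cokernel_def by blast
  note v = v[unfolded c_simps]
  show "exact_left k (snd u) (fst u) \<kappa> a (snd f)"
    unfolding exact_left_def
  proof (intro allI impI)
    fix P p r assume P: "projective A P" and a: "D p = P" "C p = C k" "D r = P" "C r = D (snd f)"
      "fst u \<cdot> p = a \<cdot> r" "\<kappa> \<cdot> p = snd f \<cdot> r"
    have e1: "snd v \<cdot> snd f = \<beta> \<cdot> a \<oplus> i" using v by simp
    have "\<beta> \<cdot> a \<cdot> r \<oplus> j \<cdot> p = (snd v \<cdot> \<kappa>) \<cdot> p" unfolding v(3) using v(1,2) a ij(1-3) ty by simp
    also have "\<dots> = (snd v \<cdot> snd f) \<cdot> r" using cmp_eq[OF e1, of r] v(1,2) a ty by simp
    also have "\<dots> = \<beta> \<cdot> a \<cdot> r \<oplus> i \<cdot> r" unfolding e1 using v(1,2) a ij(1-3) ty by simp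
    finally have "i \<cdot> r = j \<cdot> p" using v(1,2) a ij(1-3) ty by simp
    then show "\<exists>g. D g = P \<and> C g = D k \<and> k \<cdot> g = p \<and> snd u \<cdot> g = r"
      using ex(1)[rule_format, OF P, of r p] a ty by auto
  qed
  have "D (fst u) = D \<kappa>" "D a = D (snd f)" "C a = C (fst u)" "C (snd f) = C \<kappa>" using ty by simp_all
  then obtain e d where ed: "D e = C (fst u)" "D d = C \<kappa>" "C d = C e"
    "e \<cdot> fst u = \<ominus> (d \<cdot> \<kappa>)" "e \<cdot> a = \<ominus> (d \<cdot> snd f)"
    and ex2: "\<forall>P z y. projective A P \<longrightarrow> D z = P \<longrightarrow> C z = C (fst u) \<longrightarrow> D y = P \<longrightarrow> C y = C \<kappa>
      \<longrightarrow> e \<cdot> z = \<ominus> (d \<cdot> y) \<longrightarrow> (\<exists>p r. D p = P \<and> C p = D \<kappa> \<and> D r = P \<and> C r = D (snd f)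
        \<and> fst u \<cdot> p \<oplus> a \<cdot> r = z \<and> \<kappa> \<cdot> p \<oplus> snd f \<cdot> r = y)"
    by (rule matrix_cokernel)
  let ?y = "\<zero> (C e) Z" and ?v = "(\<zero> (C b) Z, d)" and ?v' = "(\<zero> (C b) Z, \<zero> (D b) (C e))"
  have y: "c_obj A ?y" using projective_Z by (simp add: c_obj_def)
  \<comment> \<open>The relations for \<open>e\<close> and \<open>d\<close> make
    \<open>\<ominus> e\<close> a 2-cell from \<open>d (snd f)\<close> to zero that is compatible
    with \<open>\<kappa>\<close>. Fullness gives a \<open>\<gamma>\<close> on \<open>b0\<close>
    through which both factor, so together they vanish on the kernel of the last map.\<close>
  have "c_mor A b ?y ?v \<and> c_mor A b ?y ?v' \<and> c_cell A a ?y (c_comp A ?v f) (c_comp A ?v' f) (\<ominus> e)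
     \<and> wl A ?v \<kappa> = Add A (wr A (\<ominus> e) u) (wl A ?v' \<kappa>)"
    using ed ty by (simp add: c_simps)
  then obtain \<gamma> where \<gamma>: "c_cell A b ?y ?v ?v' \<gamma>" "wr A \<gamma> f = \<ominus> e"
    using coker y unfolding c_is_2cokernel_def by blast
  have \<gamma>: "D \<gamma> = C b" "C \<gamma> = C e" "\<gamma> \<cdot> b = d" "\<gamma> \<cdot> fst f = \<ominus> e" using \<gamma> by (simp_all add: c_simps)
  show "exact_right (fst u) \<kappa> a (snd f) b (fst f)"
    unfolding exact_right_def
  proof (intro allI impI)
    fix P z y assume P: "projective A P" and a: "D z = P" "C z = D (fst f)" "D y = P" "C y = D b"
      "fst f \<cdot> z = b \<cdot> y"
    have "(\<gamma> \<cdot> fst f) \<cdot> z = (\<gamma> \<cdot> b) \<cdot> y" using \<gamma>(1,2) a ty by simp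
    then have "\<ominus> (e \<cdot> z) = d \<cdot> y" unfolding \<gamma> using a ed(1-3) ty by simp
    then have "e \<cdot> z = \<ominus> (d \<cdot> y)" by (metis neg_neg)
    then show "\<exists>p r. D p = P \<and> C p = D \<kappa> \<and> D r = P \<and> C r = D (snd f)
        \<and> fst u \<cdot> p \<oplus> a \<cdot> r = z \<and> \<kappa> \<cdot> p \<oplus> snd f \<cdot> r = y"
      using ex2[rule_format, OF P, of z y] a ty by simp
  qed
qed

section \<open>From exactness to universal properties\<close>

text \<open>Exactness at \<open>k1\<close> is the separate assumption \<open>inj\<close>, since it
  comes from faithfulness in one use and from the uniqueness part of a pullback in another. Degree 0
  components and 2-cells have the projective domain \<open>C x\<close> and come straight from
  exactness.\<close>

lemma kernel_of_exact:
  assumes k: "c_obj A k" and u: "c_mor A k a u" and f: "c_mor A a b f"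
    and \<kappa>: "c_cell A k b (c_comp A f u) (c_zero A k b) \<kappa>"
    and exl: "exact_left k (snd u) (fst u) \<kappa> a (snd f)" and exr: "exact_right (fst u) \<kappa> a (snd f) b (fst f)"
    and inj: "\<And>P g. projective A P \<Longrightarrow> D g = P \<Longrightarrow> C g = D k \<Longrightarrow> k \<cdot> g = \<zero> P (C k)
      \<Longrightarrow> snd u \<cdot> g = \<zero> P (C (snd u)) \<Longrightarrow> g = \<zero> P (D k)"
  shows "c_is_2kernel A a b f k u \<kappa>"
proof -
  note tf = f[unfolded mor_iff] and tu = u[unfolded mor_iff]
  have t\<kappa>: "D \<kappa> = C k" "C \<kappa> = D b" using \<kappa> by (simp_all add: cell_iff)
  have fu: "b \<cdot> \<kappa> = fst f \<cdot> fst u" "snd f \<cdot> snd u = \<kappa> \<cdot> k" using \<kappa> tf tu by (simp_all add: c_simps)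
  have inj': "g = \<zero> P (D (snd u))" if "projective A P" "D g = P" "C g = D (snd u)" "k \<cdot> g = \<zero> P (C k)"
      "snd u \<cdot> g = \<zero> P (C (snd u))" for P g
    using inj[of P g] that tu by simp
  have uniq: "h = h'" if "C h = D k" "C h' = D k" "D h = D h'" "k \<cdot> h = k \<cdot> h'" "snd u \<cdot> h = snd u \<cdot> h'" for h h'
    by (rule jointly_mono_from_projectives[of k "snd u", OF _ inj']) (use that tu in simp_all)
  have surj: "\<exists>v \<beta>. c_mor A x k v \<and> c_cell A x a (c_comp A u v) w \<beta> \<and> wr A \<kappa> v = Add A (wl A f \<beta>) \<phi>"
    if x: "c_obj A x" and w: "c_mor A x a w" and \<phi>: "c_cell A x b (c_comp A f w) (c_zero A x b) \<phi>" for x w \<phi>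
  proof -
    note tw = w[unfolded mor_iff]
    have t\<phi>: "D \<phi> = C x" "C \<phi> = D b" using \<phi> by (simp_all add: cell_iff)
    have fw: "fst f \<cdot> fst w = b \<cdot> \<phi>" "snd f \<cdot> snd w = \<phi> \<cdot> x" using \<phi> tf tw by (simp_all add: c_simps)
    \<comment> \<open>\<open>p\<close> becomes the degree 0 component of \<open>v\<close>, and
      \<open>\<ominus> r\<close> the 2-cell.\<close>
    obtain p r where pr: "D p = C x" "C p = C k" "D r = C x" "C r = D a"
        "fst u \<cdot> p \<oplus> a \<cdot> r = fst w" "\<kappa> \<cdot> p \<oplus> snd f \<cdot> r = \<phi>"
      using exr[unfolded exact_right_def, rule_format, OF x[unfolded c_obj_def], of "fst w" \<phi>] tw t\<phi> tf t\<kappa> fw by auto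
    have up: "fst u \<cdot> p = \<ominus> (a \<cdot> r) \<oplus> fst w" and kp: "\<kappa> \<cdot> p = \<ominus> (snd f \<cdot> r) \<oplus> \<phi>"
      using pr(1-4) tu tf t\<kappa> by (simp_all flip: pr(5,6) add: add_ac)
    \<comment> \<open>\<open>D x\<close> need not be projective: on each generalised element
      \<open>z\<close> of it the pair \<open>(p x z, (snd w - r x) z)\<close> is a cycle and lifts
      to \<open>k1\<close>; the lifts are then glued.\<close>
    obtain v1 where v1: "D v1 = D (snd w \<oplus> \<ominus> (r \<cdot> x))" "C v1 = D (snd u)" "k \<cdot> v1 = p \<cdot> x" "snd u \<cdot> v1 = snd w \<oplus> \<ominus> (r \<cdot> x)"
    proof (rule lift_from_projectives[of k "snd u" "p \<cdot> x" "snd w \<oplus> \<ominus> (r \<cdot> x)", OF _ _ _ _ inj'])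
      fix P z assume P: "projective A P" and z: "D z = P" "C z = D (snd w \<oplus> \<ominus> (r \<cdot> x))"
      have tz: "C z = D x" using z pr(3,4) tw by simp
      have "fst u \<cdot> p \<cdot> x \<cdot> z = a \<cdot> (snd w \<oplus> \<ominus> (r \<cdot> x)) \<cdot> z" "\<kappa> \<cdot> p \<cdot> x \<cdot> z = snd f \<cdot> (snd w \<oplus> \<ominus> (r \<cdot> x)) \<cdot> z"
        using cmp_eq[OF up, of "x \<cdot> z"] cmp_eq[OF kp, of "x \<cdot> z"] pr(1-4) tw tf tu t\<kappa> t\<phi> z(1) tz
          cmp_eq[OF fw(2), of z] cmp_eq[of a "snd w" _ z] by (simp_all add: add_ac)
      then show "\<exists>g. D g = P \<and> C g = D (snd u) \<and> k \<cdot> g = (p \<cdot> x) \<cdot> z \<and> snd u \<cdot> g = (snd w \<oplus> \<ominus> (r \<cdot> x)) \<cdot> z"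
        using exl[unfolded exact_left_def, rule_format, OF P, of "p \<cdot> x \<cdot> z" "(snd w \<oplus> \<ominus> (r \<cdot> x)) \<cdot> z"]
          pr(1-4) tw z(1) tz tf tu by simp
    qed (use pr(1-4) tu tw in simp_all)
    have tv: "D v1 = D x" "C v1 = D k" using v1(1,2) pr(3,4) tw tu by simp_all
    show ?thesis
      using tv v1(3,4) pr(1-4) up kp tu tw tf by (intro exI[of _ "(p, v1)"] exI[of _ "\<ominus> r"])
        (simp add: c_simps add_ac cmp_eq[of a "snd u" _ v1] cmp_eq[OF up])
  qed
  have full: "\<exists>\<gamma>. c_cell A x k v v' \<gamma> \<and> wl A u \<gamma> = \<beta>"
    if x: "c_obj A x" and v: "c_mor A x k v" "c_mor A x k v'"
      and \<beta>: "c_cell A x a (c_comp A u v) (c_comp A u v') \<beta>" "wr A \<kappa> v = Add A (wl A f \<beta>) (wr A \<kappa> v')" for x v v' \<beta>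
  proof -
    note tv = v[unfolded mor_iff]
    have t\<beta>: "D \<beta> = C x" "C \<beta> = D a" using \<beta> by (simp_all add: cell_iff)
    have e: "fst u \<cdot> fst v = a \<cdot> \<beta> \<oplus> fst u \<cdot> fst v'" "snd u \<cdot> snd v = \<beta> \<cdot> x \<oplus> snd u \<cdot> snd v'"
        "\<kappa> \<cdot> fst v = snd f \<cdot> \<beta> \<oplus> \<kappa> \<cdot> fst v'"
      using \<beta> by (simp_all add: c_simps)
    obtain \<gamma> where \<gamma>: "D \<gamma> = C x" "C \<gamma> = D k" "k \<cdot> \<gamma> = fst v \<oplus> \<ominus> (fst v')" "snd u \<cdot> \<gamma> = \<beta>"
      using exl[unfolded exact_left_def, rule_format, OF x[unfolded c_obj_def], of "fst v \<oplus> \<ominus> (fst v')" \<beta>]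
        tv t\<beta> tf tu t\<kappa> e by auto
    \<comment> \<open>Degree 1 is compared after \<open>k\<close> and \<open>snd u\<close>, which
      are jointly mono.\<close>
    have "snd v = \<gamma> \<cdot> x \<oplus> snd v'"
      by (rule uniq) (use \<gamma>(1,2) tv tu e cmp_eq[OF \<gamma>(3), of x] cmp_eq[OF \<gamma>(4), of x] in simp_all)
    then show ?thesis using \<gamma> tv v by (intro exI[of _ \<gamma>]) (simp add: c_simps)
  qed
  have faith: "\<gamma> = \<gamma>'"
    if "c_cell A x k v v' \<gamma>" "c_cell A x k v v' \<gamma>'" "wl A u \<gamma> = wl A u \<gamma>'" for x v v' \<gamma> \<gamma>'
  proof (rule uniq)
    have "k \<cdot> \<gamma> \<oplus> fst v' = k \<cdot> \<gamma>' \<oplus> fst v'" using that by (simp add: cell_iff)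
    then show "k \<cdot> \<gamma> = k \<cdot> \<gamma>'" using that by (simp add: c_simps)
  qed (use that in \<open>simp_all add: c_simps\<close>)
  show ?thesis
    unfolding c_is_2kernel_def using k u \<kappa> surj full faith by blast
qed

text \<open>The maps \<open>s\<close> and \<open>t\<close> encode exactness at \<open>b0\<close>.
  Degree 1 components come from \<open>extension\<close>, maps out of \<open>b0\<close> from
  \<open>map_from_target\<close>.\<close>

lemma cokernel_of_exact:
  assumes a: "c_obj A a" and b: "c_obj A b" and u: "c_mor A k a u" and f: "c_mor A a b f"
    and \<kappa>: "c_cell A k b (c_comp A f u) (c_zero A k b) \<kappa>"
    and exl: "exact_left k (snd u) (fst u) \<kappa> a (snd f)" and exr: "exact_right (fst u) \<kappa> a (snd f) b (fst f)"
    and st: "D s = C b" "C s = D b" "D t = C b" "C t = C a" "b \<cdot> s \<oplus> fst f \<cdot> t = I (C b)"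
  shows "c_is_2cokernel A k a u b f \<kappa>"
proof -
  note tf = f[unfolded mor_iff] and tu = u[unfolded mor_iff]
  have t\<kappa>: "D \<kappa> = C k" "C \<kappa> = D b" using \<kappa> by (simp_all add: cell_iff)
  have fu: "b \<cdot> \<kappa> = fst f \<cdot> fst u" "snd f \<cdot> snd u = \<kappa> \<cdot> k" using \<kappa> tf tu by (simp_all add: c_simps)
  have ty: "D (fst u) = D \<kappa>" "C (fst u) = D (fst f)" "C \<kappa> = D b" "D a = D (snd f)" "C a = D (fst f)"
    "C (snd f) = D b" "C b = C (fst f)" "D s = C (fst f)" "C s = D b" "D t = C (fst f)" "C t = D (fst f)"
    "b \<cdot> \<kappa> = fst f \<cdot> fst u" "b \<cdot> snd f = fst f \<cdot> a" "b \<cdot> s \<oplus> fst f \<cdot> t = I (C (fst f))"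
    using tf tu t\<kappa> fu st by simp_all
  note mapt = map_from_target[OF ty exr]
  have surj: "\<exists>v \<beta>. c_mor A b x v \<and> c_cell A a x (c_comp A v f) w \<beta> \<and> wl A v \<kappa> = Add A (wr A \<beta> u) \<phi>"
    if x: "c_obj A x" and w: "c_mor A a x w" and \<phi>: "c_cell A k x (c_comp A w u) (c_zero A k x) \<phi>" for x w \<phi>
  proof -
    note tw = w[unfolded mor_iff]
    have t\<phi>: "D \<phi> = C k" "C \<phi> = D x" using \<phi> by (simp_all add: cell_iff)
    have wu: "fst w \<cdot> fst u = x \<cdot> \<phi>" "snd w \<cdot> snd u = \<phi> \<cdot> k" using \<phi> tu tw by (simp_all add: c_simps)
    obtain v1 \<beta> where v1: "D v1 = D b" "C v1 = C \<phi>" "D \<beta> = D (fst f)" "C \<beta> = C \<phi>"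
      "v1 \<cdot> \<kappa> = \<beta> \<cdot> fst u \<oplus> \<phi>" "v1 \<cdot> snd f = \<beta> \<cdot> a \<oplus> snd w"
    proof (rule extension[OF ty exr])
      fix P p r assume P: "projective A P" and p: "D p = P" "C p = D \<kappa>" "D r = P" "C r = D (snd f)"
        "fst u \<cdot> p \<oplus> a \<cdot> r = \<zero> P (D (fst f))" "\<kappa> \<cdot> p \<oplus> snd f \<cdot> r = \<zero> P (D b)"
      \<comment> \<open>By exactness at \<open>k0 + a1\<close> a relation is the image of an element
        \<open>g\<close> of \<open>k1\<close>, where \<open>\<phi>\<close> and \<open>w\<close>
        cancel because \<open>\<phi>\<close> is a 2-cell from \<open>w u\<close> to zero.\<close>
      have "fst u \<cdot> p = a \<cdot> (\<ominus> r)" "\<kappa> \<cdot> p = snd f \<cdot> (\<ominus> r)"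
        using p diff_zero_iff[of "fst u \<cdot> p" "a \<cdot> (\<ominus> r)"] diff_zero_iff[of "\<kappa> \<cdot> p" "snd f \<cdot> (\<ominus> r)"] ty by simp_all
      then obtain g where g: "D g = P" "C g = D k" "k \<cdot> g = p" "snd u \<cdot> g = \<ominus> r"
        using exl[unfolded exact_left_def, rule_format, OF P, of p "\<ominus> r"] p(1-4) t\<kappa> by auto
      have r: "r = \<ominus> (snd u \<cdot> g)" using g by simp
      show "\<phi> \<cdot> p \<oplus> snd w \<cdot> r = \<zero> P (C \<phi>)"
        unfolding r g(3)[symmetric] using cmp_eq[OF wu(2), of g] g(1,2) tu tw t\<phi> by simp
    qed (use a t\<phi> t\<kappa> tw tf in \<open>simp_all add: c_obj_def\<close>)
    \<comment> \<open>The degree 0 component of \<open>v\<close> must restrict to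
      \<open>x v1\<close> along \<open>b\<close> and to \<open>fst w + x \<beta>\<close> along
      \<open>fst f\<close>; these agree on the image of the middle map, so \<open>mapt\<close>
      applies.\<close>
    have 1: "(x \<cdot> v1) \<cdot> \<kappa> = (fst w \<oplus> x \<cdot> \<beta>) \<cdot> fst u" "(x \<cdot> v1) \<cdot> snd f = (fst w \<oplus> x \<cdot> \<beta>) \<cdot> a"
      using v1 ty tw t\<phi> t\<kappa> wu by (simp_all add: add_ac)
    have 2: "D (x \<cdot> v1) = D b" "D (fst w \<oplus> x \<cdot> \<beta>) = D (fst f)" "C (x \<cdot> v1) = C (fst w \<oplus> x \<cdot> \<beta>)"
      using v1(1-4) t\<phi> tw ty by simp_all
    define v0 where "v0 = (x \<cdot> v1) \<cdot> s \<oplus> (fst w \<oplus> x \<cdot> \<beta>) \<cdot> t"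
    have v0: "D v0 = C b" "C v0 = C x" "v0 \<cdot> b = x \<cdot> v1" "v0 \<cdot> fst f = fst w \<oplus> x \<cdot> \<beta>"
      using mapt[OF 2 1] v1(1-4) t\<phi> tw ty unfolding v0_def by simp_all
    show ?thesis
      using v0 v1 t\<phi> tw tf w by (intro exI[of _ "(v0, v1)"] exI[of _ \<beta>])
        (simp add: c_simps add_ac cmp_eq[OF v0(3)] cmp_eq[OF v0(4)])
  qed
  have full: "\<exists>\<gamma>. c_cell A b x v v' \<gamma> \<and> wr A \<gamma> f = \<beta>"
    if x: "c_obj A x" and v: "c_mor A b x v" "c_mor A b x v'"
      and \<beta>: "c_cell A a x (c_comp A v f) (c_comp A v' f) \<beta>" "wl A v \<kappa> = Add A (wr A \<beta> u) (wl A v' \<kappa>)" for x v v' \<beta>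
  proof -
    note tv = v[unfolded mor_iff]
    have t\<beta>: "D \<beta> = C a" "C \<beta> = D x" using \<beta> by (simp_all add: cell_iff)
    have e: "fst v \<cdot> fst f = x \<cdot> \<beta> \<oplus> fst v' \<cdot> fst f" "snd v \<cdot> snd f = \<beta> \<cdot> a \<oplus> snd v' \<cdot> snd f"
        "snd v \<cdot> \<kappa> = \<beta> \<cdot> fst u \<oplus> snd v' \<cdot> \<kappa>"
      using \<beta> by (simp_all add: c_simps)
    \<comment> \<open>The 2-cell \<open>\<gamma>\<close> must restrict to \<open>d\<close> along
      \<open>b\<close> and to \<open>\<beta>\<close> along \<open>fst f\<close>.\<close>
    define d where "d = snd v \<oplus> \<ominus> (snd v')"
    have d: "D d = D b" "D \<beta> = D (fst f)" "C d = C \<beta>" "d \<cdot> \<kappa> = \<beta> \<cdot> fst u" "d \<cdot> snd f = \<beta> \<cdot> a"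
      using tv t\<beta> ty(1-11) e by (simp_all add: d_def)
    define \<gamma> where "\<gamma> = d \<cdot> s \<oplus> \<beta> \<cdot> t"
    have \<gamma>: "D \<gamma> = C b" "C \<gamma> = D x" "\<gamma> \<cdot> b = d" "\<gamma> \<cdot> fst f = \<beta>"
      using mapt[OF d] d(1-3) t\<beta> ty unfolding \<gamma>_def by simp_all
    have x\<beta>: "x \<cdot> \<beta> = (fst v \<oplus> \<ominus> (fst v')) \<cdot> fst f" and xd: "x \<cdot> d = (fst v \<oplus> \<ominus> (fst v')) \<cdot> b"
      using e tv t\<beta> tf by (simp_all add: d_def)
    have "x \<cdot> \<gamma> = (x \<cdot> d) \<cdot> s \<oplus> (x \<cdot> \<beta>) \<cdot> t" using d(1-3) t\<beta> ty by (simp add: \<gamma>_def)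
    also have "\<dots> = (fst v \<oplus> \<ominus> (fst v')) \<cdot> (b \<cdot> s \<oplus> fst f \<cdot> t)" unfolding x\<beta> xd using tv ty(1-11) by (simp add: add_ac)
    also have "\<dots> = fst v \<oplus> \<ominus> (fst v')" unfolding st using tv by simp
    finally show ?thesis using \<gamma> tv v by (intro exI[of _ \<gamma>]) (simp add: c_simps d_def)
  qed
  have faith: "\<gamma> = \<gamma>'"
    if "c_cell A b x v v' \<gamma>" "c_cell A b x v v' \<gamma>'" "wr A \<gamma> f = wr A \<gamma>' f" for x v v' \<gamma> \<gamma>'
  proof -
    have "\<gamma> \<cdot> b \<oplus> snd v' = \<gamma>' \<cdot> b \<oplus> snd v'" using that by (simp add: cell_iff)
    then have gb: "\<gamma> \<cdot> b = \<gamma>' \<cdot> b" using that by (simp add: c_simps)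
    have gf: "\<gamma> \<cdot> fst f = \<gamma>' \<cdot> fst f" using that by (simp add: wr_def)
    have "\<gamma> \<cdot> (b \<cdot> s \<oplus> fst f \<cdot> t) = \<gamma>' \<cdot> (b \<cdot> s \<oplus> fst f \<cdot> t)"
      using that tf st(1-4) cmp_eq[OF gb, of s] cmp_eq[OF gf, of t] by (simp add: c_simps)
    then show ?thesis unfolding st using that by (simp add: c_simps)
  qed
  show ?thesis
    unfolding c_is_2cokernel_def using b f \<kappa> surj full faith by blast
qed

end

section \<open>Kernels, cokernels, pips, copips, roots and coroots\<close>

context abelian_projective
begin

section \<open>2-kernels and 2-cokernels\<close>

text \<open>Among all arrows the homotopy kernel is \<open>m\<close>, the map from
  \<open>D a\<close> into the pullback of \<open>fst f\<close> and \<open>b\<close>. Pulling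
  \<open>m\<close> back along the projective cover \<open>e\<close> gives \<open>k\<close>; the
  2-cell is the projection \<open>q\<close> of the pullback to \<open>D b\<close>, composed with
  \<open>e\<close>.\<close>

lemma ex_2kernel:
  assumes f: "c_mor A a b f"
  shows "\<exists>k u \<kappa>. c_is_2kernel A a b f k u \<kappa>"
proof -
  note tf = f[unfolded mor_iff]
  have "C (fst f) = C b" using tf by simp
  then obtain p q where pq: "D p = D q" "C p = D (fst f)" "C q = D b" "fst f \<cdot> p = b \<cdot> q"
    and pb: "\<forall>x y. D x = D y \<longrightarrow> C x = D (fst f) \<longrightarrow> C y = D b \<longrightarrow> fst f \<cdot> x = b \<cdot> y
      \<longrightarrow> (\<exists>h. D h = D y \<and> C h = D q \<and> p \<cdot> h = x \<and> q \<cdot> h = y)"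
    and pb1: "\<forall>h h'. C h = D q \<longrightarrow> C h' = D q \<longrightarrow> D h = D h' \<longrightarrow> p \<cdot> h = p \<cdot> h' \<longrightarrow> q \<cdot> h = q \<cdot> h' \<longrightarrow> h = h'"
    by (rule pullback)
  obtain m where m: "D m = D a" "C m = D q" "p \<cdot> m = a" "q \<cdot> m = snd f"
    using pb[rule_format, of a "snd f"] tf by auto
  obtain P e where e: "projective A P" "epi A e" "D e = P" "C e = D q" by (rule projective_cover)
  have "C e = C m" using e m by simp
  then obtain k u1 where k: "D k = D u1" "C k = D e" "C u1 = D m" "e \<cdot> k = m \<cdot> u1"
    and kb: "\<forall>x y. D x = D y \<longrightarrow> C x = D e \<longrightarrow> C y = D m \<longrightarrow> e \<cdot> x = m \<cdot> y
      \<longrightarrow> (\<exists>h. D h = D y \<and> C h = D u1 \<and> k \<cdot> h = x \<and> u1 \<cdot> h = y)"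
    and kb1: "\<forall>h h'. C h = D u1 \<longrightarrow> C h' = D u1 \<longrightarrow> D h = D h' \<longrightarrow> k \<cdot> h = k \<cdot> h' \<longrightarrow> u1 \<cdot> h = u1 \<cdot> h' \<longrightarrow> h = h'"
    by (rule pullback)
  let ?u = "(p \<cdot> e, u1)"
  have ck: "c_obj A k" using k e by (simp add: c_obj_def)
  have u: "c_mor A k a ?u"
    using k e pq m tf cmp_eq[OF m(3), of u1] by (simp add: mor_iff)
  have \<kappa>: "c_cell A k b (c_comp A f ?u) (c_zero A k b) (q \<cdot> e)"
    using k e pq m(1,2) tf cmp_eq[OF m(4), of u1] cmp_eq[OF m(3), of u1] cmp_eq[OF pq(4), of e] cmp_eq[OF pq(4), of "m \<cdot> u1"]
    by (simp add: c_simps)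
  have exl: "exact_left k (snd ?u) (fst ?u) (q \<cdot> e) a (snd f)"
    unfolding exact_left_def
  proof (intro allI impI)
    fix Q y r assume y: "D y = Q" "C y = C k" "D r = Q" "C r = D (snd f)"
      "fst ?u \<cdot> y = a \<cdot> r" "(q \<cdot> e) \<cdot> y = snd f \<cdot> r"
    have "e \<cdot> y = m \<cdot> r"
      by (rule pb1[rule_format])
        (use y k e pq m(1,2) tf cmp_eq[OF m(3), of r] cmp_eq[OF m(4), of r] in simp_all)
    then show "\<exists>g. D g = Q \<and> C g = D k \<and> k \<cdot> g = y \<and> snd ?u \<cdot> g = r"
      using kb[rule_format, of y r] y k m tf by auto
  qed
  have exr: "exact_right (fst ?u) (q \<cdot> e) a (snd f) b (fst f)"
    unfolding exact_right_def
  proof (intro allI impI)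
    fix Q z y assume Q: "projective A Q" and y: "D z = Q" "C z = D (fst f)" "D y = Q" "C y = D b"
      "fst f \<cdot> z = b \<cdot> y"
    obtain h where h: "D h = Q" "C h = D q" "p \<cdot> h = z" "q \<cdot> h = y" using pb[rule_format, of z y] y by auto
    obtain g where g: "D g = Q" "C g = D e" "e \<cdot> g = h" using projective_lift[OF Q e(2)] h e by metis
    show "\<exists>s r. D s = Q \<and> C s = D (q \<cdot> e) \<and> D r = Q \<and> C r = D (snd f) \<and>
        fst ?u \<cdot> s \<oplus> a \<cdot> r = z \<and> (q \<cdot> e) \<cdot> s \<oplus> snd f \<cdot> r = y"
      using h g y pq e tf by (intro exI[of _ g] exI[of _ "\<zero> Q (D a)"]) simp
  qed
  have "c_is_2kernel A a b f k ?u (q \<cdot> e)"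
  proof (rule kernel_of_exact[OF ck u f \<kappa> exl exr])
    fix P g assume g: "D g = P" "C g = D k" "k \<cdot> g = \<zero> P (C k)" "snd ?u \<cdot> g = \<zero> P (C (snd ?u))"
    show "g = \<zero> P (D k)" by (rule kb1[rule_format]) (use g k in simp_all)
  qed
  then show ?thesis by blast
qed

text \<open>The pushout replaces degree 1 and degree 0 stays \<open>C b\<close>, so the result is
  again an object of the 2-category. As \<open>fst q\<close> is an identity, the last map of the
  total complex is split by \<open>s = 0\<close> and \<open>t = 1\<close>.\<close>

lemma ex_2cokernel:
  assumes b: "c_obj A b" and f: "c_mor A a b f"
  shows "\<exists>c q \<zeta>. c_is_2cokernel A a b f c q \<zeta>"
proof -
  note tf = f[unfolded mor_iff]
  have "D (snd f) = D a" using tf by simp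
  then obtain i j where ij: "D i = C (snd f)" "D j = C a" "C i = C j" "i \<cdot> snd f = j \<cdot> a"
    and un: "\<forall>x y. C x = C y \<longrightarrow> D x = C (snd f) \<longrightarrow> D y = C a \<longrightarrow> x \<cdot> snd f = y \<cdot> a
      \<longrightarrow> (\<exists>h. D h = C j \<and> C h = C y \<and> h \<cdot> i = x \<and> h \<cdot> j = y)"
    and ex: "\<forall>P y z. projective A P \<longrightarrow> D y = P \<longrightarrow> C y = C (snd f) \<longrightarrow> D z = P \<longrightarrow> C z = C a \<longrightarrow> i \<cdot> y = j \<cdot> z
      \<longrightarrow> (\<exists>g. D g = P \<and> C g = D (snd f) \<and> snd f \<cdot> g = y \<and> a \<cdot> g = z)"
    and gen: "\<forall>P w. projective A P \<longrightarrow> D w = P \<longrightarrow> C w = C j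
      \<longrightarrow> (\<exists>y z. D y = P \<and> C y = C (snd f) \<and> D z = P \<and> C z = C a \<and> i \<cdot> y \<oplus> j \<cdot> z = w)"
    by (rule pushout)
  obtain c where c: "D c = C j" "C c = C b" "c \<cdot> i = b" "c \<cdot> j = fst f"
    using un[rule_format, of b "fst f"] tf by auto
  let ?q = "(I (C b), i)"
  have cc: "c_obj A c" using b c by (simp add: c_obj_def)
  have q: "c_mor A b c ?q" using c ij tf by (simp add: mor_iff)
  have \<zeta>: "c_cell A a c (c_comp A ?q f) (c_zero A a c) j"
    using c ij tf cmp_eq[OF c(4), of a] by (simp add: c_simps)
  have exl: "exact_left a (snd f) (fst f) j b (snd ?q)"
    unfolding exact_left_def
  proof (intro allI impI)
    fix P p r assume P: "projective A P" and y: "D p = P" "C p = C a" "D r = P" "C r = D (snd ?q)" "j \<cdot> p = snd ?q \<cdot> r"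
    show "\<exists>g. D g = P \<and> C g = D a \<and> a \<cdot> g = p \<and> snd f \<cdot> g = r"
      using ex[rule_format, OF P, of r p] y ij tf by auto
  qed
  have exr: "exact_right (fst f) j b (snd ?q) c (fst ?q)"
    unfolding exact_right_def
  proof (intro allI impI)
    fix P z w assume P: "projective A P" and y: "D z = P" "C z = D (fst ?q)" "D w = P" "C w = D c" "fst ?q \<cdot> z = c \<cdot> w"
    obtain r p where pr: "D r = P" "C r = C (snd f)" "D p = P" "C p = C a" "i \<cdot> r \<oplus> j \<cdot> p = w"
      using gen[rule_format, OF P, of w] y c by auto
    have z: "z = c \<cdot> w" using y by simp
    show "\<exists>p r. D p = P \<and> C p = D j \<and> D r = P \<and> C r = D (snd ?q) \<and>
        fst f \<cdot> p \<oplus> b \<cdot> r = z \<and> j \<cdot> p \<oplus> snd ?q \<cdot> r = w"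
      unfolding z pr(5)[symmetric] using pr(1-4) ij c(1,2) tf cmp_eq[OF c(3), of r] cmp_eq[OF c(4), of p]
      by (intro exI[of _ p] exI[of _ r]) (simp add: add_ac)
  qed
  have "c_is_2cokernel A a b f c ?q j"
    by (rule cokernel_of_exact[OF b cc f q \<zeta> exl exr, of "\<zero> (C b) (D c)" "I (C b)"]) (use c in simp_all)
  then show ?thesis by blast
qed

section \<open>Pips and copips\<close>

text \<open>A 2-cell \<open>\<rho>\<close> between zero 1-cells that \<open>f\<close> kills is a map
  from \<open>C x\<close> to the joint kernel \<open>D i\<close> that vanishes on \<open>x\<close>.
  It is represented by the discrete object with cokernel \<open>D i\<close>, namely the kernel
  \<open>n\<close> of a projective cover \<open>e\<close> of \<open>D i\<close>.\<close>

lemma ex_pip: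
  assumes f: "c_mor A a b f"
  obtains i e n where "is_kernel A e n" "epi A e" "C e = D i" "mono A i" "C i = D a"
    "c_is_pip A a b f n (i \<cdot> e)"
    "\<forall>y. C y = D a \<longrightarrow> a \<cdot> y = \<zero> (D y) (C a) \<longrightarrow> snd f \<cdot> y = \<zero> (D y) (C (snd f))
      \<longrightarrow> (\<exists>h. D h = D y \<and> C h = D i \<and> i \<cdot> h = y)"
proof -
  note tf = f[unfolded mor_iff]
  have "D (snd f) = D a" using tf by simp
  then obtain i where i: "C i = D a" "mono A i" "a \<cdot> i = \<zero> (D i) (C a)" "snd f \<cdot> i = \<zero> (D i) (C (snd f))"
    and un: "\<forall>y. C y = D a \<longrightarrow> a \<cdot> y = \<zero> (D y) (C a) \<longrightarrow> snd f \<cdot> y = \<zero> (D y) (C (snd f))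
      \<longrightarrow> (\<exists>h. D h = D y \<and> C h = D i \<and> i \<cdot> h = y)"
    by (rule joint_kernel)
  obtain P e where e: "projective A P" "epi A e" "D e = P" "C e = D i" by (rule projective_cover)
  obtain n where n': "is_kernel A e n" using ex_kernel by blast
  note n = kernelD[OF n']
  have "c_is_pip A a b f n (i \<cdot> e)"
    unfolding c_is_pip_def
  proof (intro conjI allI impI; (elim conjE)?)
    show "c_obj A n" using n e by (simp add: c_obj_def)
    show "c_cell A n a (c_zero A n a) (c_zero A n a) (i \<cdot> e)"
      using n(1,2) e(3,4) i cmp_eq[OF i(3), of e] by (simp add: c_simps)
    show "wl A f (i \<cdot> e) = c_idcell A n b"
      using n(1) e(3,4) i tf cmp_eq[OF i(4), of e] by (simp add: c_simps)
  next
    fix x \<rho> assume x: "c_obj A x" and \<rho>: "c_cell A x a (c_zero A x a) (c_zero A x a) \<rho>" "wl A f \<rho> = c_idcell A x b"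
    have t: "D \<rho> = C x" "C \<rho> = D a" using \<rho> by (simp_all add: cell_iff)
    have z: "\<rho> \<cdot> x = \<zero> (D x) (D a)" "a \<cdot> \<rho> = \<zero> (C x) (C a)" "snd f \<cdot> \<rho> = \<zero> (C x) (C (snd f))"
      using \<rho> t tf by (simp_all add: c_simps)
    obtain r where r: "D r = C x" "C r = D i" "i \<cdot> r = \<rho>" using un[rule_format, of \<rho>] t z by auto
    obtain v0 where v0: "D v0 = C x" "C v0 = D e" "e \<cdot> v0 = r"
      using projective_lift[OF x[unfolded c_obj_def] e(2)] r e by metis
    have "i \<cdot> r \<cdot> x = i \<cdot> \<zero> (D x) (D i)" using cmp_eq[OF r(3), of x] r i z by simp
    then have "r \<cdot> x = \<zero> (D x) (D i)" by (rule monoD[OF i(2)]) (use r in simp_all)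
    then have "e \<cdot> v0 \<cdot> x = \<zero> (D x) (D i)" using cmp_eq[OF v0(3), of x] v0 by simp
    then obtain v1 where v1: "D v1 = D x" "C v1 = D n" "n \<cdot> v1 = v0 \<cdot> x"
      using n(4)[of "v0 \<cdot> x"] v0(1,2) e by auto
    show "\<exists>v. c_mor A x n v \<and> wr A (i \<cdot> e) v = \<rho>"
      using v0 v1 r e n(1) by (intro exI[of _ "(v0, v1)"]) (simp add: c_simps)
  next
    fix x v v' assume x: "c_obj A x" and v: "c_mor A x n v" "c_mor A x n v'" "wr A (i \<cdot> e) v = wr A (i \<cdot> e) v'"
    note tv = v(1,2)[unfolded mor_iff]
    have "i \<cdot> e \<cdot> fst v = i \<cdot> e \<cdot> fst v'" using v(3) tv n(1) e by (simp add: wr_def)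
    then have "e \<cdot> fst v = e \<cdot> fst v'" by (rule monoD[OF i(2)]) (use tv n(1) e in simp_all)
    then have "e \<cdot> (fst v \<oplus> \<ominus> (fst v')) = \<zero> (C x) (C e)" using tv n(1) e by simp
    then obtain \<gamma> where \<gamma>: "D \<gamma> = C x" "C \<gamma> = D n" "n \<cdot> \<gamma> = fst v \<oplus> \<ominus> (fst v')"
      using n(4)[of "fst v \<oplus> \<ominus> (fst v')"] tv n(1) e by auto
    have "n \<cdot> snd v = n \<cdot> (\<gamma> \<cdot> x \<oplus> snd v')" using \<gamma> tv cmp_eq[OF \<gamma>(3), of x] by simp
    then have "snd v = \<gamma> \<cdot> x \<oplus> snd v'" by (rule monoD[OF n(3)]) (use tv \<gamma> in simp_all)
    then show "\<exists>\<gamma>. c_cell A x n v v' \<gamma>" using v(1,2) tv \<gamma> by (intro exI[of _ \<gamma>]) (simp add: c_simps)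
  next
    fix x v v' \<gamma> \<gamma>' assume c: "c_cell A x n v v' \<gamma>" "c_cell A x n v v' \<gamma>'"
    have "n \<cdot> \<gamma> \<oplus> fst v' = n \<cdot> \<gamma>' \<oplus> fst v'" using c by (simp add: cell_iff)
    then have "n \<cdot> \<gamma> = n \<cdot> \<gamma>'" using c by (simp add: c_simps)
    then show "\<gamma> = \<gamma>'" by (rule monoD[OF n(3)]) (use c in \<open>simp_all add: c_simps\<close>)
  qed
  then show thesis using that n' e(2,4) i(1,2) un by blast
qed

text \<open>Dually, such 2-cells are maps out of the joint cokernel \<open>C q\<close> that are
  killed by \<open>x\<close>; they are represented by the codiscrete object
  \<open>C q -> Z\<close>.\<close>

lemma ex_copip:
  assumes f: "c_mor A a b f"
  obtains q where "D q = C b" "c_is_copip A a b f (\<zero> (C q) Z) q"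
    "\<forall>P y. projective A P \<longrightarrow> D y = P \<longrightarrow> C y = C b \<longrightarrow> q \<cdot> y = \<zero> P (C q)
      \<longrightarrow> (\<exists>s t. D s = P \<and> C s = D b \<and> D t = P \<and> C t = C a \<and> y = b \<cdot> s \<oplus> fst f \<cdot> t)"
proof -
  note tf = f[unfolded mor_iff]
  have "C (fst f) = C b" using tf by simp
  then obtain q where q: "D q = C b" "epi A q" "q \<cdot> b = \<zero> (D b) (C q)" "q \<cdot> fst f = \<zero> (D (fst f)) (C q)"
    and un: "\<forall>y. D y = C b \<longrightarrow> y \<cdot> b = \<zero> (D b) (C y) \<longrightarrow> y \<cdot> fst f = \<zero> (D (fst f)) (C y)
      \<longrightarrow> (\<exists>h. D h = C q \<and> C h = C y \<and> h \<cdot> q = y)"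
    and ex: "\<forall>P y. projective A P \<longrightarrow> D y = P \<longrightarrow> C y = C b \<longrightarrow> q \<cdot> y = \<zero> P (C q)
      \<longrightarrow> (\<exists>s t. D s = P \<and> C s = D b \<and> D t = P \<and> C t = D (fst f) \<and> y = b \<cdot> s \<oplus> fst f \<cdot> t)"
    by (rule joint_cokernel)
  let ?p = "\<zero> (C q) Z"
  have "c_is_copip A a b f ?p q"
    unfolding c_is_copip_def
  proof (intro conjI allI impI; (elim conjE)?)
    show "c_obj A ?p" using projective_Z by (simp add: c_obj_def)
    show "c_cell A b ?p (c_zero A b ?p) (c_zero A b ?p) q" using q by (simp add: c_simps)
    show "wr A q f = c_idcell A a ?p" using q tf by (simp add: c_simps)
  next
    fix x \<rho> assume \<rho>: "c_cell A b x (c_zero A b x) (c_zero A b x) \<rho>" "wr A \<rho> f = c_idcell A a x"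
    have t: "D \<rho> = C b" "C \<rho> = D x" using \<rho> by (simp_all add: cell_iff)
    have z: "\<rho> \<cdot> b = \<zero> (D b) (D x)" "x \<cdot> \<rho> = \<zero> (C b) (C x)" "\<rho> \<cdot> fst f = \<zero> (D (fst f)) (D x)"
      using \<rho> t tf by (simp_all add: c_simps)
    obtain r where r: "D r = C q" "C r = D x" "r \<cdot> q = \<rho>" using un[rule_format, of \<rho>] t z by auto
    have "(x \<cdot> r) \<cdot> q = \<zero> (C q) (C x) \<cdot> q" using r q z by simp
    then have "x \<cdot> r = \<zero> (C q) (C x)" by (rule epiD[OF q(2)]) (use r in simp_all)
    then show "\<exists>v. c_mor A ?p x v \<and> wl A v q = \<rho>"
      using r by (intro exI[of _ "(\<zero> Z (C x), r)"]) (simp add: c_simps)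
  next
    fix x v v' assume v: "c_mor A ?p x v" "c_mor A ?p x v'" "wl A v q = wl A v' q"
    note tv = v(1,2)[unfolded mor_iff]
    have "snd v = snd v'" by (rule epiD[OF q(2)]) (use v(3) tv in \<open>simp_all add: wl_def\<close>)
    moreover have "fst v = fst v'" by (rule from_Z) (use tv in simp_all)
    ultimately show "\<exists>\<gamma>. c_cell A ?p x v v' \<gamma>"
      using v(1,2) tv by (intro exI[of _ "\<zero> Z (D x)"]) (simp add: c_simps)
  next
    fix x v v' \<gamma> \<gamma>' assume c: "c_cell A ?p x v v' \<gamma>" "c_cell A ?p x v v' \<gamma>'"
    show "\<gamma> = \<gamma>'" by (rule from_Z) (use c in \<open>simp_all add: cell_iff\<close>)
  qed
  then show thesis using that q(1) ex tf by simp
qed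

section \<open>Roots and coroots\<close>

text \<open>Since \<open>\<alpha> a = 0\<close>, the arrow \<open>a\<close> corestricts to the
  kernel of \<open>\<alpha>\<close>; the corestriction is the root among all arrows, and
  \<open>R\<close> is its pullback along a projective cover of its codomain.\<close>

lemma ex_root:
  assumes \<alpha>: "c_cell A a b (c_zero A a b) (c_zero A a b) \<alpha>"
  shows "\<exists>R r. c_is_root A a b \<alpha> R r"
proof -
  have t\<alpha>: "D \<alpha> = C a" "C \<alpha> = D b" using \<alpha> by (simp_all add: cell_iff)
  have z: "\<alpha> \<cdot> a = \<zero> (D a) (D b)" using \<alpha> t\<alpha> by (simp add: c_simps)
  obtain m where "is_kernel A \<alpha> m" using ex_kernel by blast
  note m = kernelD[OF this]
  obtain a' where a': "D a' = D a" "C a' = D m" "m \<cdot> a' = a" using m(4)[of a] t\<alpha> z by auto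
  obtain P e where e: "projective A P" "epi A e" "D e = P" "C e = D m" by (rule projective_cover)
  have "C e = C a'" using e a' by simp
  then obtain R r where R: "D R = D r" "C R = D e" "C r = D a'" "e \<cdot> R = a' \<cdot> r"
    and pb: "\<forall>x y. D x = D y \<longrightarrow> C x = D e \<longrightarrow> C y = D a' \<longrightarrow> e \<cdot> x = a' \<cdot> y
      \<longrightarrow> (\<exists>h. D h = D y \<and> C h = D r \<and> R \<cdot> h = x \<and> r \<cdot> h = y)"
    and pb1: "\<forall>h h'. C h = D r \<longrightarrow> C h' = D r \<longrightarrow> D h = D h' \<longrightarrow> R \<cdot> h = R \<cdot> h' \<longrightarrow> r \<cdot> h = r \<cdot> h' \<longrightarrow> h = h'"
    by (rule pullback)
  let ?r = "(m \<cdot> e, r)"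
  have "c_is_root A a b \<alpha> R ?r"
    unfolding c_is_root_def
  proof (intro conjI allI impI; (elim conjE)?)
    show "c_obj A R" using R e by (simp add: c_obj_def)
    show "c_mor A R a ?r" using R e m(1) t\<alpha> a' cmp_eq[OF a'(3), of r] by (simp add: c_simps)
    show "wr A \<alpha> ?r = c_idcell A R b" using R e m(1,2) t\<alpha> cmp_eq[OF m(2), of e] by (simp add: c_simps)
  next
    fix x w assume x: "c_obj A x" and w: "c_mor A x a w" "wr A \<alpha> w = c_idcell A x b"
    note tw = w(1)[unfolded mor_iff]
    obtain w' where w': "D w' = C x" "C w' = D m" "m \<cdot> w' = fst w"
      using m(4)[of "fst w"] w(2) tw t\<alpha> by (auto simp: c_simps)
    obtain v0 where v0: "D v0 = C x" "C v0 = D e" "e \<cdot> v0 = w'"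
      using projective_lift[OF x[unfolded c_obj_def] e(2)] w' e by metis
    have "m \<cdot> e \<cdot> v0 \<cdot> x = m \<cdot> a' \<cdot> snd w"
      using cmp_eq[OF v0(3), of x] cmp_eq[OF w'(3), of x] cmp_eq[OF a'(3), of "snd w"] v0(1,2) w'(1,2) a'(1,2) e tw by simp
    then have "e \<cdot> v0 \<cdot> x = a' \<cdot> snd w" by (rule monoD[OF m(3)]) (use v0(1,2) e tw a'(1,2) in simp_all)
    then obtain v1 where v1: "D v1 = D x" "C v1 = D r" "R \<cdot> v1 = v0 \<cdot> x" "r \<cdot> v1 = snd w"
      using pb[rule_format, of "v0 \<cdot> x" "snd w"] v0(1,2) tw a'(1,2) by auto
    show "\<exists>v \<beta>. c_mor A x R v \<and> c_cell A x a (c_comp A ?r v) w \<beta>"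
      using v1 v0 w' tw R e m(1) by (intro exI[of _ "(v0, v1)"] exI[of _ "\<zero> (C x) (D a)"]) (simp add: c_simps)
  next
    fix x v v' \<beta> assume v: "c_mor A x R v" "c_mor A x R v'" and \<beta>: "c_cell A x a (c_comp A ?r v) (c_comp A ?r v') \<beta>"
    note tv = v(1,2)[unfolded mor_iff]
    have t\<beta>: "D \<beta> = C x" "C \<beta> = D a" using \<beta> by (simp_all add: cell_iff)
    have e1: "r \<cdot> snd v = \<beta> \<cdot> x \<oplus> r \<cdot> snd v'" and e0: "m \<cdot> e \<cdot> fst v = a \<cdot> \<beta> \<oplus> m \<cdot> e \<cdot> fst v'"
      using \<beta> tv R e by (simp_all add: c_simps)
    have "m \<cdot> e \<cdot> (fst v \<oplus> \<ominus> (fst v')) = m \<cdot> a' \<cdot> \<beta>"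
      using e0 tv R e a'(1,2) t\<beta> t\<alpha> m(1) cmp_eq[OF a'(3), of \<beta>] by simp
    then have "e \<cdot> (fst v \<oplus> \<ominus> (fst v')) = a' \<cdot> \<beta>"
      by (rule monoD[OF m(3)]) (use tv R e a'(1,2) t\<beta> in simp_all)
    then obtain \<gamma> where \<gamma>: "D \<gamma> = C x" "C \<gamma> = D r" "R \<cdot> \<gamma> = fst v \<oplus> \<ominus> (fst v')" "r \<cdot> \<gamma> = \<beta>"
      using pb[rule_format, of "fst v \<oplus> \<ominus> (fst v')" \<beta>] tv R a' t\<beta> by auto
    have "snd v = \<gamma> \<cdot> x \<oplus> snd v'"
      by (rule pb1[rule_format])
        (use tv \<gamma>(1,2) R e1 a' t\<beta> cmp_eq[OF \<gamma>(3), of x] cmp_eq[OF \<gamma>(4), of x] in simp_all)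
    then show "\<exists>\<gamma>. c_cell A x R v v' \<gamma> \<and> wl A ?r \<gamma> = \<beta>"
      using \<gamma> tv R v by (intro exI[of _ \<gamma>]) (simp add: c_simps)
  next
    fix x v v' \<gamma> \<gamma>' assume c: "c_cell A x R v v' \<gamma>" "c_cell A x R v v' \<gamma>'" "wl A ?r \<gamma> = wl A ?r \<gamma>'"
    have "R \<cdot> \<gamma> \<oplus> fst v' = R \<cdot> \<gamma>' \<oplus> fst v'" using c by (simp add: cell_iff)
    then have "R \<cdot> \<gamma> = R \<cdot> \<gamma>'" using c by (simp add: c_simps)
    with c R show "\<gamma> = \<gamma>'" using pb1[rule_format, of \<gamma> \<gamma>'] by (simp add: c_simps)
  qed
  then show ?thesis by blast
qed

text \<open>Since \<open>b \<alpha> = 0\<close>, the arrow \<open>b\<close> factors through the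
  cokernel of \<open>\<alpha>\<close>. The codomain is unchanged and hence projective.\<close>

lemma ex_coroot:
  assumes b: "c_obj A b" and \<alpha>: "c_cell A a b (c_zero A a b) (c_zero A a b) \<alpha>"
  shows "\<exists>Q q. c_is_coroot A a b \<alpha> Q q"
proof -
  have t\<alpha>: "D \<alpha> = C a" "C \<alpha> = D b" using \<alpha> by (simp_all add: cell_iff)
  have z: "b \<cdot> \<alpha> = \<zero> (C a) (C b)" using \<alpha> t\<alpha> by (simp add: c_simps)
  obtain q where "is_cokernel A \<alpha> q" using ex_cokernel by blast
  note q = cokernelD[OF this]
  obtain Q where Q: "D Q = C q" "C Q = C b" "Q \<cdot> q = b" using q(4)[of b] t\<alpha> z by auto
  let ?q = "(I (C b), q)"
  have "c_is_coroot A a b \<alpha> Q ?q"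
    unfolding c_is_coroot_def
  proof (intro conjI allI impI; (elim conjE)?)
    show "c_obj A Q" using Q b by (simp add: c_obj_def)
    show "c_mor A b Q ?q" using Q q(1) t\<alpha> by (simp add: c_simps)
    show "wl A ?q \<alpha> = c_idcell A a Q" using Q q(1,2) t\<alpha> by (simp add: c_simps)
  next
    fix x w assume w: "c_mor A b x w" "wl A w \<alpha> = c_idcell A a x"
    note tw = w(1)[unfolded mor_iff]
    obtain w1 where w1: "D w1 = C q" "C w1 = D x" "w1 \<cdot> q = snd w"
      using q(4)[of "snd w"] w(2) tw t\<alpha> by (auto simp: c_simps)
    have "(x \<cdot> w1) \<cdot> q = (fst w \<cdot> Q) \<cdot> q" using w1 Q tw q(1) t\<alpha> by simp
    then have "x \<cdot> w1 = fst w \<cdot> Q" by (rule epiD[OF q(3)]) (use w1 Q tw in simp_all)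
    then show "\<exists>v \<beta>. c_mor A Q x v \<and> c_cell A b x (c_comp A v ?q) w \<beta>"
      using w1 tw Q q(1) t\<alpha> by (intro exI[of _ "(fst w, w1)"] exI[of _ "\<zero> (C b) (D x)"]) (simp add: c_simps)
  next
    fix x v v' \<beta> assume v: "c_mor A Q x v" "c_mor A Q x v'" and \<beta>: "c_cell A b x (c_comp A v ?q) (c_comp A v' ?q) \<beta>"
    note tv = v(1,2)[unfolded mor_iff]
    have t\<beta>: "D \<beta> = C b" "C \<beta> = D x" using \<beta> by (simp_all add: cell_iff)
    have e1: "snd v \<cdot> q = \<beta> \<cdot> b \<oplus> snd v' \<cdot> q" and e0: "fst v = x \<cdot> \<beta> \<oplus> fst v'"
      using \<beta> tv Q by (simp_all add: c_simps)
    have "snd v \<cdot> q = (\<beta> \<cdot> Q \<oplus> snd v') \<cdot> q" using e1 tv t\<beta> Q q(1) t\<alpha> by simp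
    then have "snd v = \<beta> \<cdot> Q \<oplus> snd v'" by (rule epiD[OF q(3)]) (use tv t\<beta> Q in simp_all)
    then show "\<exists>\<gamma>. c_cell A Q x v v' \<gamma> \<and> wr A \<gamma> ?q = \<beta>"
      using e0 tv t\<beta> Q v by (intro exI[of _ \<beta>]) (simp add: c_simps)
  next
    fix x v v' \<gamma> \<gamma>' assume "c_cell A Q x v v' \<gamma>" "c_cell A Q x v v' \<gamma>'" "wr A \<gamma> ?q = wr A \<gamma>' ?q"
    then show "\<gamma> = \<gamma>'" using Q by (simp add: c_simps)
  qed
  then show ?thesis by blast
qed

end

section \<open>Exactness and additivity\<close>

context abelian_projective
begin

section \<open>The four conditions of 2-Puppe-exactness\<close>

lemma faithful_is_kernel:
  assumes f: "c_faithful A a b f" and q: "c_is_2cokernel A a b f c q \<zeta>"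
  shows "c_is_2kernel A b c q a f \<zeta>"
proof -
  have a: "c_obj A a" "c_mor A a b f" using f unfolding c_faithful_def by auto
  have c: "c_mor A b c q" "c_cell A a c (c_comp A q f) (c_zero A a c) \<zeta>"
    using q unfolding c_is_2cokernel_def by auto
  show ?thesis
    by (rule kernel_of_exact[OF a c exact_of_cokernel[OF a(2) q]]) (rule faithfulD[OF f])
qed

lemma cofaithful_is_cokernel:
  assumes f: "c_cofaithful A a b f" and k: "c_is_2kernel A a b f k u \<kappa>"
  shows "c_is_2cokernel A k a u b f \<kappa>"
proof -
  have a: "c_obj A a" "c_obj A b" "c_mor A a b f" using f unfolding c_cofaithful_def by auto
  have c: "c_mor A k a u" "c_cell A k b (c_comp A f u) (c_zero A k b) \<kappa>"
    using k unfolding c_is_2kernel_def by auto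
  obtain s t where "D s = C b" "C s = D b" "D t = C b" "C t = C a" "b \<cdot> s \<oplus> fst f \<cdot> t = I (C b)"
    using f by (rule cofaithful_split)
  then show ?thesis by (rule cokernel_of_exact[OF a(1,2) c(1) a(3) c(2) exact_of_kernel[OF a(3) k]])
qed

text \<open>On the test object \<open>Z -> P\<close> the elements \<open>z\<close> and 0 are two
  1-cells and \<open>y\<close> is a 2-cell between their images under \<open>f\<close>; fullness
  lifts it.\<close>

lemma fully_faithful_lift:
  assumes f: "c_fully_faithful A a b f" and P: "projective A P"
    and y: "D z = P" "C z = C a" "D y = P" "C y = D b" "fst f \<cdot> z = b \<cdot> y"
  shows "\<exists>g. D g = P \<and> C g = D a \<and> a \<cdot> g = z \<and> snd f \<cdot> g = y"
proof -
  have tf: "c_mor A a b f" using f unfolding c_fully_faithful_def c_faithful_def by auto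
  let ?x = "\<zero> Z P" and ?g = "(z, \<zero> Z (D a))" and ?h = "(\<zero> P (C a), \<zero> Z (D a))"
  have "c_obj A ?x \<and> c_mor A ?x a ?g \<and> c_mor A ?x a ?h \<and> c_cell A ?x b (c_comp A f ?g) (c_comp A f ?h) y"
    using P y tf by (simp add: c_obj_def c_simps)
  then obtain \<alpha> where "c_cell A ?x a ?g ?h \<alpha>" "wl A f \<alpha> = y"
    using f unfolding c_fully_faithful_def by blast
  then show ?thesis by (intro exI[of _ \<alpha>]) (simp add: c_simps)
qed

text \<open>Fullness and faithfulness of \<open>f\<close> are the last two clauses of a root, so
  only essential surjectivity is at stake. A 1-cell \<open>w\<close> killed by the copip has
  \<open>fst w = b s + (fst f) t\<close>; \<open>\<ominus> s\<close> is the 2-cell, and in degree 1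
  the pullback property supplies the lift.\<close>

lemma fully_faithful_is_root:
  assumes f: "c_fully_faithful A a b f" and p: "c_is_copip A a b f p \<pi>"
  shows "c_is_root A b p \<pi> a f"
proof -
  have faith: "c_faithful A a b f" using f unfolding c_fully_faithful_def by auto
  then have a: "c_obj A a" and fm: "c_mor A a b f" unfolding c_faithful_def by auto
  note tf = fm[unfolded mor_iff]
  have \<pi>: "wr A \<pi> f = c_idcell A a p" "c_cell A b p (c_zero A b p) (c_zero A b p) \<pi>"
    using p unfolding c_is_copip_def by auto
  have t\<pi>: "D \<pi> = C b" "C \<pi> = D p" using \<pi> by (simp_all add: cell_iff)
  obtain q where q: "D q = C b" "c_is_copip A a b f (\<zero> (C q) Z) q"
    "\<forall>P y. projective A P \<longrightarrow> D y = P \<longrightarrow> C y = C b \<longrightarrow> q \<cdot> y = \<zero> P (C q)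
      \<longrightarrow> (\<exists>s t. D s = P \<and> C s = D b \<and> D t = P \<and> C t = C a \<and> y = b \<cdot> s \<oplus> fst f \<cdot> t)"
    using fm by (rule ex_copip)
  \<comment> \<open>The explicit copip factors through the given one, so \<open>\<pi> w = 0\<close>
    implies \<open>q w = 0\<close>.\<close>
  obtain v where v: "c_mor A p (\<zero> (C q) Z) v" "wl A v \<pi> = q"
    using q(2) p unfolding c_is_copip_def by blast
  have inj: "g = \<zero> P (D (snd f))" if "projective A P" "D g = P" "C g = D (snd f)" "a \<cdot> g = \<zero> P (C a)"
      "snd f \<cdot> g = \<zero> P (C (snd f))" for P g
    using faithfulD[OF faith, of P g] that tf by simp
  have surj: "\<exists>v \<beta>. c_mor A x a v \<and> c_cell A x b (c_comp A f v) w \<beta>"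
    if x: "c_obj A x" and w: "c_mor A x b w" "wr A \<pi> w = c_idcell A x p" for x w
  proof -
    note tw = w(1)[unfolded mor_iff]
    have "q \<cdot> fst w = snd v \<cdot> \<pi> \<cdot> fst w" using v tw t\<pi> by (simp add: c_simps flip: v(2))
    also have "\<dots> = \<zero> (C x) (C q)" using v(1) w tw by (simp add: c_simps)
    finally obtain s t where st: "D s = C x" "C s = D b" "D t = C x" "C t = C a" "fst w = b \<cdot> s \<oplus> fst f \<cdot> t"
      using q(3)[rule_format, OF x[unfolded c_obj_def], of "fst w"] tw by auto
    obtain v1 where v1: "D v1 = D (snd w \<oplus> \<ominus> (s \<cdot> x))" "C v1 = D (snd f)" "a \<cdot> v1 = t \<cdot> x"
        "snd f \<cdot> v1 = snd w \<oplus> \<ominus> (s \<cdot> x)"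
    proof (rule lift_from_projectives[of a "snd f" "t \<cdot> x" "snd w \<oplus> \<ominus> (s \<cdot> x)", OF _ _ _ _ inj])
      fix P z assume P: "projective A P" and z: "D z = P" "C z = D (snd w \<oplus> \<ominus> (s \<cdot> x))"
      have tz: "C z = D x" using z st(1-4) tw by simp
      have bw: "b \<cdot> snd w = (b \<cdot> s \<oplus> fst f \<cdot> t) \<cdot> x" using tw st(5) by simp
      have "fst f \<cdot> (t \<cdot> x) \<cdot> z = b \<cdot> (snd w \<oplus> \<ominus> (s \<cdot> x)) \<cdot> z"
        using st(1-4) tw tf tz cmp_eq[OF bw, of z] by (simp add: add_ac)
      then show "\<exists>g. D g = P \<and> C g = D (snd f) \<and> a \<cdot> g = (t \<cdot> x) \<cdot> z \<and> snd f \<cdot> g = (snd w \<oplus> \<ominus> (s \<cdot> x)) \<cdot> z"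
        using fully_faithful_lift[OF f P, of "(t \<cdot> x) \<cdot> z" "(snd w \<oplus> \<ominus> (s \<cdot> x)) \<cdot> z"] st(1-4) tw tf z(1) tz by simp
    qed (use st(1-4) tf tw in simp_all)
    have tv: "D v1 = D x" "C v1 = D a" using v1(1,2) st(1-4) tw tf by simp_all
    have m: "c_mor A x a (t, v1)" using tv v1(3) st(1-4) by (simp add: mor_iff)
    have f1: "snd f \<cdot> v1 = (\<ominus> s) \<cdot> x \<oplus> snd w" using v1(4) st(1-4) tw by (simp add: add_ac)
    have f0: "fst f \<cdot> t = b \<cdot> (\<ominus> s) \<oplus> fst w" unfolding st(5) using st(1-4) tf by simp
    have "c_mor A x b (c_comp A f (t, v1))"
      using m tf cmp_eq[of b "snd f" _ v1] by (simp add: c_simps)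
    then have "c_cell A x b (c_comp A f (t, v1)) w (\<ominus> s)"
      unfolding cell_iff using w(1) f1 f0 st(1-4) by (simp add: c_comp_def)
    then show ?thesis using m by blast
  qed
  show ?thesis
    unfolding c_is_root_def
    using a fm \<pi>(1) surj f unfolding c_fully_faithful_def c_faithful_def by blast
qed

text \<open>Again only essential surjectivity is at stake. It is treated like that of a 2-cokernel
  of a 1-cell from the zero object: the pushout property is \<open>exact_right\<close> with zero
  maps for \<open>u\<close> and \<open>\<kappa>\<close>, and the pip controls the elements of
  \<open>D a\<close> killed by both \<open>a\<close> and \<open>snd f\<close>.\<close>

lemma fully_cofaithful_is_coroot:
  assumes f: "c_fully_cofaithful A a b f" and p: "c_is_pip A a b f p \<pi>"
  shows "c_is_coroot A p a \<pi> b f"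
proof -
  have cofaith: "c_cofaithful A a b f" using f unfolding c_fully_cofaithful_def by auto
  then have a: "c_obj A a" and b: "c_obj A b" and fm: "c_mor A a b f" unfolding c_cofaithful_def by auto
  note tf = fm[unfolded mor_iff]
  have \<pi>: "wl A f \<pi> = c_idcell A p b" "c_cell A p a (c_zero A p a) (c_zero A p a) \<pi>"
    using p unfolding c_is_pip_def by auto
  have t\<pi>: "D \<pi> = C p" "C \<pi> = D a" using \<pi> by (simp_all add: cell_iff)
  obtain i e n where n: "is_kernel A e n" and e: "epi A e" "C e = D i" and i: "mono A i" "C i = D a"
    and pip: "c_is_pip A a b f n (i \<cdot> e)"
    and un: "\<forall>y. C y = D a \<longrightarrow> a \<cdot> y = \<zero> (D y) (C a) \<longrightarrow> snd f \<cdot> y = \<zero> (D y) (C (snd f))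
      \<longrightarrow> (\<exists>h. D h = D y \<and> C h = D i \<and> i \<cdot> h = y)"
    using fm by (rule ex_pip)
  \<comment> \<open>The explicit pip factors through the given one, so \<open>w \<pi> = 0\<close>
    makes \<open>snd w\<close> vanish on \<open>i e\<close>, hence on the joint kernel.\<close>
  obtain v where v: "c_mor A n p v" "wr A \<pi> v = i \<cdot> e"
    using pip p unfolding c_is_pip_def by blast
  obtain s t where st: "D s = C b" "C s = D b" "D t = C b" "C t = C a" "b \<cdot> s \<oplus> fst f \<cdot> t = I (C b)"
    using cofaith by (rule cofaithful_split)
  have "D (snd f) = D a" using tf by simp
  then obtain h j where hj: "D h = C (snd f)" "D j = C a" "C h = C j" "h \<cdot> snd f = j \<cdot> a"
    "\<forall>x y. C x = C y \<longrightarrow> D x = C (snd f) \<longrightarrow> D y = C a \<longrightarrow> x \<cdot> snd f = y \<cdot> a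
      \<longrightarrow> (\<exists>g. D g = C j \<and> C g = C y \<and> g \<cdot> h = x \<and> g \<cdot> j = y)"
    and ex: "\<forall>P y z. projective A P \<longrightarrow> D y = P \<longrightarrow> C y = C (snd f) \<longrightarrow> D z = P \<longrightarrow> C z = C a \<longrightarrow> h \<cdot> y = j \<cdot> z
      \<longrightarrow> (\<exists>g. D g = P \<and> C g = D (snd f) \<and> snd f \<cdot> g = y \<and> a \<cdot> g = z)"
    "\<forall>P w. projective A P \<longrightarrow> D w = P \<longrightarrow> C w = C j
      \<longrightarrow> (\<exists>y z. D y = P \<and> C y = C (snd f) \<and> D z = P \<and> C z = C a \<and> h \<cdot> y \<oplus> j \<cdot> z = w)"
    by (rule pushout)
  let ?x = "\<zero> (C j) Z" and ?g = "(\<zero> (C b) Z, h)" and ?h = "(\<zero> (C b) Z, \<zero> (D b) (C j))"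
  \<comment> \<open>\<open>j\<close> is a 2-cell between the images of \<open>h\<close> and zero.
    The lifted \<open>\<alpha>\<close> on \<open>b0\<close> restricts to \<open>h\<close> and
    \<open>j\<close>, so pairs identified in \<open>b0\<close> are already identified in the
    pushout.\<close>
  have "c_obj A ?x \<and> c_mor A b ?x ?g \<and> c_mor A b ?x ?h \<and> c_cell A a ?x (c_comp A ?g f) (c_comp A ?h f) j"
    using projective_Z hj(1-4) tf by (simp add: c_obj_def c_simps)
  then obtain \<alpha> where \<alpha>': "c_cell A b ?x ?g ?h \<alpha>" "wr A \<alpha> f = j"
    using f unfolding c_fully_cofaithful_def by blast
  have \<alpha>: "D \<alpha> = C b" "C \<alpha> = C j" "\<alpha> \<cdot> b = h" "\<alpha> \<cdot> fst f = j" using \<alpha>' by (simp_all add: c_simps)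
  have exr: "exact_right (\<zero> Z (C a)) (\<zero> Z (D b)) a (snd f) b (fst f)"
    unfolding exact_right_def
  proof (intro allI impI)
    fix P z y assume P: "projective A P" and y: "D z = P" "C z = D (fst f)" "D y = P" "C y = D b"
      "fst f \<cdot> z = b \<cdot> y"
    have "(\<alpha> \<cdot> b) \<cdot> y = (\<alpha> \<cdot> fst f) \<cdot> z" using y tf \<alpha>(1,2) by simp
    then have "h \<cdot> y = j \<cdot> z" unfolding \<alpha> .
    then obtain g where "D g = P" "C g = D (snd f)" "snd f \<cdot> g = y" "a \<cdot> g = z"
      using ex(1)[rule_format, OF P, of y z] y tf by auto
    then show "\<exists>p r. D p = P \<and> C p = D (\<zero> Z (D b)) \<and> D r = P \<and> C r = D (snd f) \<and>
        \<zero> Z (C a) \<cdot> p \<oplus> a \<cdot> r = z \<and> \<zero> Z (D b) \<cdot> p \<oplus> snd f \<cdot> r = y"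
      using y tf by (intro exI[of _ "\<zero> P Z"] exI[of _ g]) simp
  qed
  have ty: "D (\<zero> Z (C a)) = D (\<zero> Z (D b))" "C (\<zero> Z (C a)) = D (fst f)" "C (\<zero> Z (D b)) = D b"
    "D a = D (snd f)" "C a = D (fst f)"
    "C (snd f) = D b" "C b = C (fst f)" "D s = C (fst f)" "C s = D b" "D t = C (fst f)" "C t = D (fst f)"
    "b \<cdot> \<zero> Z (D b) = fst f \<cdot> \<zero> Z (C a)" "b \<cdot> snd f = fst f \<cdot> a" "b \<cdot> s \<oplus> fst f \<cdot> t = I (C (fst f))"
    using tf st by simp_all
  have surj: "\<exists>v \<beta>. c_mor A b x v \<and> c_cell A a x (c_comp A v f) w \<beta>"
    if x: "c_obj A x" and w: "c_mor A a x w" "wl A w \<pi> = c_idcell A p x" for x w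
  proof -
    note tw = w(1)[unfolded mor_iff]
    have "(snd w \<cdot> i) \<cdot> e = snd w \<cdot> \<pi> \<cdot> fst v" using v t\<pi> i e tw by (simp add: c_simps)
    also have "\<dots> = \<zero> (C n) (D x)"
      using w(2) cmp_eq[of "snd w" \<pi> _ "fst v"] v(1) tw t\<pi> by (simp add: c_simps)
    also have "\<dots> = \<zero> (D i) (D x) \<cdot> e" using kernelD(1)[OF n] e by simp
    finally have wi: "snd w \<cdot> i = \<zero> (D i) (D x)" by (rule epiD[OF e(1)]) (use i e tw in simp_all)
    obtain v1 \<beta> where v1: "D v1 = D b" "C v1 = C (\<zero> Z (D x))" "D \<beta> = D (fst f)" "C \<beta> = C (\<zero> Z (D x))"
      "v1 \<cdot> \<zero> Z (D b) = \<beta> \<cdot> \<zero> Z (C a) \<oplus> \<zero> Z (D x)" "v1 \<cdot> snd f = \<beta> \<cdot> a \<oplus> snd w"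
    proof (rule extension[OF ty exr])
      fix P y r assume r: "D y = P" "C y = D (\<zero> Z (D b))" "D r = P" "C r = D (snd f)"
        "\<zero> Z (C a) \<cdot> y \<oplus> a \<cdot> r = \<zero> P (D (fst f))" "\<zero> Z (D b) \<cdot> y \<oplus> snd f \<cdot> r = \<zero> P (D b)"
      \<comment> \<open>The summands coming from \<open>Z\<close> vanish, so \<open>r\<close> lies
        in the joint kernel of \<open>a\<close> and \<open>snd f\<close>.\<close>
      then obtain g where g: "D g = P" "C g = D i" "i \<cdot> g = r" using un[rule_format, of r] tf by auto
      have "snd w \<cdot> r = \<zero> P (D x)"
        unfolding g(3)[symmetric] using cmp_eq[OF wi, of g] g(1,2) i tw by simp
      then show "\<zero> Z (D x) \<cdot> y \<oplus> snd w \<cdot> r = \<zero> P (C (\<zero> Z (D x)))" using r by simp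
    qed (use a tw tf in \<open>simp_all add: c_obj_def\<close>)
    have tv: "C v1 = D x" "C \<beta> = D x" using v1 by simp_all
    have 1: "(x \<cdot> v1) \<cdot> \<zero> Z (D b) = (fst w \<oplus> x \<cdot> \<beta>) \<cdot> \<zero> Z (C a)" "(x \<cdot> v1) \<cdot> snd f = (fst w \<oplus> x \<cdot> \<beta>) \<cdot> a"
      using v1(1,3,6) tv ty tw by (simp_all add: add_ac)
    have 2: "D (x \<cdot> v1) = D b" "D (fst w \<oplus> x \<cdot> \<beta>) = D (fst f)" "C (x \<cdot> v1) = C (fst w \<oplus> x \<cdot> \<beta>)"
      using v1(1,3) tv tw ty by simp_all
    define v0 where "v0 = (x \<cdot> v1) \<cdot> s \<oplus> (fst w \<oplus> x \<cdot> \<beta>) \<cdot> t"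
    have v0: "D v0 = C b" "C v0 = C x" "v0 \<cdot> b = x \<cdot> v1" "v0 \<cdot> fst f = fst w \<oplus> x \<cdot> \<beta>"
      using map_from_target[OF ty exr 2 1] v1(1,3) tv tw ty(1-11) unfolding v0_def by simp_all
    show ?thesis
      using v0 v1(1,3,6) tv tw tf w(1) by (intro exI[of _ "(v0, v1)"] exI[of _ \<beta>])
        (simp add: c_simps add_ac cmp_eq[OF v0(3)] cmp_eq[OF v0(4)])
  qed
  show ?thesis
    unfolding c_is_coroot_def
    using b fm \<pi>(1) surj f unfolding c_fully_cofaithful_def c_cofaithful_def by blast
qed

section \<open>Zero object, biproducts and 2-additivity\<close>

lemma zero_obj: "c_zero_obj A (\<zero> Z Z)"
proof -
  have to: "\<exists>!\<alpha>. c_cell A x (\<zero> Z Z) f g \<alpha>" if "c_mor A x (\<zero> Z Z) f" "c_mor A x (\<zero> Z Z) g" for x f g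
  proof (rule ex1I[of _ "\<zero> (C x) Z"])
    have "fst f = fst g" by (rule to_Z) (use that in \<open>simp_all add: mor_iff\<close>)
    moreover have "snd f = snd g" by (rule to_Z) (use that in \<open>simp_all add: mor_iff\<close>)
    ultimately show "c_cell A x (\<zero> Z Z) f g (\<zero> (C x) Z)" using that by (simp add: c_simps)
    show "\<alpha> = \<zero> (C x) Z" if "c_cell A x (\<zero> Z Z) f g \<alpha>" for \<alpha>
      by (rule to_Z) (use that in \<open>simp_all add: cell_iff\<close>)
  qed
  have fro: "\<exists>!\<alpha>. c_cell A (\<zero> Z Z) x f g \<alpha>" if "c_mor A (\<zero> Z Z) x f" "c_mor A (\<zero> Z Z) x g" for x f g
  proof (rule ex1I[of _ "\<zero> Z (D x)"])
    have "fst f = fst g" by (rule from_Z) (use that in \<open>simp_all add: mor_iff\<close>)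
    moreover have "snd f = snd g" by (rule from_Z) (use that in \<open>simp_all add: mor_iff\<close>)
    ultimately show "c_cell A (\<zero> Z Z) x f g (\<zero> Z (D x))" using that by (simp add: c_simps)
    show "\<alpha> = \<zero> Z (D x)" if "c_cell A (\<zero> Z Z) x f g \<alpha>" for \<alpha>
      by (rule from_Z) (use that in \<open>simp_all add: cell_iff\<close>)
  qed
  have "c_mor A x (\<zero> Z Z) (c_zero A x (\<zero> Z Z))" "c_mor A (\<zero> Z Z) x (c_zero A (\<zero> Z Z) x)" for x
    by (simp_all add: c_simps)
  moreover have "c_obj A (\<zero> Z Z)" using projective_Z by (simp add: c_obj_def)
  ultimately show ?thesis
    unfolding c_zero_obj_def by (intro conjI allI impI; (elim conjE)?) (assumption | rule to fro exI)+
qed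

lemma projective_biproduct:
  assumes "projective A x" "projective A y"
    and t: "D i1 = x" "C i1 = s" "D i2 = y" "C i2 = s" "D p1 = s" "C p1 = x" "D p2 = s" "C p2 = y"
    and id: "i1 \<cdot> p1 \<oplus> i2 \<cdot> p2 = I s"
  shows "projective A s"
  unfolding projective_def
proof (intro allI impI, elim conjE)
  fix e g assume e: "epi A e" and g: "g \<in> hom A s (C e)"
  obtain h1 where h1: "D h1 = x" "C h1 = D e" "e \<cdot> h1 = g \<cdot> i1"
    using projective_lift[OF assms(1) e, of "g \<cdot> i1"] g t by auto
  obtain h2 where h2: "D h2 = y" "C h2 = D e" "e \<cdot> h2 = g \<cdot> i2"
    using projective_lift[OF assms(2) e, of "g \<cdot> i2"] g t by auto
  have "e \<cdot> (h1 \<cdot> p1 \<oplus> h2 \<cdot> p2) = g \<cdot> (i1 \<cdot> p1 \<oplus> i2 \<cdot> p2)"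
    using h1(1,2) h2(1,2) t g cmp_eq[OF h1(3), of p1] cmp_eq[OF h2(3), of p2] by simp
  also have "\<dots> = g" unfolding id using g by simp
  finally show "\<exists>h\<in>hom A s (D e). e \<cdot> h = g"
    using h1(1,2) h2(1,2) t by (intro bexI[of _ "h1 \<cdot> p1 \<oplus> h2 \<cdot> p2"]) simp_all
qed

text \<open>Biproducts are formed degreewise and are strict, so all five 2-cells can be taken to be
  zero maps.\<close>

lemma ex_2biproduct:
  assumes a: "c_obj A a" and b: "c_obj A b"
  shows "\<exists>s i1 i2 p1 p2 \<alpha>1 \<alpha>2 \<alpha>3 \<alpha>4 \<alpha>5. c_obj A s \<and>
           c_mor A a s i1 \<and> c_mor A b s i2 \<and> c_mor A s a p1 \<and> c_mor A s b p2 \<and>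
           c_cell A a a (c_comp A p1 i1) (c_id A a) \<alpha>1 \<and>
           c_cell A b b (c_comp A p2 i2) (c_id A b) \<alpha>2 \<and>
           c_cell A b a (c_comp A p1 i2) (c_zero A b a) \<alpha>3 \<and>
           c_cell A a b (c_comp A p2 i1) (c_zero A a b) \<alpha>4 \<and>
           c_cell A s s (c_add A (c_comp A i1 p1) (c_comp A i2 p2)) (c_id A s) \<alpha>5"
proof -
  obtain s1 i1 i2 p1 p2 where
    t: "D i1 = D a" "C i1 = s1" "D i2 = D b" "C i2 = s1" "D p1 = s1" "C p1 = D a" "D p2 = s1" "C p2 = D b"
    and e: "p1 \<cdot> i1 = I (D a)" "p2 \<cdot> i2 = I (D b)" "p1 \<cdot> i2 = \<zero> (D b) (D a)" "p2 \<cdot> i1 = \<zero> (D a) (D b)"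
      "i1 \<cdot> p1 \<oplus> i2 \<cdot> p2 = I s1" by (rule biproduct)
  obtain s0 j1 j2 q1 q2 where
    t': "D j1 = C a" "C j1 = s0" "D j2 = C b" "C j2 = s0" "D q1 = s0" "C q1 = C a" "D q2 = s0" "C q2 = C b"
    and e': "q1 \<cdot> j1 = I (C a)" "q2 \<cdot> j2 = I (C b)" "q1 \<cdot> j2 = \<zero> (C b) (C a)" "q2 \<cdot> j1 = \<zero> (C a) (C b)"
      "j1 \<cdot> q1 \<oplus> j2 \<cdot> q2 = I s0" by (rule biproduct)
  define s where "s = j1 \<cdot> a \<cdot> p1 \<oplus> j2 \<cdot> b \<cdot> p2"
  have ts: "D s = s1" "C s = s0" using t t' by (simp_all add: s_def)
  have s: "c_obj A s"
    using a b projective_biproduct[OF _ _ t' e'(5)] ts by (simp add: c_obj_def)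
  have m: "s \<cdot> i1 = j1 \<cdot> a" "s \<cdot> i2 = j2 \<cdot> b" "q1 \<cdot> s = a \<cdot> p1" "q2 \<cdot> s = b \<cdot> p2"
    using t t' e e'(1-4)[THEN cmp_eq] by (simp_all add: s_def)
  have mor: "c_mor A a s (j1, i1)" "c_mor A b s (j2, i2)" "c_mor A s a (q1, p1)" "c_mor A s b (q2, p2)"
    using t t' ts m by (simp_all add: mor_iff)
  have "c_cell A a a (c_comp A (q1, p1) (j1, i1)) (c_id A a) (\<zero> (C a) (D a))"
    "c_cell A b b (c_comp A (q2, p2) (j2, i2)) (c_id A b) (\<zero> (C b) (D b))"
    "c_cell A b a (c_comp A (q1, p1) (j2, i2)) (c_zero A b a) (\<zero> (C b) (D a))"
    "c_cell A a b (c_comp A (q2, p2) (j1, i1)) (c_zero A a b) (\<zero> (C a) (D b))"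
    "c_cell A s s (c_add A (c_comp A (j1, i1) (q1, p1)) (c_comp A (j2, i2) (q2, p2))) (c_id A s) (\<zero> (C s) (D s))"
    using t t' ts e e' by (simp_all add: c_simps)
  then show ?thesis using s mor by blast
qed

lemma two_additive: "c_two_additive A"
  unfolding c_two_additive_def
proof (intro conjI allI impI; (elim conjE)?)
  show "\<exists>z. c_zero_obj A z" using zero_obj by blast
next
  fix a b assume "c_obj A a" "c_obj A b"
  then show "\<exists>s i1 i2 p1 p2 \<alpha>1 \<alpha>2 \<alpha>3 \<alpha>4 \<alpha>5. c_obj A s \<and>
           c_mor A a s i1 \<and> c_mor A b s i2 \<and> c_mor A s a p1 \<and> c_mor A s b p2 \<and>
           c_cell A a a (c_comp A p1 i1) (c_id A a) \<alpha>1 \<and>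
           c_cell A b b (c_comp A p2 i2) (c_id A b) \<alpha>2 \<and>
           c_cell A b a (c_comp A p1 i2) (c_zero A b a) \<alpha>3 \<and>
           c_cell A a b (c_comp A p2 i1) (c_zero A a b) \<alpha>4 \<and>
           c_cell A s s (c_add A (c_comp A i1 p1) (c_comp A i2 p2)) (c_id A s) \<alpha>5"
    by (rule ex_2biproduct)
next
  fix a b f g \<alpha> assume c: "c_cell A a b f g \<alpha>"
  note tc = c[unfolded cell_iff mor_iff]
  have "snd g = (\<ominus> \<alpha>) \<cdot> a \<oplus> snd f" "fst g = b \<cdot> (\<ominus> \<alpha>) \<oplus> fst f" using tc by simp_all
  then show "c_cell A a b g f (\<ominus> \<alpha>)" unfolding cell_iff using c by (simp add: cell_iff)
qed (auto simp: c_simps prod_eq_iff add_ac)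

lemma two_abelian: "c_two_abelian A"
proof -
  have "\<exists>p \<pi>. c_is_pip A a b f p \<pi>" if "c_mor A a b f" for a b f
    using ex_pip[OF that] by metis
  moreover have "\<exists>p \<pi>. c_is_copip A a b f p \<pi>" if "c_mor A a b f" for a b f
    using ex_copip[OF that] by metis
  ultimately show ?thesis
    unfolding c_two_abelian_def
    by (intro conjI allI impI; (elim conjE)?)
      (assumption | rule two_additive ex_2kernel ex_2cokernel ex_root ex_coroot faithful_is_kernel
        cofaithful_is_cokernel fully_faithful_is_root fully_cofaithful_is_coroot | blast)+
qed

end

section \<open>Discrete and codiscrete objects\<close>

context abelian_projective
begin

section \<open>Recognising discrete and codiscrete objects\<close>

text \<open>Faithfulness of the 1-cell to \<open>Z -> Z\<close> forces every generalised element of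
  the kernel of \<open>a\<close> to be zero. Conversely \<open>a \<alpha>\<close> is the difference
  of the degree 0 components of two 1-cells, so these determine \<open>\<alpha>\<close> when
  \<open>a\<close> is mono.\<close>

lemma discrete_iff: "c_discrete A a \<longleftrightarrow> c_obj A a \<and> mono A a"
proof
  assume a: "c_discrete A a"
  have "c_mor A a (\<zero> Z Z) (c_zero A a (\<zero> Z Z))" by (simp add: c_simps)
  then have f: "c_faithful A a (\<zero> Z Z) (c_zero A a (\<zero> Z Z))" using a zero_obj unfolding c_discrete_def by blast
  have "mono A a"
  proof (rule monoI)
    fix y assume y: "C y = D a" "a \<cdot> y = \<zero> (D y) (C a)"
    have "y = \<zero> (D y) (C y)"
    proof (rule zero_if_zero_on_projectives)
      fix P z assume P: "projective A P" and z: "D z = P" "C z = D y"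
      have "a \<cdot> y \<cdot> z = \<zero> P (C a)" using cmp_eq[OF y(2), of z] y z by simp
      then show "y \<cdot> z = \<zero> P (C y)"
        using faithfulD[OF f P, of "y \<cdot> z"] y z by (simp add: c_zero_def)
    qed
    then show "y = \<zero> (D y) (D a)" using y by simp
  qed
  then show "c_obj A a \<and> mono A a" using a unfolding c_discrete_def by blast
next
  assume a: "c_obj A a \<and> mono A a"
  have "c_faithful A a z t" if z: "c_zero_obj A z" "c_mor A a z t" for z t
    unfolding c_faithful_def
  proof (intro conjI allI impI)
    show "c_obj A z" using z unfolding c_zero_obj_def by blast
    fix x g h \<alpha> \<beta> assume "c_obj A x \<and> c_cell A x a g h \<alpha> \<and> c_cell A x a g h \<beta> \<and> wl A t \<alpha> = wl A t \<beta>"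
    then have c: "c_cell A x a g h \<alpha>" "c_cell A x a g h \<beta>" by auto
    have "a \<cdot> \<alpha> \<oplus> fst h = a \<cdot> \<beta> \<oplus> fst h" using c by (simp add: cell_iff)
    then have "a \<cdot> \<alpha> = a \<cdot> \<beta>" using c by (simp add: c_simps)
    then show "\<alpha> = \<beta>" by (rule monoD[OF conjunct2[OF a]]) (use c in \<open>simp_all add: c_simps\<close>)
  qed (use a z in auto)
  then show "c_discrete A a" using a unfolding c_discrete_def by blast
qed

text \<open>Here the test objects are \<open>C y -> Z\<close>: a map \<open>y\<close> killing
  \<open>a\<close> is a 2-cell between zero 1-cells. Conversely \<open>\<alpha> a\<close> is fixed
  by the degree 1 components.\<close>

lemma codiscrete_iff: "c_codiscrete A a \<longleftrightarrow> c_obj A a \<and> epi A a"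
proof
  assume a: "c_codiscrete A a"
  let ?t = "c_zero A (\<zero> Z Z) a"
  have "c_mor A (\<zero> Z Z) a ?t" by (simp add: c_simps)
  then have f: "c_cofaithful A (\<zero> Z Z) a ?t" using a zero_obj unfolding c_codiscrete_def by blast
  have "epi A a"
  proof (rule epiI)
    fix y assume y: "D y = C a" "y \<cdot> a = \<zero> (D a) (C y)"
    let ?x = "\<zero> (C y) Z"
    have "c_obj A ?x \<and> c_cell A a ?x (c_zero A a ?x) (c_zero A a ?x) y
        \<and> c_cell A a ?x (c_zero A a ?x) (c_zero A a ?x) (\<zero> (C a) (C y)) \<and> wr A y ?t = wr A (\<zero> (C a) (C y)) ?t"
      using projective_Z y by (simp add: c_obj_def c_simps)
    then show "y = \<zero> (C a) (C y)" using f unfolding c_cofaithful_def by blast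
  qed
  then show "c_obj A a \<and> epi A a" using a unfolding c_codiscrete_def by blast
next
  assume a: "c_obj A a \<and> epi A a"
  have "c_cofaithful A z a t" if z: "c_zero_obj A z" "c_mor A z a t" for z t
    unfolding c_cofaithful_def
  proof (intro conjI allI impI)
    show "c_obj A z" using z unfolding c_zero_obj_def by blast
    fix x g h \<alpha> \<beta> assume "c_obj A x \<and> c_cell A a x g h \<alpha> \<and> c_cell A a x g h \<beta> \<and> wr A \<alpha> t = wr A \<beta> t"
    then have c: "c_cell A a x g h \<alpha>" "c_cell A a x g h \<beta>" by auto
    have "\<alpha> \<cdot> a \<oplus> snd h = \<beta> \<cdot> a \<oplus> snd h" using c by (simp add: cell_iff)
    then have "\<alpha> \<cdot> a = \<beta> \<cdot> a" using c by (simp add: c_simps)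
    then show "\<alpha> = \<beta>" by (rule epiD[OF conjunct2[OF a]]) (use c in \<open>simp_all add: c_simps\<close>)
  qed (use a z in auto)
  then show "c_codiscrete A a" using a unfolding c_codiscrete_def by blast
qed

section \<open>The cokernel functor on discrete objects\<close>

definition cok where "cok a = (SOME c. is_cokernel A a c)"

definition cok_map where
  "cok_map a b f = (SOME h. D h = C (cok a) \<and> C h = C (cok b) \<and> h \<cdot> cok a = cok b \<cdot> fst f)"

lemma cok: "is_cokernel A a (cok a)"
  unfolding cok_def using ex_cokernel by (rule someI_ex)

lemmas cokD = cokernelD[OF cok]

lemma cok_map:
  assumes "c_mor A a b f"
  shows "D (cok_map a b f) = C (cok a)" "C (cok_map a b f) = C (cok b)"
    "cok_map a b f \<cdot> cok a = cok b \<cdot> fst f"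
proof -
  note tf = assms[unfolded mor_iff]
  have "cok b \<cdot> b \<cdot> snd f = \<zero> (D a) (C (cok b))"
    using cmp_eq[OF cokD(2)[of b], of "snd f"] cokD(1)[of b] tf by simp
  then have "(cok b \<cdot> fst f) \<cdot> a = \<zero> (D a) (C (cok b \<cdot> fst f))" using tf cokD(1)[of b] by simp
  then have "\<exists>h. D h = C (cok a) \<and> C h = C (cok b) \<and> h \<cdot> cok a = cok b \<cdot> fst f"
    using cokD(4)[of "cok b \<cdot> fst f" a] tf cokD(1)[of b] by simp
  from someI_ex[OF this] show "D (cok_map a b f) = C (cok a)" "C (cok_map a b f) = C (cok b)"
    "cok_map a b f \<cdot> cok a = cok b \<cdot> fst f" unfolding cok_map_def by auto
qed

lemma cok_map_eqI:
  assumes "c_mor A a b f" "D h = C (cok a)" "C h = C (cok b)" "h \<cdot> cok a = cok b \<cdot> fst f"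
  shows "cok_map a b f = h"
  by (rule epiD[OF cokD(3)[of a]]) (use assms cok_map[OF assms(1)] in simp_all)

text \<open>The comparison argument for projective presentations: a map of cokernels lifts in degree
  0 because \<open>C a\<close> is projective, and in degree 1 because the mono \<open>b\<close> is
  the kernel of its cokernel. The latter fact also turns a difference with zero induced map into a
  2-cell.\<close>

lemma discrete_equivalence: "discrete_equiv_via_coker A"
  unfolding discrete_equiv_via_coker_def
proof (intro exI[of _ cok] exI[of _ "\<lambda>a. C (cok a)"] exI[of _ cok_map] conjI allI impI; (elim conjE)?)
  show "is_cokernel A a (cok a)" for a by (rule cok)
next
  fix a b f assume "c_mor A a b f"
  then show "cok_map a b f \<in> hom A (C (cok a)) (C (cok b))" "cok_map a b f \<cdot> cok a = cok b \<cdot> fst f"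
    using cok_map by simp_all
next
  fix a b f g \<alpha> assume c: "c_cell A a b f g \<alpha>"
  note tc = c[unfolded cell_iff mor_iff]
  have m: "c_mor A a b f" "c_mor A a b g" using c by (auto simp: cell_iff)
  have "cok b \<cdot> fst f = cok b \<cdot> fst g"
    using tc cokD(1)[of b] cmp_eq[OF cokD(2)[of b], of \<alpha>] by simp
  then show "cok_map a b f = cok_map a b g"
    using cok_map[OF m(2)] by (intro cok_map_eqI[OF m(1)]) simp_all
next
  fix a
  have "c_mor A a a (c_id A a)" by (simp add: c_simps)
  then show "cok_map a a (c_id A a) = I (C (cok a))"
    by (rule cok_map_eqI) (use cokD(1)[of a] in \<open>simp_all add: c_id_def\<close>)
next
  fix a b c f g assume m: "c_mor A a b f" "c_mor A b c g"
  note tm = m[unfolded mor_iff]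
  have "c_mor A a c (c_comp A g f)"
    using tm cmp_eq[of c "snd g" _ "snd f"] cmp_eq[of b "snd f"] by (simp add: c_simps)
  then show "cok_map a c (c_comp A g f) = cok_map b c g \<cdot> cok_map a b f"
    by (rule cok_map_eqI)
      (use cok_map[OF m(1)] cok_map[OF m(2)] cokD(1)[of a] cokD(1)[of b] cokD(1)[of c] tm
        cmp_eq[OF cok_map(3)[OF m(2)], of "fst f"] in \<open>simp_all add: c_comp_def\<close>)
next
  fix a b f g assume d: "c_discrete A b" and m: "c_mor A a b f" "c_mor A a b g" and e: "cok_map a b f = cok_map a b g"
  note tm = m[unfolded mor_iff]
  have mono: "mono A b" using d discrete_iff by blast
  have "cok b \<cdot> fst f = cok b \<cdot> fst g" using cok_map(3)[OF m(1)] cok_map(3)[OF m(2)] e by simp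
  then have "cok b \<cdot> (fst f \<oplus> \<ominus> (fst g)) = \<zero> (C a) (C (cok b))" using tm cokD(1)[of b] by simp
  then obtain \<alpha> where \<alpha>: "D \<alpha> = C a" "C \<alpha> = D b" "b \<cdot> \<alpha> = fst f \<oplus> \<ominus> (fst g)"
    using mono_kernel_of_cokernel[OF mono cok, of "fst f \<oplus> \<ominus> (fst g)"] tm by auto
  have "b \<cdot> snd f = b \<cdot> (\<alpha> \<cdot> a \<oplus> snd g)" using tm \<alpha> cmp_eq[OF \<alpha>(3), of a] by simp
  then have "snd f = \<alpha> \<cdot> a \<oplus> snd g" by (rule monoD[OF mono]) (use tm \<alpha> in simp_all)
  then show "\<exists>\<alpha>. c_cell A a b f g \<alpha>" using \<alpha> m tm by (intro exI[of _ \<alpha>]) (simp add: cell_iff)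
next
  fix a b h assume d: "c_discrete A a" "c_discrete A b" and h: "h \<in> hom A (C (cok a)) (C (cok b))"
  have mono: "mono A b" and P: "projective A (C a)" using d discrete_iff unfolding c_obj_def by blast+
  obtain f0 where f0: "D f0 = C a" "C f0 = D (cok b)" "cok b \<cdot> f0 = h \<cdot> cok a"
    using projective_lift[OF P cokD(3)[of b], of "h \<cdot> cok a"] h cokD(1)[of a] by auto
  have "cok b \<cdot> f0 \<cdot> a = \<zero> (D a) (C (cok b))"
    using cmp_eq[OF f0(3), of a] f0 h cokD(1,2)[of a] by simp
  then obtain f1 where f1: "D f1 = D a" "C f1 = D b" "b \<cdot> f1 = f0 \<cdot> a"
    using mono_kernel_of_cokernel[OF mono cok, of "f0 \<cdot> a"] f0(1,2) cokD(1)[of b] by auto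
  have m: "c_mor A a b (f0, f1)" using f0 f1 cokD(1)[of b] by (simp add: mor_iff)
  have "cok_map a b (f0, f1) = h" by (rule cok_map_eqI[OF m]) (use h f0 in simp_all)
  then show "\<exists>f. c_mor A a b f \<and> cok_map a b f = h" using m by blast
next
  fix X
  \<comment> \<open>The kernel \<open>n\<close> of a projective cover of \<open>X\<close> is
    discrete, and \<open>e\<close> and \<open>cok n\<close> are both cokernels of \<open>n\<close>;
    \<open>h\<close> and \<open>g\<close> compare them.\<close>
  obtain P e where e: "projective A P" "epi A e" "D e = P" "C e = X" by (rule projective_cover)
  obtain n where n': "is_kernel A e n" using ex_kernel by blast
  note n = kernelD[OF n']
  obtain h where h: "D h = C (cok n)" "C h = C e" "h \<cdot> cok n = e" using cokD(4)[of e n] n(1,2) by auto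
  obtain g where g: "D g = C e" "C g = C (cok n)" "g \<cdot> e = cok n"
    using epi_cokernel_of_kernel[OF e(2) n', of "cok n"] cokD(1,2)[of n] n(1) by auto
  have 1: "(g \<cdot> h) \<cdot> cok n = I (C (cok n)) \<cdot> cok n" using g h by simp
  have gh: "g \<cdot> h = I (C (cok n))" by (rule epiD[OF cokD(3) 1]) (use g(1,2) h(1,2) in simp_all)
  have 2: "(h \<cdot> g) \<cdot> e = I X \<cdot> e" using g h e cokD(1)[of n] n(1) by simp
  have hg: "h \<cdot> g = I X" by (rule epiD[OF e(2) 2]) (use g(1,2) h(1,2) e in simp_all)
  have "c_discrete A n" using discrete_iff n(1,3) e by (simp add: c_obj_def)
  moreover have "isomorphic A (C (cok n)) X"
    unfolding isomorphic_def using gh hg g(1,2) h(1,2) e(4) by (intro exI[of _ h] exI[of _ g]) simp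
  ultimately show "\<exists>a. c_discrete A a \<and> isomorphic A (C (cok a)) X" by blast
qed simp_all

section \<open>The kernel functor on codiscrete objects\<close>

definition ker where "ker a = (SOME k. is_kernel A a k)"

definition ker_map where
  "ker_map a b f = (SOME h. D h = D (ker a) \<and> C h = D (ker b) \<and> ker b \<cdot> h = snd f \<cdot> ker a)"

lemma ker: "is_kernel A a (ker a)"
  unfolding ker_def using ex_kernel by (rule someI_ex)

lemmas kerD = kernelD[OF ker]

lemma ker_map:
  assumes "c_mor A a b f"
  shows "D (ker_map a b f) = D (ker a)" "C (ker_map a b f) = D (ker b)"
    "ker b \<cdot> ker_map a b f = snd f \<cdot> ker a"
proof -
  note tf = assms[unfolded mor_iff]
  have "b \<cdot> snd f \<cdot> ker a = \<zero> (D (ker a)) (C b)"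
    using cmp_eq[of b "snd f" _ "ker a"] kerD(1,2)[of a] tf by simp
  then have "\<exists>h. D h = D (ker a) \<and> C h = D (ker b) \<and> ker b \<cdot> h = snd f \<cdot> ker a"
    using kerD(4)[of "snd f \<cdot> ker a" b] tf kerD(1)[of a] by simp
  from someI_ex[OF this] show "D (ker_map a b f) = D (ker a)" "C (ker_map a b f) = D (ker b)"
    "ker b \<cdot> ker_map a b f = snd f \<cdot> ker a" unfolding ker_map_def by auto
qed

lemma ker_map_eqI:
  assumes "c_mor A a b f" "D h = D (ker a)" "C h = D (ker b)" "ker b \<cdot> h = snd f \<cdot> ker a"
  shows "ker_map a b f = h"
  by (rule monoD[OF kerD(3)[of b]]) (use assms ker_map[OF assms(1)] in simp_all)

text \<open>If two 1-cells induce the same map, the difference of their degree 1 components kills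
  \<open>ker a\<close>, hence factors through the epi \<open>a\<close>, and the factor is the
  2-cell. Projectivity of \<open>C a\<close> enters through fullness.\<close>

lemma codiscrete_equivalence: "codiscrete_equiv_via_ker A"
  unfolding codiscrete_equiv_via_ker_def
proof (intro exI[of _ ker] exI[of _ "\<lambda>a. D (ker a)"] exI[of _ ker_map] conjI allI impI; (elim conjE)?)
  show "is_kernel A a (ker a)" for a by (rule ker)
next
  fix a b f assume "c_mor A a b f"
  then show "ker_map a b f \<in> hom A (D (ker a)) (D (ker b))" "ker b \<cdot> ker_map a b f = snd f \<cdot> ker a"
    using ker_map by simp_all
next
  fix a b f g \<alpha> assume c: "c_cell A a b f g \<alpha>"
  note tc = c[unfolded cell_iff mor_iff]
  have m: "c_mor A a b f" "c_mor A a b g" using c by (auto simp: cell_iff)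
  have "snd f \<cdot> ker a = snd g \<cdot> ker a" using tc kerD(1,2)[of a] by simp
  then show "ker_map a b f = ker_map a b g"
    using ker_map[OF m(2)] by (intro ker_map_eqI[OF m(1)]) simp_all
next
  fix a
  have "c_mor A a a (c_id A a)" by (simp add: c_simps)
  then show "ker_map a a (c_id A a) = I (D (ker a))"
    by (rule ker_map_eqI) (use kerD(1)[of a] in \<open>simp_all add: c_id_def\<close>)
next
  fix a b c f g assume m: "c_mor A a b f" "c_mor A b c g"
  note tm = m[unfolded mor_iff]
  have "c_mor A a c (c_comp A g f)"
    using tm cmp_eq[of c "snd g" _ "snd f"] cmp_eq[of b "snd f"] by (simp add: c_simps)
  then show "ker_map a c (c_comp A g f) = ker_map b c g \<cdot> ker_map a b f"
    by (rule ker_map_eqI)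
      (use ker_map[OF m(1)] ker_map[OF m(2)] kerD(1)[of a] kerD(1)[of b] kerD(1)[of c] tm
        cmp_eq[OF ker_map(3)[OF m(2)], of "ker_map a b f"] in \<open>simp_all add: c_comp_def\<close>)
next
  fix a b f g assume d: "c_codiscrete A a" and m: "c_mor A a b f" "c_mor A a b g" and e: "ker_map a b f = ker_map a b g"
  note tm = m[unfolded mor_iff]
  have epi: "epi A a" using d codiscrete_iff by blast
  have "snd f \<cdot> ker a = snd g \<cdot> ker a" using ker_map(3)[OF m(1)] ker_map(3)[OF m(2)] e by simp
  then have "(snd f \<oplus> \<ominus> (snd g)) \<cdot> ker a = \<zero> (D (ker a)) (D b)" using tm kerD(1)[of a] by simp
  then obtain \<alpha> where \<alpha>: "D \<alpha> = C a" "C \<alpha> = D b" "\<alpha> \<cdot> a = snd f \<oplus> \<ominus> (snd g)"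
    using epi_cokernel_of_kernel[OF epi ker, of "snd f \<oplus> \<ominus> (snd g)"] tm by auto
  have "fst f \<cdot> a = (b \<cdot> \<alpha> \<oplus> fst g) \<cdot> a" using tm \<alpha> by simp
  then have "fst f = b \<cdot> \<alpha> \<oplus> fst g" by (rule epiD[OF epi]) (use tm \<alpha> in simp_all)
  then show "\<exists>\<alpha>. c_cell A a b f g \<alpha>" using \<alpha> m tm by (intro exI[of _ \<alpha>]) (simp add: cell_iff)
next
  fix a b h assume d: "c_codiscrete A a" "c_codiscrete A b" and h: "h \<in> hom A (D (ker a)) (D (ker b))"
  have epi: "epi A a" and P: "projective A (C a)" using d codiscrete_iff unfolding c_obj_def by blast+
  \<comment> \<open>a is a split epi, so its kernel is a direct summand and h extends by zero.\<close>
  obtain s where s: "D s = C a" "C s = D a" "a \<cdot> s = I (C a)"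
    using projective_lift[OF P epi, of "I (C a)"] by auto
  have "a \<cdot> (I (D a) \<oplus> \<ominus> (s \<cdot> a)) = \<zero> (D a) (C a)" using s cmp_eq[OF s(3), of a] by simp
  then obtain r where r: "D r = D a" "C r = D (ker a)" "ker a \<cdot> r = I (D a) \<oplus> \<ominus> (s \<cdot> a)"
    using kerD(4)[of "I (D a) \<oplus> \<ominus> (s \<cdot> a)" a] s(1,2) by auto
  have "ker a \<cdot> r \<cdot> ker a = ker a \<cdot> I (D (ker a))"
    using cmp_eq[OF r(3), of "ker a"] r s(1,2) kerD(1,2)[of a] by simp
  then have rk: "r \<cdot> ker a = I (D (ker a))" by (rule monoD[OF kerD(3)]) (use r kerD(1)[of a] in simp_all)
  let ?f = "(\<zero> (C a) (C b), ker b \<cdot> h \<cdot> r)"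
  have m: "c_mor A a b ?f"
    using h r kerD(1)[of b] cmp_eq[OF kerD(2)[of b], of "h \<cdot> r"] by (simp add: mor_iff)
  have "ker_map a b ?f = h" by (rule ker_map_eqI[OF m]) (use h r rk kerD(1)[of a] kerD(1)[of b] in simp_all)
  then show "\<exists>f. c_mor A a b f \<and> ker_map a b f = h" using m by blast
next
  fix X
  \<comment> \<open>The identity of \<open>X\<close> is a kernel of \<open>X -> Z\<close>, so the
    chosen kernel is invertible.\<close>
  let ?a = "\<zero> X Z"
  obtain g where g: "D g = X" "C g = D (ker ?a)" "ker ?a \<cdot> g = I X" using kerD(4)[of "I X" ?a] by auto
  have "ker ?a \<cdot> g \<cdot> ker ?a = ker ?a \<cdot> I (D (ker ?a))"
    using cmp_eq[OF g(3), of "ker ?a"] g kerD(1)[of ?a] by simp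
  then have gk: "g \<cdot> ker ?a = I (D (ker ?a))" by (rule monoD[OF kerD(3)]) (use g kerD(1)[of ?a] in simp_all)
  have "c_codiscrete A ?a" using codiscrete_iff epi_to_Z projective_Z by (simp add: c_obj_def)
  moreover have "isomorphic A (D (ker ?a)) X"
    unfolding isomorphic_def using gk g kerD(1)[of ?a] by (intro exI[of _ "ker ?a"] exI[of _ g]) simp
  ultimately show "\<exists>a. c_codiscrete A a \<and> isomorphic A (D (ker a)) X" by blast
qed simp_all

end

theorem theorem3p1:
  fixes A :: "('o, 'm) acat"
  assumes "abelian A" and "enough_projectives A"
  shows "c_two_abelian A \<and> discrete_equiv_via_coker A \<and> codiscrete_equiv_via_ker A"
proof -
  interpret abelian_projective A
    using assms by unfold_locales (auto simp: abelian_def)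
  show ?thesis using two_abelian discrete_equivalence codiscrete_equivalence by blast
qed

end
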